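(* Let $n\ge 1$, let $\Omega\subset\mathbb{R}^n$ be a nonempty open bounded convex set having diameter $d$, and let $2\le p<\infty$. Then $$\mu_p \ge \left(\frac{\pi_p}{d}\right)^p,$$ where $\mu_p=\mu_p(\Omega)$ is the first nontrivial Neumann eigenvalue of the $p$-Laplacian on $\Omega$ and $$\pi_p=2\int_0^{(p-1)^{1/p}}\frac{dt}{\left(1-\frac{t^p}{p-1}\right)^{1/p}}=2\pi\,\frac{(p-1)^{1/p}}{p\,\sin(\pi/p)}.$$
   Context: For an open bounded Lipschitz connected set $\Omega\subset\mathbb{R}^n$ and $p>1$, the first nontrivial Neumann eigenvalue of the $p$-Laplacian (i.e. of the problem $-\mathrm{div}(|Du|^{p-2}Du)=\mu_p|u|^{p-2}u$ in $\Omega$, $\partial u/\partial\nu=0$ on $\partial\Omega$) is characterized by $$\mu_p=\min\left\{\frac{\int_\Omega|Du|^p\,dx}{\int_\Omega|u|^p\,dx}\;:\;u\in W^{1,p}(\Omega),\ u\not\equiv 0,\ \int_\Omega|u|^{p-2}u\,dx=0\right\}.$$ Functions are real-valued, and $|u|^{p-2}u$ is understood to be $0$ where $u=0$. *)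

theory Defs
  imports "HOL-Analysis.Analysis"
begin

text \<open>\<open>C\<^sup>k\<close> functions on the whole space, by recursion over iterated partial derivatives.\<close>

primrec Ck :: "nat \<Rightarrow> ('a::euclidean_space \<Rightarrow> real) \<Rightarrow> bool" where
  "Ck 0 f \<longleftrightarrow> continuous_on UNIV f"
| "Ck (Suc k) f \<longleftrightarrow> (\<forall>x. f differentiable (at x)) \<and>
     (\<forall>b\<in>Basis. Ck k (\<lambda>x. frechet_derivative f (at x) b))"

text \<open>The space \<open>C\<^sub>c\<^sup>\<infinity>(\<Omega>)\<close>; its elements are represented by their extensions by zero.\<close>

definition test_functions :: "'a::euclidean_space set \<Rightarrow> ('a \<Rightarrow> real) set" where
  "test_functions \<Omega> = {\<phi>. (\<forall>k. Ck k \<phi>) \<and>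
     compact (closure {x. \<phi> x \<noteq> 0}) \<and> closure {x. \<phi> x \<noteq> 0} \<subseteq> \<Omega>}"

text \<open>Functions are not identified almost everywhere, and values outside \<open>\<Omega>\<close> are irrelevant.\<close>

definition in_Lp :: "real \<Rightarrow> 'a::euclidean_space set \<Rightarrow> ('a \<Rightarrow> 'b::real_normed_vector) \<Rightarrow> bool" where
  "in_Lp p \<Omega> f \<longleftrightarrow> f \<in> borel_measurable (lebesgue_on \<Omega>) \<and>
     integrable (lebesgue_on \<Omega>) (\<lambda>x. norm (f x) powr p)"

definition has_weak_gradient ::
    "('a::euclidean_space \<Rightarrow> real) \<Rightarrow> ('a \<Rightarrow> 'a) \<Rightarrow> 'a set \<Rightarrow> bool" where
  "has_weak_gradient u Du \<Omega> \<longleftrightarrow> (\<forall>\<phi>\<in>test_functions \<Omega>. \<forall>b\<in>Basis.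
     (LINT x|lebesgue_on \<Omega>. u x * frechet_derivative \<phi> (at x) b) =
     - (LINT x|lebesgue_on \<Omega>. (Du x \<bullet> b) * \<phi> x))"

text \<open>\<open>u \<in> W\<^sup>1\<^sup>,\<^sup>p(\<Omega>)\<close> with weak gradient \<open>Du\<close>. The gradient is determined by \<open>u\<close> up to null sets, so
  integrals such as \<open>\<integral>|Du|\<^sup>p\<close> depend on \<open>u\<close> only. The two \<open>L\<^sup>p\<close> conditions (for \<open>p \<ge> 1\<close>) guarantee
  that the integrals in \<open>has_weak_gradient\<close> exist.\<close>

definition in_W1p ::
    "real \<Rightarrow> 'a::euclidean_space set \<Rightarrow> ('a \<Rightarrow> real) \<Rightarrow> ('a \<Rightarrow> 'a) \<Rightarrow> bool" where
  "in_W1p p \<Omega> u Du \<longleftrightarrow> in_Lp p \<Omega> u \<and> in_Lp p \<Omega> Du \<and> has_weak_gradient u Du \<Omega>"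

text \<open>The first nontrivial Neumann eigenvalue of the \<open>p\<close>-Laplacian in its variational form, for
  \<open>p > 1\<close> and \<open>\<Omega>\<close> a bounded connected Lipschitz domain. For such \<open>\<Omega>\<close> the infimum is over a nonempty
  set of nonnegative reals and is attained. The factor \<open>u x\<close> makes \<open>|u|\<^sup>p\<^sup>-\<^sup>2 u\<close> vanish where \<open>u = 0\<close>.\<close>

definition neumann_eigenvalue :: "real \<Rightarrow> 'a::euclidean_space set \<Rightarrow> real" where
  "neumann_eigenvalue p \<Omega> = Inf
     {(LINT x|lebesgue_on \<Omega>. norm (Du x) powr p) / (LINT x|lebesgue_on \<Omega>. \<bar>u x\<bar> powr p) | u Du.
        in_W1p p \<Omega> u Du \<and>
        \<not> (AE x in lebesgue_on \<Omega>. u x = 0) \<and>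
        (LINT x|lebesgue_on \<Omega>. \<bar>u x\<bar> powr (p - 2) * u x) = 0}"

definition pi_p :: "real \<Rightarrow> real" where
  "pi_p p = 2 * (LBINT t=0..((p - 1) powr (1 / p)). 1 / (1 - t powr p / (p - 1)) powr (1 / p))"

end

theory Submission
  imports Defs
begin

text \<open>
  Every admissible quotient is at least \<open>(\<pi>\<^sub>p / d')\<^sup>p\<close> for each \<open>d' > d\<close>; that is the Poincare inequality
  \<open>\<lambda> \<integral>|u|\<^sup>p \<le> \<integral>|Du|\<^sup>p\<close> with \<open>\<lambda> = (\<pi>\<^sub>p / d')\<^sup>p\<close> under the constraint \<open>\<integral>|u|\<^sup>p\<^sup>-\<^sup>2 u = 0\<close>. The slack between
  \<open>d\<close> and \<open>d'\<close> absorbs all the approximations below. The proof follows the Payne--Weinberger method: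
  localize to thin convex sets, and compare these with weighted intervals.

  Localization (\<open>needle_localization\<close>). For a \<open>C\<^sup>1\<close> function \<open>u\<close> violating the inequality, a continuous
  function \<open>G = \<lambda>|u|\<^sup>p - |Du|\<^sup>p - \<delta>\<close> has nonnegative integral while \<open>|u|\<^sup>p\<^sup>-\<^sup>2 u\<close> has integral zero. Both
  properties pass to one of the two halves of a suitable hyperplane cut, and the cut can be made through
  any prescribed affine subspace of codimension two. Cutting through a countable dense family of such
  subspaces yields a decreasing sequence of convex sets that shrinks to a segment of length at most \<open>d\<close>.

  Thin convex sets (\<open>thin_convex_poincare\<close>). On a convex set close to a segment, \<open>u\<close> is almost a
  function of one variable, and the Lebesgue measure projects to a density on an interval. By the
  Brunn--Minkowski inequality (\<open>brunn_minkowski_multiplicative\<close>) the density is log-concave. The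
  constraint makes \<open>0\<close> the best constant for \<open>u\<close> in \<open>L\<^sup>p\<close> (\<open>abs_powr_tangent\<close>), so that it suffices to bound
  \<open>\<integral>|u - c|\<^sup>p\<close> for one constant \<open>c\<close>.

  Weighted intervals (\<open>log_concave_poincare_interval\<close>). For a log-concave weight \<open>f\<close> on an interval of
  length at most \<open>d'\<close> there is a point \<open>s\<^sub>0\<close>, depending on \<open>f\<close> only, such that
  \<open>\<lambda> \<integral>|v - v(s\<^sub>0)|\<^sup>p f \<le> \<integral>|v'|\<^sup>p f\<close> for all \<open>v\<close>, separately on both sides of \<open>s\<^sub>0\<close>. On one side this is a Hardy
  inequality, and it follows from a supersolution \<open>Z\<close> of the Riccati equation
  \<open>Z' = 1 + b Z + (\<lambda>/(p-1)) Z\<^sup>p\<close>, which governs \<open>Z = v/v'\<close> for the extremals with weight \<open>exp((p-1) b s)\<close>.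
  The solution with \<open>Z(s\<^sub>0) = 0\<close> lives for the time \<open>T(b) = \<integral>\<^sub>0\<^sup>\<infinity> dz / (1 + b z + (\<lambda>/(p-1)) z\<^sup>p)\<close>. It is here that
  \<open>\<pi>\<^sub>p\<close> enters: \<open>T(0) = d'/2\<close>. As \<open>T\<close> is convex, \<open>T(b) \<ge> d'/2 - \<kappa> b\<close> and \<open>T(-b) \<ge> d'/2 + \<kappa> b\<close>, so that an asymmetric
  position of \<open>s\<^sub>0\<close> is compensated by a slope \<open>b\<close> of the weight. A maximum point \<open>s\<^sub>0\<close> of \<open>f\<close> times a
  Gaussian has exactly the right relation between position and logarithmic slope.

  Sobolev functions (\<open>sobolev_poincare_convex\<close>). Mollification gives \<open>C\<^sup>1\<close> functions on the inner
  parallel sets of \<open>\<Omega>\<close>, which are convex and of no larger diameter, and does not increase the energy. The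
  functions converge almost everywhere along a subsequence, and Fatou's lemma concludes.
\<close>

section \<open>The constant \<open>\<pi>\<^sub>p\<close>\<close>

text \<open>The substitutions below turn both \<open>\<pi>\<^sub>p\<close> and the half-line integral of \<open>1/(1 + m z\<^sup>p)\<close> into this Beta
  integral, whose value comes from Euler's reflection formula.\<close>

lemma beta_integrand:
  fixes p :: real
  assumes p: "1 < p"
  defines "g \<equiv> (\<lambda>y. y powr (1/p - 1) * (1 - y) powr (- 1/p))"
  shows "set_integrable lborel (einterval 0 1) g"
    and "(LBINT y=0..1. g y) = pi / sin (pi / p)"
proof -
  have hi: "(g has_integral Beta (1/p) (1 - 1/p)) {0..1}"
    using has_integral_Beta_real[of "1/p" "1 - 1/p"] p by (simp add: g_def)
  have nn: "0 \<le> g y" for y by (simp add: g_def)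
  have "g absolutely_integrable_on {0..1}"
    using hi nn by (simp add: nonnegative_absolutely_integrable_1 has_integral_integrable)
  moreover have gm: "g \<in> borel_measurable borel" unfolding g_def by measurable
  ultimately have i01: "set_integrable lborel {0..1} g"
    unfolding absolutely_integrable_on_def set_integrable_def
    by (subst (asm) integrable_completion) auto
  then show si: "set_integrable lborel (einterval 0 1) g"
    by (rule set_integrable_subset) (auto simp: einterval_def zero_ereal_def one_ereal_def)
  have "(LBINT y=0..1. g y) = (LBINT y:{0..1}. g y)"
    using interval_integral_Icc[of 0 1 g] by (simp add: zero_ereal_def one_ereal_def)
  also have "\<dots> = integral {0..1} g"
    using i01 by (rule set_borel_integral_eq_integral)
  also have "\<dots> = Beta (1/p) (1 - 1/p)"
    using hi by (rule integral_unique)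
  also have "\<dots> = Gamma (1/p) * Gamma (1 - 1/p)"
    by (simp add: Beta_def)
  also have "\<dots> = pi / sin (pi / p)"
  proof -
    have "complex_of_real (Gamma (1/p) * Gamma (1 - 1/p)) = complex_of_real (pi / sin (pi / p))"
      using Gamma_reflection_complex[of "of_real (1/p)"] 
      by (simp flip: Gamma_complex_of_real sin_of_real)
    then show ?thesis by (simp only: of_real_eq_iff)
  qed
  finally show "(LBINT y=0..1. g y) = pi / sin (pi / p)" .
qed

text \<open>Substitute \<open>t = ((p - 1) y)\<close> to the power \<open>1/p\<close>.\<close>

lemma pi_p_eq:
  assumes p: "1 < p"
  shows "pi_p p = 2 * pi * ((p - 1) powr (1 / p) / (p * sin (pi / p)))"
proof -
  define c where "c = (p - 1) powr (1/p)"
  have c: "c > 0" "c powr p = p - 1" using p by (auto simp: c_def powr_powr)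
  define g where "g y = y powr (1/p - 1) * (1 - y) powr (- 1/p)" for y :: real
  define f where "f t = 1 / (1 - t powr p / (p - 1)) powr (1/p)" for t :: real
  define h where "h y = c * y powr (1/p)" for y :: real
  define h' where "h' y = c * (1/p * y powr (1/p - 1))" for y :: real
  have hp: "h y powr p = (p - 1) * y" if "0 < y" for y
    using that p c by (simp add: h_def powr_mult powr_powr)
  have fh: "f (h y) * h' y = (c / p) * g y" if "0 < y" "y < 1" for y
  proof -
    have "h y powr p / (p - 1) = y" using hp[OF that(1)] p by simp
    then have "f (h y) = (1 - y) powr (- 1/p)"
      using p by (simp add: f_def powr_minus divide_inverse)
    then show ?thesis by (simp add: h'_def g_def)
  qed
  have hB: "((ereal \<circ> h \<circ> real_of_ereal) \<longlongrightarrow> ereal c) (at_left 1)"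
  proof -
    have "(h \<longlongrightarrow> h 1) (at_left 1)" unfolding h_def by (intro tendsto_intros) auto
    then have "(h \<longlongrightarrow> c) (at_left 1)" by (simp add: h_def)
    then show ?thesis
      by (simp add: one_ereal_def ereal_tendsto_simps1(1)) (simp add: o_def)
  qed
  have hA: "((ereal \<circ> h \<circ> real_of_ereal) \<longlongrightarrow> ereal 0) (at_right 0)"
  proof -
    have "(h \<longlongrightarrow> c * 0 powr (1/p)) (at_right 0)" unfolding h_def
      by (intro tendsto_intros tendsto_powr2) (use p in \<open>auto simp: eventually_at_right_less eventually_at_filter\<close>)
    then have "(h \<longlongrightarrow> 0) (at_right 0)" by simp
    then show ?thesis
      by (simp add: zero_ereal_def ereal_tendsto_simps1(2)) (simp add: o_def)
  qed
  have "(LBINT t=0..c. f t) = (LBINT y=0..1. f (h y) * h' y)"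
    unfolding zero_ereal_def
  proof (rule interval_integral_substitution_nonneg(2)[where a = "ereal 0"])
    show "DERIV h y :> h' y" if "ereal 0 < ereal y" "ereal y < 1" for y
      using that p unfolding h_def h'_def
      by (auto intro!: derivative_eq_intros simp: one_ereal_def)
    show "isCont f (h y)" if "ereal 0 < ereal y" "ereal y < 1" for y
    proof -
      have "0 < y" "y < 1" using that by (auto simp: one_ereal_def)
      moreover have "h y > 0" using c \<open>0 < y\<close> by (simp add: h_def)
      ultimately show ?thesis using hp[of y] p unfolding f_def
        by (intro continuous_intros) auto
    qed
    show "isCont h' y" if "ereal 0 < ereal y" "ereal y < 1" for y
      using that p unfolding h'_def by (auto intro!: continuous_intros)
    show "set_integrable lborel (einterval (ereal 0) 1) (\<lambda>y. f (h y) * h' y)"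
      using beta_integrand(1)[OF p, folded g_def] 
      by (subst set_integrable_cong[where f' = "\<lambda>y. (c / p) * g y"])
         (auto simp: zero_ereal_def einterval_def one_ereal_def fh)
  qed (use c p hA hB in \<open>auto simp: f_def h'_def zero_ereal_def\<close>)
  also have "\<dots> = (LBINT y=0..1. (c / p) * g y)"
    by (rule interval_integral_cong) (auto simp: einterval_def zero_ereal_def one_ereal_def fh)
  also have "\<dots> = (c / p) * (pi / sin (pi / p))"
    using beta_integrand(2)[OF p] by (simp add: g_def)
  finally show ?thesis unfolding pi_p_def f_def c_def by simp
qed

lemma pi_p_pos: "1 < p \<Longrightarrow> 0 < pi_p p"
  by (simp add: pi_p_eq sin_gt_zero field_simps)

text \<open>The integral is the time that \<open>z' = 1 + m z\<^sup>p\<close> needs to go from \<open>0\<close> to \<open>Z\<close>. The bound on \<open>L\<close> says that \<open>L/2\<close> is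
  smaller than the blow-up time, which is computed by the substitution \<open>m z\<^sup>p = y/(1 - y)\<close>. Stopping at a
  finite \<open>Z\<close> keeps all later constructions on compact intervals.\<close>

lemma integral_inverse_one_plus_powr:
  fixes p m :: real
  assumes p: "1 < p" and m: "0 < m" and L: "L < 2 * m powr (- 1/p) * (pi / (p * sin (pi / p)))"
  shows "\<exists>Z>0. L / 2 \<le> integral {0..Z} (\<lambda>z. 1 / (1 + m * z powr p))"
proof -
  define g where "g y = y powr (1/p - 1) * (1 - y) powr (- 1/p)" for y :: real
  define f where "f z = 1 / (1 + m * z powr p)" for z :: real
  define h where "h y = (y / (m * (1 - y))) powr (1/p)" for y :: real
  define h' where "h' y = 1/p * (y / (m * (1 - y))) powr (1/p - 1) * (1 / (m * (1 - y)^2))" for y :: real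
  define c where "c = m powr (- 1/p)"
  have hp: "h y powr p = y / (m * (1 - y))" if "0 < y" "y < 1" for y
    using that p m by (simp add: h_def powr_powr)
  have fh: "f (h y) * h' y = (c / p) * g y" if "0 < y" "y < 1" for y
  proof -
    have "1 + m * h y powr p = 1 / (1 - y)"
      unfolding hp[OF that] using that m by (simp add: divide_simps)
    then have "f (h y) = 1 - y" by (simp add: f_def)
    moreover have "h' y = (1/p) * (y powr (1/p - 1) * m powr (1 - 1/p) * (1 - y) powr (1 - 1/p)) / (m * (1 - y)^2)"
    proof -
      have "(y / (m * (1 - y))) powr (1/p - 1) = y powr (1/p - 1) * (m powr (1 - 1/p) * (1 - y) powr (1 - 1/p))"
        using that m powr_minus_divide[of m "1 - 1/p"] powr_minus_divide[of "1 - y" "1 - 1/p"]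
        by (simp add: powr_divide powr_mult)
      then show ?thesis unfolding h'_def by simp
    qed
    moreover have "m powr (1 - 1/p) = m * c" using m by (simp add: c_def powr_diff powr_minus field_simps)
    moreover have "(1 - y) powr (1 - 1/p) = (1 - y) * (1 - y) powr (- 1/p)"
      using that by (simp add: powr_diff powr_minus field_simps)
    ultimately have "f (h y) = 1 - y" "h' y = (c / p) * g y / (1 - y)"
      using that m p by (simp_all add: g_def power2_eq_square divide_simps)
    then show ?thesis using that by simp
  qed
  have hB: "((ereal \<circ> h \<circ> real_of_ereal) \<longlongrightarrow> \<infinity>) (at_left 1)"
  proof -
    have "filterlim h at_top (at_left 1)" unfolding h_def
      using p m by real_asymp
    then show ?thesis
      by (simp only: one_ereal_def ereal_tendsto_simps)
  qed
  have hA: "((ereal \<circ> h \<circ> real_of_ereal) \<longlongrightarrow> 0) (at_right 0)"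
  proof -
    have "(h \<longlongrightarrow> 0) (at_right 0)" unfolding h_def
      using p m by real_asymp
    then show ?thesis
      by (simp add: zero_ereal_def ereal_tendsto_simps1(2)) (simp add: o_def)
  qed
  note sub = interval_integral_substitution_nonneg[where a = "0" and b = 1 and g=h and g'=h' and f=f and A = 0 and B = \<infinity>]
  have 1: "DERIV h y :> h' y" if "0 < ereal y" "ereal y < 1" for y
  proof -
    have "0 < y" "y < 1" using that by (auto simp: one_ereal_def)
    then have *: "((\<lambda>y. y / (m * (1 - y))) has_real_derivative 1 / (m * (1-y)^2)) (at y)"
      using m by (auto intro!: derivative_eq_intros simp: divide_simps power2_eq_square) (simp add: algebra_simps)
    show ?thesis unfolding h_def h'_def
      by (rule DERIV_cong[OF DERIV_fun_powr[OF *]]) (use \<open>0 < y\<close> \<open>y < 1\<close> m in auto)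
  qed
  have 2: "isCont f (h y)" if "0 < ereal y" "ereal y < 1" for y
  proof -
    have "0 < y" "y < 1" using that by (auto simp: one_ereal_def)
    moreover have "h y > 0" using m \<open>0 < y\<close> \<open>y < 1\<close> by (simp add: h_def)
    moreover have "1 + m * h y powr p > 0" using m by (simp add: add_pos_nonneg)
    ultimately show ?thesis unfolding f_def
      by (intro continuous_intros) auto
  qed
  have 3: "isCont h' y" if "0 < ereal y" "ereal y < 1" for y
    using that p m unfolding h'_def by (auto intro!: continuous_intros)
  have 4: "set_integrable lborel (einterval 0 1) (\<lambda>y. f (h y) * h' y)"
      using beta_integrand(1)[OF p, folded g_def] 
      by (subst set_integrable_cong[where f' = "\<lambda>y. (c / p) * g y"])
         (auto simp: zero_ereal_def einterval_def one_ereal_def fh)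
  have nnf: "0 \<le> f z" for z using m by (simp add: f_def)
  have nnh: "0 \<le> h' z" for z using m p by (simp add: h'_def)
  have fin: "set_integrable lborel (einterval 0 \<infinity>) f"
    by (rule sub(1)) (use 1 2 3 4 nnf nnh hA hB in auto)
  have "(LBINT z=0..\<infinity>. f z) = (LBINT y=0..1. f (h y) * h' y)"
    by (rule sub(2)) (use 1 2 3 4 nnf nnh hA hB in auto)
  also have "\<dots> = (LBINT y=0..1. (c / p) * g y)"
    by (rule interval_integral_cong) (auto simp: einterval_def zero_ereal_def one_ereal_def fh)
  also have "\<dots> = (c / p) * (pi / sin (pi / p))"
    using beta_integrand(2)[OF p] by (simp add: g_def)
  finally have val: "(LBINT z=0..\<infinity>. f z) = c * (pi / (p * sin (pi / p)))" by simp
  have "((\<lambda>Z. integral {0..Z} f) \<longlongrightarrow> (LBINT z:{0..}. f z)) at_top"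
  proof -
    have fin': "set_integrable lborel {0..} f"
    proof -
      have "AE z in lborel. z \<noteq> (0::real)" by (rule AE_lborel_singleton)
      then show ?thesis
        using fin unfolding set_integrable_def
        by (subst integrable_cong_AE[where g = "\<lambda>z. indicator (einterval 0 \<infinity>) z *\<^sub>R f z"])
          (auto simp: f_def einterval_def zero_ereal_def indicator_def)
    qed
    have "((\<lambda>Z. LBINT z:{0..Z}. f z) \<longlongrightarrow> (LBINT z:{0..}. f z)) at_top"
      by (rule tendsto_set_lebesgue_integral_at_top[OF _ fin']) auto
    moreover have "(LBINT z:{0..Z}. f z) = integral {0..Z} f" for Z
      by (intro set_borel_integral_eq_integral(2) set_integrable_subset[OF fin']) auto
    ultimately show ?thesis by simp
  qed
  moreover have "(LBINT z:{0..}. f z) = (LBINT z=0..\<infinity>. f z)"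
    unfolding zero_ereal_def interval_integral_to_infinity_eq
    by (rule set_integral_discrete_difference[where X = "{0}"]) auto
  ultimately have lim: "((\<lambda>Z. integral {0..Z} f) \<longlongrightarrow> c * (pi / (p * sin (pi / p)))) at_top"
    using val by simp
  have "L / 2 < c * (pi / (p * sin (pi / p)))" using L unfolding c_def by linarith
  from order_tendstoD(1)[OF lim this] have "\<forall>\<^sub>F Z in at_top. 0 < Z \<and> L / 2 < integral {0..Z} f"
    using eventually_gt_at_top[of 0] by eventually_elim auto
  then show ?thesis
    unfolding f_def by (auto dest!: eventually_happens intro: less_imp_le)
qed

section \<open>Hardy inequalities from Riccati supersolutions\<close>

lemma has_real_derivative_abs_powr:
  fixes x p :: real
  assumes "1 < p"
  shows "((\<lambda>x. \<bar>x\<bar> powr p) has_real_derivative p * \<bar>x\<bar> powr (p - 1) * sgn x) (at x)"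
proof -
  consider "x > 0" | "x < 0" | "x = 0" by linarith
  then show ?thesis
  proof cases
    case 1
    then have "((\<lambda>x. x powr p) has_real_derivative p * \<bar>x\<bar> powr (p - 1) * sgn x) (at x)"
      using assms by (auto intro!: derivative_eq_intros simp: sgn_if)
    then show ?thesis
      by (rule DERIV_cong_ev[OF refl _ refl, THEN iffD1, rotated])
         (use 1 eventually_nhds_in_open[of "{0<..}" x] in \<open>auto elim!: eventually_mono\<close>)
  next
    case 2
    then have "((\<lambda>x. (- x) powr p) has_real_derivative p * \<bar>x\<bar> powr (p - 1) * sgn x) (at x)"
      using assms by (auto intro!: derivative_eq_intros simp: sgn_if)
    then show ?thesis
      by (rule DERIV_cong_ev[OF refl _ refl, THEN iffD1, rotated])
         (use 2 eventually_nhds_in_open[of "{..<0}" x] in \<open>auto elim!: eventually_mono\<close>)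
  next
    case 3
    have "((\<lambda>h. \<bar>h\<bar> powr p / h) \<longlongrightarrow> 0) (at (0::real))"
    proof (rule tendsto_norm_zero_cancel, rule tendsto_cong[THEN iffD1])
      show "((\<lambda>h. \<bar>h\<bar> powr (p - 1)) \<longlongrightarrow> 0) (at (0::real))"
      proof -
        have "((\<lambda>h. \<bar>h\<bar> powr (p - 1)) \<longlongrightarrow> \<bar>0\<bar> powr (p - 1)) (at (0::real))"
          using assms by (intro tendsto_powr2 tendsto_intros) auto
        then show ?thesis by simp
      qed
      show "\<forall>\<^sub>F h in at (0::real). \<bar>h\<bar> powr (p - 1) = norm (\<bar>h\<bar> powr p / h)"
        by (auto simp: eventually_at_filter powr_diff)
    qed
    then show ?thesis using 3 assms by (simp add: DERIV_def)
  qed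
qed

text \<open>Picone's inequality: below \<open>r = |v|/Z\<close> and \<open>a = |v'|\<close>.\<close>

lemma Young_powr:
  fixes a r p :: real
  assumes p: "1 < p" and a: "0 \<le> a" and r: "0 \<le> r"
  shows "p * r powr (p - 1) * a \<le> a powr p + (p - 1) * r powr p"
proof (cases "a = 0 \<or> r = 0")
  case True
  then show ?thesis using p r by auto
next
  case False
  with a r have "a > 0" "r > 0" by auto
  have "(a powr p) powr (1/p) * (r powr p) powr ((p-1)/p) \<le> 1/p * a powr p + (p-1)/p * r powr p"
    by (rule Youngs_inequality_0) (use p \<open>a > 0\<close> \<open>r > 0\<close> in \<open>auto simp: field_simps\<close>)
  then have "p * (a * r powr (p - 1)) \<le> p * (1/p * a powr p + (p-1)/p * r powr p)"
    using p \<open>a > 0\<close> by (simp add: powr_powr)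
  also have "\<dots> = a powr p + (p - 1) * r powr p" using p by (simp add: field_simps)
  finally show ?thesis by (simp add: mult_ac)
qed

text \<open>\<open>Z\<close> is the inverse of a function \<open>T\<close> whose derivative \<open>t\<close> is positive with \<open>t (1 + b z + m z\<^sup>p) \<le> 1\<close>.
  Since \<open>b \<mapsto> 1/(1 + b z + m z\<^sup>p)\<close> is convex, \<open>t\<close> can be taken above the tangent at \<open>b = 0\<close>, and so
  \<open>T\<close> reaches at least the bound on \<open>l\<close>. The lower bound \<open>c s \<le> Z s\<close> controls the singularity of powers of
  \<open>1/Z\<close> at \<open>0\<close>.\<close>

lemma riccati_supersolution:
  fixes p m b Zm l :: real
  assumes p: "1 < p" and m: "0 < m" and Zm: "0 < Zm" and l: "0 < l"
    and le: "l \<le> integral {0..Zm} (\<lambda>z. 1 / (1 + m * z powr p))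
                   - b * integral {0..Zm} (\<lambda>z. z / (1 + m * z powr p)\<^sup>2)"
  obtains Z Z' c where "continuous_on {0..l} Z" "0 < c" "\<And>s. s \<in> {0..l} \<Longrightarrow> c * s \<le> Z s"
    "\<And>s. s \<in> {0<..<l} \<Longrightarrow> (Z has_real_derivative Z' s) (at s)"
    "\<And>s. s \<in> {0<..<l} \<Longrightarrow> 1 + b * Z s + m * Z s powr p \<le> Z' s"
proof -
  define A where "A z = 1 + m * z powr p" for z :: real
  have A: "1 \<le> A z" for z using m by (simp add: A_def)
  have contA: "continuous_on {0..Zm} A"
    unfolding A_def by (intro continuous_intros continuous_on_powr') (use p in auto)
  \<comment> \<open>For \<open>b < 0\<close> the tangent itself is positive, also where \<open>A + b z\<close> is not and the reciprocal is useless.\<close>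
  define t where "t z = (if 0 \<le> b then 1 / (A z + b * z) else 1 / A z - b * (z / (A z)\<^sup>2))" for z
  have Ab: "0 < A z + b * z" if "0 \<le> b" "z \<in> {0..Zm}" for z
    using A[of z] that by (simp add: add_pos_nonneg)
  have A0: "A z \<noteq> 0" for z using A[of z] by auto
  have contt: "continuous_on {0..Zm} t"
  proof (cases "0 \<le> b")
    case True
    have "continuous_on {0..Zm} (\<lambda>z. 1 / (A z + b * z))"
      by (intro continuous_intros contA ballI) (use Ab[OF True] in force)
    then show ?thesis using True by (simp add: t_def[abs_def])
  next
    case False
    have "continuous_on {0..Zm} (\<lambda>z. 1 / A z - b * (z / (A z)\<^sup>2))"
      by (intro continuous_intros contA ballI) (use A0 in auto)
    then show ?thesis using False by (simp add: t_def[abs_def])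
  qed
  have tpos: "0 < t z" if "z \<in> {0..Zm}" for z
  proof (cases "0 \<le> b")
    case True then show ?thesis using Ab that by (simp add: t_def)
  next
    case False
    then have "b * (z / (A z)\<^sup>2) \<le> 0" using that
      by (intro mult_nonpos_nonneg divide_nonneg_nonneg) auto
    moreover have "0 < 1 / A z" using A[of z] by simp
    ultimately have "0 < 1 / A z - b * (z / (A z)\<^sup>2)" by linarith
    then show ?thesis using False unfolding t_def by simp
  qed
  have key: "(1/A z - b * (z / (A z)\<^sup>2)) * (A z + b * z) \<le> 1" for z
  proof -
    have "(1/A z - b * (z / (A z)\<^sup>2)) * (A z + b * z) = 1 - (b * z / A z)\<^sup>2"
      using A0[of z] by (simp add: power2_eq_square divide_simps) (simp add: algebra_simps)
    then show ?thesis by simp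
  qed
  have t1: "t z * (A z + b * z) \<le> 1" if "z \<in> {0..Zm}" for z
    using key[of z] Ab[of z] that by (auto simp: t_def)
  have t2: "1/A z - b * (z / (A z)\<^sup>2) \<le> t z" if "z \<in> {0..Zm}" for z
    using key[of z] Ab[of z] that by (auto simp: t_def pos_le_divide_eq)
  define T where "T z = integral {0..z} t" for z
  have intt: "t integrable_on {0..z}" if "z \<le> Zm" for z
    by (rule integrable_continuous_real) (rule continuous_on_subset[OF contt], use that in auto)
  have i1: "(\<lambda>z. 1 / A z) integrable_on {0..Zm}"
    by (rule integrable_continuous_real) (use A0 in \<open>auto intro!: continuous_intros contA\<close>)
  have i2: "(\<lambda>z. z / (A z)\<^sup>2) integrable_on {0..Zm}"
    by (rule integrable_continuous_real) (use A0 in \<open>auto intro!: continuous_intros contA\<close>)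
  have i3: "(\<lambda>z. b * (z / (A z)\<^sup>2)) integrable_on {0..Zm}"
    by (rule integrable_on_mult_right[OF i2])
  have lT: "l \<le> T Zm"
  proof -
    have "l \<le> integral {0..Zm} (\<lambda>z. 1/A z) - integral {0..Zm} (\<lambda>z. b * (z / (A z)\<^sup>2))"
      using le unfolding A_def integral_mult_right .
    also have "\<dots> = integral {0..Zm} (\<lambda>z. 1/A z - b * (z / (A z)\<^sup>2))"
      by (rule integral_diff[OF i1 i3, symmetric])
    also have "\<dots> \<le> T Zm"
      unfolding T_def by (intro integral_le integrable_diff i1 i3 intt t2) auto
    finally show ?thesis .
  qed
  have Tder: "(T has_real_derivative t z) (at z within {0..Zm})" if "z \<in> {0..Zm}" for z
    unfolding T_def using integral_has_real_derivative[OF contt that] .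
  have contT: "continuous_on {0..Zm} T"
    using Tder by (rule DERIV_continuous_on)
  have Tmono: "T x < T y" if "0 \<le> x" "x < y" "y \<le> Zm" for x y
  proof (rule DERIV_pos_imp_increasing_open[OF that(2)])
    show "\<exists>d. (T has_real_derivative d) (at z) \<and> 0 < d" if "x < z" "z < y" for z
      using Tder[of z] tpos[of z] that \<open>0 \<le> x\<close> \<open>y \<le> Zm\<close>
      by (intro exI[of _ "t z"]) (auto simp: at_within_Icc_at)
    show "continuous_on {x..y} T"
      using contT by (rule continuous_on_subset) (use that in auto)
  qed
  have injT: "inj_on T {0..Zm}"
    by (intro linorder_inj_onI) (auto dest: Tmono)
  have T0: "T 0 = 0" by (simp add: T_def)
  have ex: "\<exists>z\<in>{0..Zm}. T z = s" if "s \<in> {0..l}" for s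
    using IVT'[of T 0 s Zm] that lT T0 contT Zm by auto
  define Z where "Z = the_inv_into {0..Zm} T"
  have ZT: "T (Z s) = s" "Z s \<in> {0..Zm}" if "s \<in> {0..l}" for s
  proof -
    have "s \<in> T ` {0..Zm}" using ex[OF that] by auto
    then show "T (Z s) = s" "Z s \<in> {0..Zm}"
      unfolding Z_def using injT by (auto intro: f_the_inv_into_f the_inv_into_into[where B = "{0..Zm}"] simp del: atLeastAtMost_iff)
  qed
  have contZ: "continuous_on {0..l} Z"
  proof (rule continuous_on_subset)
    show "continuous_on (T ` {0..Zm}) Z"
      by (rule continuous_on_inv[OF contT]) (auto simp: Z_def the_inv_into_f_f injT)
    show "{0..l} \<subseteq> T ` {0..Zm}"
    proof
      fix s assume "s \<in> {0..l}"
      from ex[OF this] show "s \<in> T ` {0..Zm}" by auto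
    qed
  qed
  have Zint: "0 < Z s" "Z s < Zm" if "s \<in> {0<..<l}" for s
  proof -
    have "Z s \<noteq> 0" "Z s \<noteq> Zm" using ZT(1)[of s] that T0 lT by auto
    then show "0 < Z s" "Z s < Zm" using ZT(2)[of s] that by auto
  qed
  have Zder: "(Z has_real_derivative inverse (t (Z s))) (at s)" if "s \<in> {0<..<l}" for s
  proof (rule DERIV_inverse_function[where a = 0 and b = l])
    show "(T has_real_derivative t (Z s)) (at (Z s))"
      using Tder[of "Z s"] Zint[OF that] by (simp add: at_within_Icc_at)
    show "t (Z s) \<noteq> 0" using tpos[of "Z s"] Zint[OF that] by auto
    show "isCont Z s"
      using contZ that by (intro continuous_on_interior[of "{0..l}"]) auto
  qed (use that ZT in auto)
  obtain M where M: "\<And>z. z \<in> {0..Zm} \<Longrightarrow> t z \<le> M"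
    using continuous_attains_sup[of "{0..Zm}" t] contt Zm by fastforce
  have Mpos: "0 < M" using M[of 0] tpos[of 0] Zm by auto
  show thesis
  proof (rule that[of Z "1/M" "\<lambda>s. inverse (t (Z s))"])
    show "1 / M * s \<le> Z s" if "s \<in> {0..l}" for s
    proof -
      have "s = integral {0..Z s} t" using ZT[OF that] by (simp add: T_def)
      also have "\<dots> \<le> integral {0..Z s} (\<lambda>_. M)"
        using ZT[OF that] by (intro integral_le intt M) auto
      also have "\<dots> = Z s * M" using ZT[OF that] by simp
      finally show ?thesis using Mpos by (simp add: field_simps)
    qed
    show "1 + b * Z s + m * Z s powr p \<le> inverse (t (Z s))" if "s \<in> {0<..<l}" for s
      using t1[of "Z s"] tpos[of "Z s"] Zint[OF that] 
      by (simp add: A_def field_simps)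
  qed (use contZ Mpos Zder in auto)
qed

text \<open>The second mean value theorem contains the integrability of the product.\<close>

lemma antimono_mult_integrable:
  fixes w k :: "real \<Rightarrow> real"
  assumes "k integrable_on {a..b}" "a \<le> b" "\<And>x y. \<lbrakk>a \<le> x; x \<le> y; y \<le> b\<rbrakk> \<Longrightarrow> w y \<le> w x"
  shows "(\<lambda>x. w x * k x) integrable_on {a..b}"
proof -
  have "\<exists>c\<in>{a..b}. ((\<lambda>x. - w x * k x) has_integral (- w a * integral {a..c} k + - w b * integral {c..b} k)) {a..b}"
    using second_mean_value_theorem_full[of k a b "\<lambda>x. - w x"] assms by fastforce
  then have "(\<lambda>x. - w x * k x) integrable_on {a..b}" by (auto simp: integrable_on_def)
  from integrable_neg[OF this] show ?thesis by simp
qed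

text \<open>With \<open>\<beta> = (p - 1) b\<close> and \<open>E = |v|\<^sup>p Z\<^sup>1\<^sup>-\<^sup>p exp(\<beta> s)\<close>, Young's inequality and the differential inequality for
  \<open>Z\<close> give \<open>|v'|\<^sup>p - (p - 1) m |v|\<^sup>p \<ge> E' exp(-\<beta> s)\<close>. Multiplied by \<open>f\<close>, the right-hand side is \<open>E'\<close> times a
  decreasing weight, and as \<open>E\<close> is nonnegative and vanishes at \<open>0\<close> its integral is nonnegative.\<close>

lemma hardy_half_interval:
  fixes p m b Zm l :: real and v v' f :: "real \<Rightarrow> real"
  assumes p: "1 < p" and m: "0 < m" and Zm: "0 < Zm" and l: "0 \<le> l"
    and le: "l \<le> integral {0..Zm} (\<lambda>z. 1 / (1 + m * z powr p))
                   - b * integral {0..Zm} (\<lambda>z. z / (1 + m * z powr p)\<^sup>2)"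
    and v: "\<And>x. (v has_real_derivative v' x) (at x)" and v': "continuous_on UNIV v'" and v0: "v 0 = 0"
    and f: "\<And>x. 0 \<le> x \<Longrightarrow> x \<le> l \<Longrightarrow> 0 \<le> f x"
    and fmono: "\<And>x y. \<lbrakk>0 \<le> x; x \<le> y; y \<le> l\<rbrakk> \<Longrightarrow> f y * exp (- ((p-1) * b) * y) \<le> f x * exp (- ((p-1) * b) * x)"
  shows "(p - 1) * m * integral {0..l} (\<lambda>x. \<bar>v x\<bar> powr p * f x) \<le> integral {0..l} (\<lambda>x. \<bar>v' x\<bar> powr p * f x)"
proof (cases "l = 0")
  case False
  with l have l: "0 < l" by simp
  obtain Z Z' c where Z: "continuous_on {0..l} Z" "0 < c" "\<And>s. s \<in> {0..l} \<Longrightarrow> c * s \<le> Z s"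
    "\<And>s. s \<in> {0<..<l} \<Longrightarrow> (Z has_real_derivative Z' s) (at s)"
    "\<And>s. s \<in> {0<..<l} \<Longrightarrow> 1 + b * Z s + m * Z s powr p \<le> Z' s"
    by (rule riccati_supersolution[OF p m Zm l le]) blast
  define \<beta> where "\<beta> = (p - 1) * b"
  define w where "w x = f x * exp (- \<beta> * x)" for x
  have fw: "f x = w x * exp (\<beta> * x)" for x by (simp add: w_def flip: exp_add)
  have wmono: "w y \<le> w x" if "0 \<le> x" "x \<le> y" "y \<le> l" for x y
    using fmono[OF that] by (simp add: w_def \<beta>_def)
  have w0: "0 \<le> w x" if "0 \<le> x" "x \<le> l" for x using f[OF that] by (simp add: w_def)
  have contv: "continuous_on S v" for S
    by (rule DERIV_continuous_on[OF has_field_derivative_at_within[OF v]])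
  have contv': "continuous_on S v'" for S using v' continuous_on_subset by blast
  have Zpos: "0 < Z s" if "s \<in> {0<..l}" for s
    using Z(2) Z(3)[of s] that by (smt (verit) atLeastAtMost_iff greaterThanAtMost_iff mult_pos_pos)
  define E where "E s = \<bar>v s\<bar> powr p * Z s powr (- (p - 1)) * exp (\<beta> * s)" for s
  \<comment> \<open>The derivative of \<open>E\<close>; at the endpoints, a value for which the pointwise comparison persists.\<close>
  define D where "D s = (if s \<in> {0<..<l} then exp (\<beta> * s) * 
      (p * \<bar>v s\<bar> powr (p - 1) * sgn (v s) * v' s * Z s powr (- (p - 1))
       - (p - 1) * \<bar>v s\<bar> powr p * Z s powr (- p) * Z' s + \<beta> * \<bar>v s\<bar> powr p * Z s powr (- (p - 1)))
      else - ((p - 1) * m * \<bar>v s\<bar> powr p) * exp (\<beta> * s))" for s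
  have E0: "E 0 = 0" using v0 p by (simp add: E_def)
  have Enn: "0 \<le> E s" for s by (simp add: E_def)
  have contabs: "continuous_on S (\<lambda>x. \<bar>v x\<bar> powr p)" "continuous_on S (\<lambda>x. \<bar>v' x\<bar> powr p)" for S
    using p by (auto intro!: continuous_on_powr' continuous_on_rabs contv contv' continuous_on_const)
  have contE: "continuous_on {0..l} E"
  proof -
    have "compact ((\<lambda>s. v' s) ` {0..l})"
      by (rule compact_continuous_image[OF contv' compact_Icc])
    then have "bounded (v' ` {0..l})" by (rule compact_imp_bounded)
    then obtain M where "\<forall>y \<in> v' ` {0..l}. norm y \<le> M" unfolding bounded_iff ..
    then have M: "\<bar>v' s\<bar> \<le> M" if "s \<in> {0..l}" for s using that by simp
    have M0: "0 \<le> M" using M[of 0] l by auto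
    have vM: "\<bar>v s\<bar> \<le> M * s" if "s \<in> {0..l}" for s
    proof -
      have "norm (v s - v 0) \<le> M * norm (s - 0)"
        by (rule field_differentiable_bound[of "{0..l}" v v'])
           (use v M that l in \<open>auto intro: has_field_derivative_at_within\<close>)
      then show ?thesis using that v0 by simp
    qed
    have EM: "E s \<le> (M powr p * c powr (- (p - 1)) * exp (\<bar>\<beta>\<bar> * l)) * s" if "s \<in> {0..l}" for s
    proof (cases "s = 0")
      case False
      with that have s: "0 < s" "s \<le> l" by auto
      have "E s \<le> (M * s) powr p * (c * s) powr (- (p - 1)) * exp (\<bar>\<beta>\<bar> * l)"
        unfolding E_def
      proof (intro mult_mono)
        show "\<bar>v s\<bar> powr p \<le> (M * s) powr p" using vM[OF that] p by (intro powr_mono2) auto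
        show "Z s powr - (p - 1) \<le> (c * s) powr - (p - 1)"
          using Z(2) Z(3)[OF that] p s by (intro powr_mono2') auto
        have "\<beta> * s \<le> \<bar>\<beta>\<bar> * l" using s by (intro mult_mono) auto
        then show "exp (\<beta> * s) \<le> exp (\<bar>\<beta>\<bar> * l)" by simp
      qed auto
      also have "(M * s) powr p * (c * s) powr (- (p - 1)) = M powr p * c powr (- (p - 1)) * (s powr p * s powr (- (p - 1)))"
        using M0 Z(2) s by (simp add: powr_mult)
      also have "s powr p * s powr (- (p - 1)) = s" using s by (simp flip: powr_add)
      finally show ?thesis by (simp add: mult_ac)
    qed (simp add: E0)
    have "continuous (at s within {0..l}) E" if "s \<in> {0..l}" for s
    proof (cases "s = 0")
      case True
      have "(E \<longlongrightarrow> 0) (at 0 within {0..l})"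
      proof (rule tendsto_sandwich[of "\<lambda>_. 0" E _ "\<lambda>s. (M powr p * c powr (- (p - 1)) * exp (\<bar>\<beta>\<bar> * l)) * s"])
        show "\<forall>\<^sub>F s in at 0 within {0..l}. E s \<le> (M powr p * c powr (- (p - 1)) * exp (\<bar>\<beta>\<bar> * l)) * s"
          using EM by (auto simp: eventually_at_filter)
        have "((\<lambda>s. (M powr p * c powr (- (p - 1)) * exp (\<bar>\<beta>\<bar> * l)) * s) \<longlongrightarrow> (M powr p * c powr (- (p - 1)) * exp (\<bar>\<beta>\<bar> * l)) * 0) (at 0 within {0..l})"
          by (intro tendsto_intros)
        then show "((\<lambda>s. (M powr p * c powr (- (p - 1)) * exp (\<bar>\<beta>\<bar> * l)) * s) \<longlongrightarrow> 0) (at 0 within {0..l})" by simp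
      qed (auto simp: Enn)
      then show ?thesis using True E0 by (simp add: continuous_within)
    next
      case False
      with that have s: "s \<in> {0<..l}" by auto
      have "continuous (at s within {0..l}) Z" "continuous (at s within {0..l}) v"
        using Z(1) contv that by (auto simp: continuous_on_eq_continuous_within)
      then show ?thesis unfolding E_def using Zpos[OF s] p
        by (intro continuous_intros) (auto simp: )
    qed
    then show ?thesis by (simp add: continuous_on_eq_continuous_within)
  qed
  have Eder: "(E has_real_derivative D s) (at s)" if s: "s \<in> {0<..<l}" for s
  proof -
    have 1: "((\<lambda>s. \<bar>v s\<bar> powr p) has_real_derivative p * \<bar>v s\<bar> powr (p - 1) * sgn (v s) * v' s) (at s)"
      by (rule DERIV_chain2[OF has_real_derivative_abs_powr[OF p] v])
    have 2: "((\<lambda>s. Z s powr (- (p - 1))) has_real_derivative (- (p - 1)) * Z s powr (- (p-1) - 1) * Z' s) (at s)"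
      using DERIV_fun_powr[OF Z(4)[OF s], of "- (p - 1)"] Zpos[of s] s by simp
    have 3: "((\<lambda>s. exp (\<beta> * s)) has_real_derivative \<beta> * exp (\<beta> * s)) (at s)"
      by (auto intro!: derivative_eq_intros)
    show ?thesis unfolding E_def D_def
      by (rule DERIV_cong[OF DERIV_mult[OF DERIV_mult[OF 1 2] 3]]) (use s in \<open>simp add: algebra_simps\<close>)
  qed
  have FTC: "(D has_integral (E y - E x)) {x..y}" if "0 \<le> x" "x \<le> y" "y \<le> l" for x y
  proof (rule fundamental_theorem_of_calculus_interior[OF that(2)])
    show "continuous_on {x..y} E" using contE by (rule continuous_on_subset) (use that in auto)
    show "(E has_vector_derivative D z) (at z)" if "z \<in> {x<..<y}" for z
      using Eder[of z] that \<open>0 \<le> x\<close> \<open>y \<le> l\<close> by (simp add: has_real_derivative_iff_has_vector_derivative)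
  qed
  have Dint: "D integrable_on {0..l}" using FTC[of 0 l] l by (auto simp: integrable_on_def)
  obtain \<xi> where \<xi>: "\<xi> \<in> {0..l}" "integral {0..l} (\<lambda>x. - w x * D x) = - w 0 * integral {0..\<xi>} D + - w l * integral {\<xi>..l} D"
    using second_mean_value_theorem[OF Dint, of "\<lambda>x. - w x"] wmono l by auto
  have "integral {0..l} (\<lambda>x. w x * D x) = w 0 * E \<xi> + w l * (E l - E \<xi>)"
    using \<xi> FTC[of 0 \<xi>] FTC[of \<xi> l] E0 by (simp add: integral_unique)
  also have "\<dots> = (w 0 - w l) * E \<xi> + w l * E l" by (simp add: algebra_simps)
  also have "\<dots> \<ge> 0" using wmono[of 0 l] w0[of l] l Enn by simp
  finally have pos: "0 \<le> integral {0..l} (\<lambda>x. w x * D x)" .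
  have i1: "(\<lambda>x. \<bar>v x\<bar> powr p * f x) integrable_on {0..l}"
  proof -
    have "(\<lambda>x. w x * (\<bar>v x\<bar> powr p * exp (\<beta> * x))) integrable_on {0..l}"
      using l wmono by (intro antimono_mult_integrable integrable_continuous_real continuous_intros contabs) auto
    then show ?thesis by (simp add: fw mult_ac)
  qed
  have i2: "(\<lambda>x. \<bar>v' x\<bar> powr p * f x) integrable_on {0..l}"
  proof -
    have "(\<lambda>x. w x * (\<bar>v' x\<bar> powr p * exp (\<beta> * x))) integrable_on {0..l}"
      using l wmono by (intro antimono_mult_integrable integrable_continuous_real continuous_intros contabs) auto
    then show ?thesis by (simp add: fw mult_ac)
  qed
  have i3: "(\<lambda>x. w x * D x) integrable_on {0..l}"
    using l wmono by (intro antimono_mult_integrable Dint) auto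
  have ptw: "w s * D s \<le> \<bar>v' s\<bar> powr p * f s - (p - 1) * m * (\<bar>v s\<bar> powr p * f s)" if "s \<in> {0..l}" for s
  proof (cases "s \<in> {0<..<l}")
    case False
    then have "w s * D s = - ((p - 1) * m * (\<bar>v s\<bar> powr p * f s))" by (auto simp: D_def fw)
    then show ?thesis using f[of s] that by simp
  next
    case True
    have zp: "0 < Z s" using Zpos True by auto
    define r where "r = \<bar>v s\<bar> / Z s"
    have r: "r powr p = \<bar>v s\<bar> powr p * Z s powr (- p)" "r powr (p - 1) = \<bar>v s\<bar> powr (p-1) * Z s powr (-(p-1))"
      using zp by (simp_all add: r_def powr_divide powr_minus powr_diff field_simps)
    have "p * \<bar>v s\<bar> powr (p - 1) * sgn (v s) * v' s * Z s powr (- (p - 1)) \<le> p * r powr (p - 1) * \<bar>v' s\<bar>"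
    proof -
      have "sgn (v s) * v' s \<le> \<bar>v' s\<bar>" by (auto simp: sgn_if)
      then have "(p * \<bar>v s\<bar> powr (p - 1) * Z s powr (- (p - 1))) * (sgn (v s) * v' s) \<le> (p * \<bar>v s\<bar> powr (p - 1) * Z s powr (- (p - 1))) * \<bar>v' s\<bar>"
        using p by (intro mult_left_mono) auto
      then show ?thesis by (simp add: r mult_ac)
    qed
    also have "\<dots> \<le> \<bar>v' s\<bar> powr p + (p - 1) * r powr p"
      using zp by (intro Young_powr p) (auto simp: r_def)
    finally have Y: "p * \<bar>v s\<bar> powr (p - 1) * sgn (v s) * v' s * Z s powr (- (p - 1)) \<le> \<bar>v' s\<bar> powr p + (p - 1) * r powr p" .
    have e1: "\<bar>v s\<bar> powr p * Z s powr (- (p - 1)) = r powr p * Z s"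
      using zp by (simp add: r powr_diff powr_minus field_simps)
    have e2: "\<bar>v s\<bar> powr p = r powr p * Z s powr p"
      using zp by (simp add: r powr_minus field_simps)
    have "(p - 1) * r powr p + \<beta> * (\<bar>v s\<bar> powr p * Z s powr (- (p - 1))) + (p-1) * m * \<bar>v s\<bar> powr p
        = (p - 1) * (r powr p * (1 + b * Z s + m * Z s powr p))"
      unfolding \<beta>_def e1 unfolding e2 by (simp add: algebra_simps)
    also have "\<dots> \<le> (p - 1) * (r powr p * Z' s)"
      using p Z(5)[OF True] by (intro mult_left_mono) auto
    also have "\<dots> = (p - 1) * \<bar>v s\<bar> powr p * Z s powr (- p) * Z' s"
      by (simp only: r(1) mult.assoc)
    finally have "(p - 1) * r powr p + \<beta> * (\<bar>v s\<bar> powr p * Z s powr (- (p - 1))) + (p-1) * m * \<bar>v s\<bar> powr p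
        \<le> (p - 1) * \<bar>v s\<bar> powr p * Z s powr (- p) * Z' s" .
    with Y have B: "p * \<bar>v s\<bar> powr (p - 1) * sgn (v s) * v' s * Z s powr (- (p - 1))
       - (p - 1) * \<bar>v s\<bar> powr p * Z s powr (- p) * Z' s + \<beta> * \<bar>v s\<bar> powr p * Z s powr (- (p - 1))
       \<le> \<bar>v' s\<bar> powr p - (p-1) * m * \<bar>v s\<bar> powr p"
      by (simp add: mult.assoc)
    have "w s * D s = f s * (p * \<bar>v s\<bar> powr (p - 1) * sgn (v s) * v' s * Z s powr (- (p - 1))
       - (p - 1) * \<bar>v s\<bar> powr p * Z s powr (- p) * Z' s + \<beta> * \<bar>v s\<bar> powr p * Z s powr (- (p - 1)))"
      using True by (simp add: D_def fw)
    also have "\<dots> \<le> f s * (\<bar>v' s\<bar> powr p - (p-1) * m * \<bar>v s\<bar> powr p)"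
      using B f[of s] that by (intro mult_left_mono) auto
    finally show ?thesis by (simp add: algebra_simps)
  qed
  have "integral {0..l} (\<lambda>x. w x * D x) \<le> integral {0..l} (\<lambda>s. \<bar>v' s\<bar> powr p * f s - (p - 1) * m * (\<bar>v s\<bar> powr p * f s))"
    by (intro integral_le integrable_diff i2 i3 integrable_on_mult_right[OF i1] ptw)
  also have "\<dots> = integral {0..l} (\<lambda>s. \<bar>v' s\<bar> powr p * f s) - (p - 1) * m * integral {0..l} (\<lambda>s. \<bar>v s\<bar> powr p * f s)"
    by (subst integral_diff[OF i2 integrable_on_mult_right[OF i1]]) simp
  finally show ?thesis using pos by simp
qed simp

section \<open>The Poincare inequality for log-concave weights on an interval\<close>

lemma integral_reflect_about:
  fixes f :: "real \<Rightarrow> real"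
  assumes "a \<le> b"
  shows "integral {0..b - a} (\<lambda>x. f (b - x)) = integral {a..b} f"
proof -
  have "integral {0..b - a} (\<lambda>x. f (b - x)) = integral {- (b - a)..-0} (\<lambda>x. f (b + x))"
    using Henstock_Kurzweil_Integration.integral_reflect_real[of 0 "a - b" "\<lambda>x. f (b + x)"]
    by (simp del: Henstock_Kurzweil_Integration.integral_reflect_real)
  also have "\<dots> = integral {a..b} f"
    using integral_shift_real_ivl[of a b b f] by (simp add: add.commute)
  finally show ?thesis .
qed

text \<open>Let \<open>s\<^sub>0\<close> maximize \<open>f\<close> times a Gaussian centred at the midpoint. At \<open>s\<^sub>0\<close> the logarithm of \<open>f\<close>
  has a supporting line with the slope \<open>\<beta> = (p - 1)(s\<^sub>0 - mid)/\<kappa>\<close> of the inverse Gaussian, so that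
  \<open>f exp(-\<beta> s)\<close> increases up to \<open>s\<^sub>0\<close> and decreases after it. With \<open>b = (s\<^sub>0 - mid)/\<kappa>\<close> the lengths of the two sides of \<open>s\<^sub>0\<close> are
  \<open>(\<omega> - \<alpha>)/2 - \<kappa> b\<close> and \<open>(\<omega> - \<alpha>)/2 + \<kappa> b\<close>, which are the lengths allowed by \<open>hardy_half_interval\<close>
  for the slopes \<open>b\<close> and \<open>-b\<close>.\<close>

lemma log_concave_poincare_interval:
  fixes p m Zm \<alpha> \<omega> :: real and f :: "real \<Rightarrow> real"
  assumes p: "1 < p" and m: "0 < m" and Zm: "0 < Zm" and le: "\<alpha> \<le> \<omega>"
    and L: "(\<omega> - \<alpha>) / 2 \<le> integral {0..Zm} (\<lambda>z. 1 / (1 + m * z powr p))"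
    and f0: "\<And>x. 0 \<le> f x" and contf: "continuous_on {\<alpha>..\<omega>} f" and fpos: "\<exists>x\<in>{\<alpha>..\<omega>}. 0 < f x"
    and lc: "\<And>x y t. \<lbrakk>x \<in> {\<alpha>..\<omega>}; y \<in> {\<alpha>..\<omega>}; 0 < t; t < 1\<rbrakk> \<Longrightarrow> f x powr (1 - t) * f y powr t \<le> f ((1 - t) * x + t * y)"
  obtains s0 where "s0 \<in> {\<alpha>..\<omega>}" and "\<And>v v'. \<lbrakk>\<And>x. (v has_real_derivative v' x) (at x); continuous_on UNIV v'\<rbrakk> \<Longrightarrow>
      (p - 1) * m * integral {\<alpha>..\<omega>} (\<lambda>x. \<bar>v x - v s0\<bar> powr p * f x) \<le> integral {\<alpha>..\<omega>} (\<lambda>x. \<bar>v' x\<bar> powr p * f x)"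
proof -
  define \<kappa> where "\<kappa> = integral {0..Zm} (\<lambda>z. z / (1 + m * z powr p)\<^sup>2)"
  define mid where "mid = (\<alpha> + \<omega>) / 2"
  have \<kappa>: "0 < \<kappa>"
  proof -
    have c: "continuous_on {0..Zm} (\<lambda>z. z / (1 + m * z powr p)\<^sup>2)"
    proof (intro continuous_on_divide continuous_on_power continuous_on_add continuous_on_mult continuous_on_const continuous_on_id continuous_on_powr' ballI)
      show "(1 + m * z powr p)\<^sup>2 \<noteq> 0" for z using m by (simp add: add_pos_nonneg pos_add_strict less_imp_neq[symmetric])
    qed (use p in auto)
    have "0 \<le> \<kappa>" unfolding \<kappa>_def
      by (intro integral_nonneg integrable_continuous_real c) auto
    moreover have "\<kappa> \<noteq> 0"
    proof
      assume "\<kappa> = 0"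
      then have "\<forall>z\<in>{0..Zm}. z / (1 + m * z powr p)\<^sup>2 = 0"
        using integral_eq_0_iff[OF c] Zm unfolding \<kappa>_def by auto
      then have "Zm / (1 + m * Zm powr p)\<^sup>2 = 0" using Zm by (meson atLeastAtMost_iff less_imp_le order_refl)
      moreover have "0 < 1 + m * Zm powr p" using m by (simp add: add_pos_nonneg)
      ultimately show False using Zm by simp
    qed
    ultimately show ?thesis by simp
  qed
  define C where "C = (p - 1) / (2 * \<kappa>)"
  have C: "0 < C" using p \<kappa> by (simp add: C_def)
  define G where "G s = f s * exp (- (C * (s - mid)\<^sup>2))" for s
  have "continuous_on {\<alpha>..\<omega>} G" unfolding G_def by (intro continuous_intros contf)
  then obtain s0 where s0: "s0 \<in> {\<alpha>..\<omega>}" "\<And>s. s \<in> {\<alpha>..\<omega>} \<Longrightarrow> G s \<le> G s0"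
    using continuous_attains_sup[of "{\<alpha>..\<omega>}" G] le by fastforce
  obtain x1 where x1: "x1 \<in> {\<alpha>..\<omega>}" "0 < f x1" using fpos by auto
  have fs0: "0 < f s0"
  proof -
    have "0 < G x1" using x1 by (simp add: G_def)
    also have "\<dots> \<le> G s0" using s0 x1 by simp
    finally show ?thesis by (simp add: G_def zero_less_mult_iff)
  qed
  define b where "b = (s0 - mid) / \<kappa>"
  define \<beta> where "\<beta> = (p - 1) * b"
  define F where "F s = f s * exp (- \<beta> * s)" for s
  have F0: "0 \<le> F s" for s using f0 by (simp add: F_def)
  have Fs0: "0 < F s0" using fs0 by (simp add: F_def)
  have \<beta>C: "\<beta> = 2 * C * (s0 - mid)" using \<kappa> by (simp add: \<beta>_def b_def C_def field_simps)
  have Flc: "F x powr (1 - t) * F y powr t \<le> F ((1 - t) * x + t * y)"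
    if "x \<in> {\<alpha>..\<omega>}" "y \<in> {\<alpha>..\<omega>}" "0 < t" "t < 1" for x y t
  proof -
    have "F x powr (1 - t) * F y powr t = (f x powr (1 - t) * f y powr t) * (exp (- \<beta> * x * (1 - t)) * exp (- \<beta> * y * t))"
      using f0 by (simp add: F_def powr_mult exp_powr_real)
    also have "exp (- \<beta> * x * (1 - t)) * exp (- \<beta> * y * t) = exp (- \<beta> * ((1 - t) * x + t * y))"
      by (simp add: algebra_simps flip: exp_add)
    finally show ?thesis unfolding F_def using lc[OF that] by (simp add: mult_right_mono)
  qed
  \<comment> \<open>Log-concavity makes an excess over \<open>F s0\<close> grow linearly along the segment from \<open>s0\<close>, but the choice of
    \<open>s0\<close> allows only quadratic growth.\<close>
  have Fmax: "F s \<le> F s0" if s: "s \<in> {\<alpha>..\<omega>}" for s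
  proof (rule ccontr)
    assume "\<not> F s \<le> F s0"
    then have gt: "F s0 < F s" by simp
    define \<eta> where "\<eta> = ln (F s / F s0)"
    have \<eta>: "0 < \<eta>" using gt Fs0 by (simp add: \<eta>_def)
    have bd: "\<eta> \<le> C * t * (s - s0)\<^sup>2" if t: "0 < t" "t < 1" for t
    proof -
      define y where "y = (1 - t) * s0 + t * s"
      have y: "y \<in> {\<alpha>..\<omega>}"
      proof -
        have "(1 - t) *\<^sub>R s0 + t *\<^sub>R s \<in> {\<alpha>..\<omega>}"
          by (rule convexD_alt) (use s s0 t in auto)
        then show ?thesis by (simp add: y_def)
      qed
      have "F s0 powr (1 - t) * F s powr t = F s0 * exp (t * \<eta>)"
      proof -
        have "F s0 powr (1 - t) * F s powr t = exp ((1 - t) * ln (F s0) + t * ln (F s))"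
          using Fs0 gt by (simp add: powr_def exp_add)
        also have "(1 - t) * ln (F s0) + t * ln (F s) = ln (F s0) + t * \<eta>"
          using Fs0 gt by (simp add: \<eta>_def ln_div algebra_simps)
        also have "exp \<dots> = F s0 * exp (t * \<eta>)" using Fs0 by (simp add: exp_add)
        finally show ?thesis .
      qed
      then have "F s0 * exp (t * \<eta>) \<le> F y" using Flc[OF s0(1) s t] by (simp add: y_def)
      also have "F y \<le> F s0 * exp (C * (y - s0)\<^sup>2)"
      proof -
        have "F y = G y * exp (C * (y - mid)\<^sup>2 - \<beta> * y)"
          by (simp add: F_def G_def flip: exp_add)
        also have "\<dots> \<le> G s0 * exp (C * (y - mid)\<^sup>2 - \<beta> * y)"
          using s0(2)[OF y] by (intro mult_right_mono) auto
        also have "\<dots> = F s0 * exp (\<beta> * s0 - C * (s0 - mid)\<^sup>2 + (C * (y - mid)\<^sup>2 - \<beta> * y))"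
          by (simp add: F_def G_def mult.assoc flip: exp_add)
        also have "\<beta> * s0 - C * (s0 - mid)\<^sup>2 + (C * (y - mid)\<^sup>2 - \<beta> * y) = C * (y - s0)\<^sup>2"
          unfolding \<beta>C by (simp add: power2_eq_square algebra_simps)
        finally show ?thesis .
      qed
      finally have "t * \<eta> \<le> C * (y - s0)\<^sup>2" using Fs0 by simp
      also have "(y - s0)\<^sup>2 = t * (t * (s - s0)\<^sup>2)" by (simp add: y_def power2_eq_square algebra_simps)
      finally have "t * \<eta> \<le> t * (C * t * (s - s0)\<^sup>2)" by (simp add: mult_ac)
      then show ?thesis using t by simp
    qed
    have "((\<lambda>t. C * t * (s - s0)\<^sup>2) \<longlongrightarrow> C * 0 * (s - s0)\<^sup>2) (at_right 0)"
      by (intro tendsto_intros)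
    then have "\<eta> \<le> C * 0 * (s - s0)\<^sup>2"
    proof (rule tendsto_lowerbound)
      show "\<forall>\<^sub>F t in at_right 0. \<eta> \<le> C * t * (s - s0)\<^sup>2"
        by (rule eventually_mono[OF eventually_at_right_real[of 0 1]]) (auto intro: bd)
    qed auto
    with \<eta> show False by simp
  qed
  have Funi: "F z \<le> F y" if y: "y = (1 - t) * s0 + t * z" and t: "0 \<le> t" "t \<le> 1" and z: "z \<in> {\<alpha>..\<omega>}" for y z t
  proof (cases "t = 0 \<or> t = 1")
    case True
    then show ?thesis using y Fmax[OF z] by auto
  next
    case False
    then have t: "0 < t" "t < 1" using t by auto
    have "F z = F z powr (1 - t) * F z powr t" using F0[of z] by (simp flip: powr_add)
    also have "\<dots> \<le> F s0 powr (1 - t) * F z powr t"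
      using t Fmax[OF z] F0 by (intro mult_right_mono powr_mono2) auto
    also have "\<dots> \<le> F y" unfolding y by (rule Flc[OF s0(1) z t])
    finally show ?thesis .
  qed
  show thesis
  proof (rule that[OF s0(1)])
    fix v v' :: "real \<Rightarrow> real"
    assume v: "\<And>x. (v has_real_derivative v' x) (at x)" and v': "continuous_on UNIV v'"
    have contv: "continuous_on S v" for S
      by (rule DERIV_continuous_on[OF has_field_derivative_at_within[OF v]])
    have contv': "continuous_on S v'" for S using v' continuous_on_subset by blast
    define I where "I x = \<bar>v x - v s0\<bar> powr p * f x" for x
    define J where "J x = \<bar>v' x\<bar> powr p * f x" for x
    have "\<omega> - s0 = (\<omega> - \<alpha>) / 2 - b * \<kappa>" "s0 - \<alpha> = (\<omega> - \<alpha>) / 2 + b * \<kappa>"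
      using \<kappa> by (simp_all add: b_def mid_def field_simps)
    then have l: "\<omega> - s0 \<le> integral {0..Zm} (\<lambda>z. 1 / (1 + m * z powr p)) - b * integral {0..Zm} (\<lambda>z. z / (1 + m * z powr p)\<^sup>2)"
      "s0 - \<alpha> \<le> integral {0..Zm} (\<lambda>z. 1 / (1 + m * z powr p)) - (- b) * integral {0..Zm} (\<lambda>z. z / (1 + m * z powr p)\<^sup>2)"
      using L unfolding \<kappa>_def mult_minus_left by linarith+
    have R: "(p - 1) * m * integral {0..\<omega> - s0} (\<lambda>x. \<bar>v (s0 + x) - v s0\<bar> powr p * f (s0 + x))
        \<le> integral {0..\<omega> - s0} (\<lambda>x. \<bar>v' (s0 + x)\<bar> powr p * f (s0 + x))"
    proof (rule hardy_half_interval[OF p m Zm _ l(1)])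
      show "((\<lambda>x. v (s0 + x) - v s0) has_real_derivative v' (s0 + x)) (at x)" for x
        by (auto intro!: derivative_eq_intros DERIV_chain2[OF v])
      show "f (s0 + y) * exp (- ((p - 1) * b) * y) \<le> f (s0 + x) * exp (- ((p - 1) * b) * x)"
        if xy: "0 \<le> x" "x \<le> y" "y \<le> \<omega> - s0" for x y
      proof -
        have "F (s0 + y) \<le> F (s0 + x)"
        proof (cases "y = 0")
          case False
          then show ?thesis using xy s0(1)
            by (intro Funi[of _ "x / y"]) (auto simp: field_simps)
        qed (use xy in auto)
        moreover have "F (s0 + z) = (f (s0 + z) * exp (- \<beta> * z)) * exp (- \<beta> * s0)" for z
          unfolding F_def mult.assoc by (simp add: algebra_simps flip: exp_add)
        ultimately have "(f (s0 + y) * exp (- \<beta> * y)) * exp (- \<beta> * s0) \<le> (f (s0 + x) * exp (- \<beta> * x)) * exp (- \<beta> * s0)"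
          by simp
        then show ?thesis by (simp add: \<beta>_def)
      qed
    qed (use s0 f0 contv' in \<open>auto intro!: continuous_on_compose2[OF v'] continuous_intros\<close>)
    have Lh: "(p - 1) * m * integral {0..s0 - \<alpha>} (\<lambda>x. \<bar>v (s0 - x) - v s0\<bar> powr p * f (s0 - x))
        \<le> integral {0..s0 - \<alpha>} (\<lambda>x. \<bar>- v' (s0 - x)\<bar> powr p * f (s0 - x))"
    proof (rule hardy_half_interval[OF p m Zm _ l(2)])
      show "((\<lambda>x. v (s0 - x) - v s0) has_real_derivative - v' (s0 - x)) (at x)" for x
        by (auto intro!: derivative_eq_intros DERIV_chain2[OF v])
      show "f (s0 - y) * exp (- ((p - 1) * - b) * y) \<le> f (s0 - x) * exp (- ((p - 1) * - b) * x)"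
        if xy: "0 \<le> x" "x \<le> y" "y \<le> s0 - \<alpha>" for x y
      proof -
        have "F (s0 - y) \<le> F (s0 - x)"
        proof (cases "y = 0")
          case False
          then show ?thesis using xy s0(1)
            by (intro Funi[of _ "x / y"]) (auto simp: field_simps)
        qed (use xy in auto)
        moreover have "F (s0 - z) = (f (s0 - z) * exp (\<beta> * z)) * exp (- \<beta> * s0)" for z
          unfolding F_def mult.assoc by (simp add: algebra_simps flip: exp_add)
        ultimately have "(f (s0 - y) * exp (\<beta> * y)) * exp (- \<beta> * s0) \<le> (f (s0 - x) * exp (\<beta> * x)) * exp (- \<beta> * s0)"
          by simp
        then show ?thesis by (simp add: \<beta>_def)
      qed
    qed (use s0 f0 contv' in \<open>auto intro!: continuous_on_compose2[OF v'] continuous_intros\<close>)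
    have intI: "I integrable_on {\<alpha>..\<omega>}" unfolding I_def
      using p by (auto intro!: integrable_continuous_real continuous_on_mult continuous_on_powr' continuous_on_rabs continuous_on_diff contv contf continuous_on_const)
    have intJ: "J integrable_on {\<alpha>..\<omega>}" unfolding J_def
      using p by (auto intro!: integrable_continuous_real continuous_on_mult continuous_on_powr' continuous_on_rabs contv' contf continuous_on_const)
    have R': "(p - 1) * m * integral {s0..\<omega>} I \<le> integral {s0..\<omega>} J"
    proof -
      have "integral {0..\<omega> - s0} (\<lambda>x. K (s0 + x)) = integral {s0..\<omega>} K" for K :: "real \<Rightarrow> real"
        using integral_shift_real_ivl[of s0 s0 \<omega> K] by (simp add: add.commute)
      from this[of I] this[of J] show ?thesis using R by (simp add: I_def J_def)
    qed
    have L': "(p - 1) * m * integral {\<alpha>..s0} I \<le> integral {\<alpha>..s0} J"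
      using integral_reflect_about[of \<alpha> s0 I] integral_reflect_about[of \<alpha> s0 J] s0(1) Lh by (simp add: I_def J_def)
    have "integral {\<alpha>..\<omega>} I = integral {\<alpha>..s0} I + integral {s0..\<omega>} I" "integral {\<alpha>..\<omega>} J = integral {\<alpha>..s0} J + integral {s0..\<omega>} J"
      using Henstock_Kurzweil_Integration.integral_combine[OF _ _ intI, of s0]
        Henstock_Kurzweil_Integration.integral_combine[OF _ _ intJ, of s0] s0(1) by simp_all
    then have "(p - 1) * m * integral {\<alpha>..\<omega>} I \<le> integral {\<alpha>..\<omega>} J"
      using R' L' by (simp add: distrib_left)
    then show "(p - 1) * m * integral {\<alpha>..\<omega>} (\<lambda>x. \<bar>v x - v s0\<bar> powr p * f x) \<le> integral {\<alpha>..\<omega>} (\<lambda>x. \<bar>v' x\<bar> powr p * f x)"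
      by (simp add: I_def[abs_def] J_def[abs_def])
  qed
qed

section \<open>The Brunn--Minkowski inequality and slab volumes\<close>

lemma AE_lborel_hyperplane:
  fixes e :: "'a::euclidean_space"
  assumes "e \<noteq> 0"
  shows "AE x in lborel. x \<bullet> e \<noteq> c"
proof -
  have "negligible {x. e \<bullet> x = c}" using assms by (intro negligible_hyperplane) auto
  then have "AE x in lebesgue. x \<bullet> e \<noteq> c"
    by (intro AE_I'[of "{x. e \<bullet> x = c}"]) (auto simp: negligible_iff_null_sets inner_commute)
  then show ?thesis by (simp add: AE_completion_iff)
qed

lemma bounded_emeasure_lborel_finite:
  fixes A :: "'a::euclidean_space set"
  assumes "bounded A"
  shows "emeasure lborel A < \<infinity>"
  by (metis assms bounded_subset_cbox_symmetric cbox_borel emeasure_lborel_cbox_finite emeasure_mono order_le_less_trans sets_lborel)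

definition minkowski_comb :: "real \<Rightarrow> 'a::real_vector set \<Rightarrow> 'a set \<Rightarrow> 'a set" where
  "minkowski_comb t A B = (\<Union>y\<in>B. (\<lambda>x. t *\<^sub>R y + (1 - t) *\<^sub>R x) ` A)"

lemma mem_minkowski_comb: "z \<in> minkowski_comb t A B \<longleftrightarrow> (\<exists>x\<in>A. \<exists>y\<in>B. z = (1 - t) *\<^sub>R x + t *\<^sub>R y)"
  by (auto simp: minkowski_comb_def add.commute)

lemma minkowski_comb_commute: "minkowski_comb (1 - t) B A = minkowski_comb t A B"
  by (auto simp: set_eq_iff mem_minkowski_comb add.commute)

lemma minkowski_comb_mono: "A \<subseteq> A' \<Longrightarrow> B \<subseteq> B' \<Longrightarrow> minkowski_comb t A B \<subseteq> minkowski_comb t A' B'"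
  by (auto simp: subset_iff mem_minkowski_comb) 

lemma open_minkowski_comb:
  fixes A B :: "'a::euclidean_space set"
  assumes "open A" "t < 1"
  shows "open (minkowski_comb t A B)"
  unfolding minkowski_comb_def using assms by (intro open_UN ballI open_affinity) auto

lemma bounded_minkowski_comb:
  fixes A B :: "'a::euclidean_space set"
  assumes "bounded A" "bounded B"
  shows "bounded (minkowski_comb t A B)"
proof -
  obtain a where a: "\<And>x. x \<in> A \<Longrightarrow> norm x \<le> a" using assms bounded_iff by metis
  obtain b where b: "\<And>x. x \<in> B \<Longrightarrow> norm x \<le> b" using assms bounded_iff by metis
  show ?thesis
  proof (rule boundedI)
    fix z assume "z \<in> minkowski_comb t A B"
    then obtain x y where xy: "x \<in> A" "y \<in> B" "z = (1 - t) *\<^sub>R x + t *\<^sub>R y"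
      unfolding mem_minkowski_comb by blast
    have "norm z \<le> \<bar>1 - t\<bar> * norm x + \<bar>t\<bar> * norm y"
      unfolding xy(3) using norm_triangle_ineq[of "(1 - t) *\<^sub>R x" "t *\<^sub>R y"] by simp
    also have "\<dots> \<le> \<bar>1 - t\<bar> * a + \<bar>t\<bar> * b"
      using a[OF xy(1)] b[OF xy(2)] by (intro add_mono mult_left_mono) auto
    finally show "norm z \<le> \<bar>1 - t\<bar> * a + \<bar>t\<bar> * b" .
  qed
qed

lemma measure_lborel_mono_bounded:
  fixes A B :: "'a::euclidean_space set"
  assumes "A \<subseteq> B" "B \<in> sets borel" "bounded B"
  shows "measure lborel A \<le> measure lborel B"
proof (cases "A \<in> sets borel")
  case True
  then show ?thesis
    using assms bounded_emeasure_lborel_finite[OF assms(3)] by (intro measure_mono_fmeasurable) (auto simp: fmeasurable_def)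
qed (simp add: measure_notin_sets)

lemma measure_split_hyperplane:
  fixes A :: "'a::euclidean_space set"
  assumes A: "open A" "bounded A" and e: "e \<noteq> 0"
  shows "measure lborel A = measure lborel (A \<inter> {x. x \<bullet> e < c}) + measure lborel (A \<inter> {x. c < x \<bullet> e})"
proof -
  have op: "open {x. x \<bullet> e < c}" "open {x. c < x \<bullet> e}"
    by (auto intro!: open_Collect_less continuous_intros)
  have sets: "A \<inter> {x. x \<bullet> e < c} \<in> sets lborel" "A \<inter> {x. c < x \<bullet> e} \<in> sets lborel" "A \<in> sets lborel"
    using A op by auto
  have fin: "emeasure lborel (A \<inter> S) \<noteq> \<infinity>" for S
    using bounded_emeasure_lborel_finite[OF bounded_subset[OF A(2), of "A \<inter> S"]] by auto
  have "measure lborel A = measure lborel (A \<inter> {x. x \<bullet> e < c} \<union> A \<inter> {x. c < x \<bullet> e})"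
  proof (rule measure_eq_AE)
    show "AE x in lborel. x \<in> A \<longleftrightarrow> x \<in> A \<inter> {x. x \<bullet> e < c} \<union> A \<inter> {x. c < x \<bullet> e}"
      using AE_lborel_hyperplane[OF e, of c] by eventually_elim auto
  qed (use sets in auto)
  also have "\<dots> = measure lborel (A \<inter> {x. x \<bullet> e < c}) + measure lborel (A \<inter> {x. c < x \<bullet> e})"
    using sets fin by (intro measure_Union) auto
  finally show ?thesis .
qed

text \<open>Dominated convergence: the indicator functions converge off the bounding hyperplane.\<close>

lemma continuous_measure_halfspace:
  fixes A :: "'a::euclidean_space set"
  assumes A: "open A" "bounded A" and e: "e \<noteq> 0"
  shows "continuous_on UNIV (\<lambda>c. measure lborel (A \<inter> {x. x \<bullet> e < c}))"
  unfolding continuous_on_sequentially comp_def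
proof safe
  fix X :: "nat \<Rightarrow> real" and c assume X: "X \<longlonglongrightarrow> c"
  have op: "open {x. x \<bullet> e < c}" for c
    by (auto intro!: open_Collect_less continuous_intros)
  have sets: "A \<inter> {x. x \<bullet> e < c} \<in> sets lborel" for c
    using A op by auto
  have eq: "measure lborel (A \<inter> {x. x \<bullet> e < c}) = integral\<^sup>L lborel (indicator (A \<inter> {x. x \<bullet> e < c}))" for c
    by simp
  show "(\<lambda>n. measure lborel (A \<inter> {x. x \<bullet> e < X n})) \<longlonglongrightarrow> measure lborel (A \<inter> {x. x \<bullet> e < c})"
    unfolding eq
  proof (rule integral_dominated_convergence[where w = "indicator A"])
    show "integrable lborel (indicator A :: 'a \<Rightarrow> real)"
      using A bounded_emeasure_lborel_finite[of A] by (simp add: integrable_indicator_iff)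
    show "AE x in lborel. (\<lambda>n. indicator (A \<inter> {x. x \<bullet> e < X n}) x) \<longlonglongrightarrow> (indicator (A \<inter> {x. x \<bullet> e < c}) x :: real)"
      using AE_lborel_hyperplane[OF e, of c]
    proof eventually_elim
      case (elim x)
      have "\<forall>\<^sub>F n in sequentially. (x \<bullet> e < X n) = (x \<bullet> e < c)"
      proof (cases "x \<bullet> e < c")
        case True
        then show ?thesis using order_tendstoD(1)[OF X True] by (auto elim: eventually_mono)
      next
        case False
        with elim have "c < x \<bullet> e" by simp
        then show ?thesis using order_tendstoD(2)[OF X, of "x \<bullet> e"] by (auto elim!: eventually_mono)
      qed
      then show ?case
        by (intro tendsto_eventually) (auto elim!: eventually_mono simp: indicator_def)
    qed
  qed (use sets in \<open>auto simp: indicator_def\<close>)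
qed

lemma box_Int_halfspace:
  fixes a b :: "'a::euclidean_space"
  assumes "i \<in> Basis"
  shows "\<exists>a' b'. box a b \<inter> {x. x \<bullet> i < c} = box a' b'" "\<exists>a' b'. box a b \<inter> {x. c < x \<bullet> i} = box a' b'"
proof -
  have 1: "(\<Sum>j\<in>Basis. (if j = i then m else b \<bullet> j) *\<^sub>R j) \<bullet> j = (if j = i then m else b \<bullet> j)" if "j \<in> Basis" for j m and b :: 'a
    using that by simp
  show "\<exists>a' b'. box a b \<inter> {x. x \<bullet> i < c} = box a' b'"
    by (rule exI[of _ a], rule exI[of _ "\<Sum>j\<in>Basis. (if j = i then min c (b \<bullet> i) else b \<bullet> j) *\<^sub>R j"])
       (use assms in \<open>auto simp: box_def 1 simp del: inner_sum_left_Basis split: if_splits\<close>)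
  show "\<exists>a' b'. box a b \<inter> {x. c < x \<bullet> i} = box a' b'"
    by (rule exI[of _ "\<Sum>j\<in>Basis. (if j = i then max c (a \<bullet> i) else a \<bullet> j) *\<^sub>R j"], rule exI[of _ b])
       (use assms in \<open>auto simp: box_def 1 simp del: inner_sum_left_Basis split: if_splits\<close>)
qed

text \<open>Boxes are open and disjoint, so that a hyperplane between two of them splits the family up to a null
  set; excluding the empty box makes the number of boxes a measure of progress.\<close>

definition box_family :: "'a::euclidean_space set set \<Rightarrow> bool" where
  "box_family D \<longleftrightarrow> finite D \<and> disjoint D \<and> (\<forall>E\<in>D. E \<noteq> {} \<and> (\<exists>a b. E = box a b))"

lemma box_familyD:
  assumes "box_family D" "E \<in> D"
  shows "E \<noteq> {}" "\<exists>a b. E = box a b" "open E" "bounded E"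
  using assms by (force simp: box_family_def intro: open_box bounded_box)+

lemma box_family_Union:
  assumes "box_family D"
  shows "open (\<Union>D)" "bounded (\<Union>D)"
  using box_familyD[OF assms] assms by (auto simp: box_family_def intro: bounded_Union)

lemma measure_lborel_box_ne:
  fixes u v :: "'a::euclidean_space"
  assumes "\<And>i. i \<in> Basis \<Longrightarrow> u \<bullet> i < v \<bullet> i"
  shows "measure lborel (box u v) = (\<Prod>i\<in>Basis. v \<bullet> i - u \<bullet> i)"
proof -
  have 1: "u \<bullet> i \<le> v \<bullet> i" if "i \<in> Basis" for i using assms[OF that] by simp
  then have "emeasure lborel (box u v) = ennreal (\<Prod>i\<in>Basis. v \<bullet> i - u \<bullet> i)"
    using emeasure_lborel_box[OF 1] by (simp add: inner_diff_left)
  then show ?thesis using 1 by (simp add: measure_def prod_nonneg)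
qed

lemma measure_box_pos: 
  fixes a b :: "'a::euclidean_space"
  assumes "box a b \<noteq> {}"
  shows "0 < measure lborel (box a b)"
proof -
  have 1: "a \<bullet> i < b \<bullet> i" if "i \<in> Basis" for i using assms that by (auto simp: box_ne_empty)
  have "0 < (\<Prod>i\<in>Basis. b \<bullet> i - a \<bullet> i)" using 1 by (intro prod_pos) auto
  then show ?thesis using measure_lborel_box_ne[of a b] 1 by simp
qed

lemma box_family_measure_pos:
  assumes "box_family D" "D \<noteq> {}"
  shows "0 < measure lborel (\<Union>D)"
proof -
  obtain E where E: "E \<in> D" using assms by auto
  then obtain a b where ab: "E = box a b" "E \<noteq> {}" using box_familyD[OF assms(1) E] by blast
  have "0 < measure lborel E" using measure_box_pos ab by auto
  also have "\<dots> \<le> measure lborel (\<Union>D)"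
    using box_family_Union[OF assms(1)] E by (intro measure_lborel_mono_bounded) auto
  finally show ?thesis .
qed

lemma box_family_restrict:
  assumes D: "box_family D" and H: "\<And>a b. \<exists>a' b'. box a b \<inter> H = box a' b'"
  defines "D' \<equiv> (\<lambda>E. E \<inter> H) ` D - {{}}"
  shows "box_family D'" "\<Union>D' = \<Union>D \<inter> H" "card D' \<le> card D"
    and "E \<in> D \<Longrightarrow> E \<inter> H = {} \<Longrightarrow> card D' < card D"
proof -
  have fin: "finite D" using D by (simp add: box_family_def)
  have 1: "\<exists>E0\<in>D. E = E0 \<inter> H \<and> E0 \<inter> H \<noteq> {}" if "E \<in> D'" for E using that by (auto simp: D'_def)
  have "disjoint D'"
  proof (rule disjointI)
    fix A B assume AB: "A \<in> D'" "B \<in> D'" "A \<noteq> B"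
    obtain A0 where A0: "A0 \<in> D" "A = A0 \<inter> H" using 1[OF AB(1)] by blast
    obtain B0 where B0: "B0 \<in> D" "B = B0 \<inter> H" using 1[OF AB(2)] by blast
    have "A0 \<noteq> B0" using A0 B0 AB by auto
    then have "A0 \<inter> B0 = {}" using D A0 B0 by (auto simp: box_family_def disjoint_def)
    then show "A \<inter> B = {}" using A0 B0 by auto
  qed
  moreover have "E \<noteq> {} \<and> (\<exists>a b. E = box a b)" if E: "E \<in> D'" for E
  proof -
    obtain E0 where E0: "E0 \<in> D" "E = E0 \<inter> H" "E \<noteq> {}" using 1[OF E] by blast
    then obtain a b where "E0 = box a b" using box_familyD(2)[OF D] by blast
    then show ?thesis using H[of a b] E0 by auto
  qed
  ultimately show "box_family D'" using fin by (simp add: box_family_def D'_def)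
  show "\<Union>D' = \<Union>D \<inter> H" by (auto simp: D'_def)
  have "card D' \<le> card ((\<lambda>E. E \<inter> H) ` D)" using fin by (intro card_mono) (auto simp: D'_def)
  also have "\<dots> \<le> card D" by (rule card_image_le[OF fin])
  finally show "card D' \<le> card D" .
  show "card D' < card D" if "E \<in> D" "E \<inter> H = {}"
  proof -
    have "card D' \<le> card ((\<lambda>E. E \<inter> H) ` (D - {E}))" using fin that by (intro card_mono) (auto simp: D'_def)
    also have "\<dots> \<le> card (D - {E})" using fin by (intro card_image_le) auto
    also have "\<dots> < card D" using fin that by (intro card_Diff1_less)
    finally show ?thesis .
  qed
qed

text \<open>The combination contains the box with the combined corners, and the inequality between weighted
  arithmetic and geometric means applies in each coordinate.\<close>

lemma brunn_minkowski_two_boxes: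
  fixes a b c d :: "'a::euclidean_space"
  assumes t: "0 < t" "t < 1" and ne: "box a b \<noteq> {}" "box c d \<noteq> {}"
  shows "measure lborel (box a b) powr (1 - t) * measure lborel (box c d) powr t
    \<le> measure lborel (minkowski_comb t (box a b) (box c d))"
proof -
  have ab: "a \<bullet> i < b \<bullet> i" "c \<bullet> i < d \<bullet> i" if "i \<in> Basis" for i using ne that by (auto simp: box_ne_empty)
  define lo hi where "lo = (1 - t) *\<^sub>R a + t *\<^sub>R c" and "hi = (1 - t) *\<^sub>R b + t *\<^sub>R d"
  have lohi: "lo \<bullet> i < hi \<bullet> i" if "i \<in> Basis" for i
    using ab[OF that] t by (simp add: lo_def hi_def inner_add_left add_strict_mono)
  have sub: "box lo hi \<subseteq> minkowski_comb t (box a b) (box c d)"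
  proof
    fix z assume z: "z \<in> box lo hi"
    define r where "r i = (z \<bullet> i - lo \<bullet> i) / (hi \<bullet> i - lo \<bullet> i)" for i
    have r: "0 < r i" "r i < 1" if "i \<in> Basis" for i
      using z lohi[OF that] that by (auto simp: r_def mem_box divide_simps)
    define x where "x = (\<Sum>i\<in>Basis. (a \<bullet> i + r i * (b \<bullet> i - a \<bullet> i)) *\<^sub>R i)"
    define y where "y = (\<Sum>i\<in>Basis. (c \<bullet> i + r i * (d \<bullet> i - c \<bullet> i)) *\<^sub>R i)"
    have xi: "x \<bullet> i = a \<bullet> i + r i * (b \<bullet> i - a \<bullet> i)" "y \<bullet> i = c \<bullet> i + r i * (d \<bullet> i - c \<bullet> i)" if "i \<in> Basis" for i
      using that by (simp_all add: x_def y_def)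
    have between: "u < u + s * (v - u) \<and> u + s * (v - u) < v" if "u < v" "0 < s" "s < 1" for u v s :: real
    proof -
      have "0 < s * (v - u)" "s * (v - u) < 1 * (v - u)"
        using that by (auto intro!: mult_strict_right_mono)
      then show ?thesis by simp
    qed
    have "x \<in> box a b" "y \<in> box c d"
      using between ab r by (auto simp: mem_box xi)
    moreover have "z = (1 - t) *\<^sub>R x + t *\<^sub>R y"
    proof (rule euclidean_eqI)
      fix i :: 'a assume i: "i \<in> Basis"
      have "((1 - t) *\<^sub>R x + t *\<^sub>R y) \<bullet> i = lo \<bullet> i + r i * (hi \<bullet> i - lo \<bullet> i)"
        using i unfolding lo_def hi_def inner_add_left inner_scaleR_left xi[OF i] by (simp add: algebra_simps)
      also have "\<dots> = z \<bullet> i" using lohi[OF i] by (simp add: r_def)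
      finally show "z \<bullet> i = ((1 - t) *\<^sub>R x + t *\<^sub>R y) \<bullet> i" by simp
    qed
    ultimately show "z \<in> minkowski_comb t (box a b) (box c d)"
      unfolding mem_minkowski_comb by blast
  qed
  have "measure lborel (box a b) powr (1 - t) * measure lborel (box c d) powr t
      = (\<Prod>i\<in>Basis. (b \<bullet> i - a \<bullet> i) powr (1 - t) * (d \<bullet> i - c \<bullet> i) powr t)"
    using ab by (simp add: measure_lborel_box_ne prod_powr_distrib prod.distrib less_imp_le del: measure_lborel_box)
  also have "\<dots> \<le> (\<Prod>i\<in>Basis. hi \<bullet> i - lo \<bullet> i)"
  proof (rule prod_mono, safe)
    fix i :: 'a assume i: "i \<in> Basis"
    have "(b \<bullet> i - a \<bullet> i) powr (1 - t) * (d \<bullet> i - c \<bullet> i) powr t \<le> (1 - t) * (b \<bullet> i - a \<bullet> i) + t * (d \<bullet> i - c \<bullet> i)"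
      using t ab[OF i] by (intro Youngs_inequality_0) auto
    then show "(b \<bullet> i - a \<bullet> i) powr (1 - t) * (d \<bullet> i - c \<bullet> i) powr t \<le> hi \<bullet> i - lo \<bullet> i"
      by (simp add: lo_def hi_def inner_add_left algebra_simps)
  qed auto
  also have "\<dots> = measure lborel (box lo hi)" using lohi by (simp add: measure_lborel_box_ne)
  also have "\<dots> \<le> measure lborel (minkowski_comb t (box a b) (box c d))"
    using t by (intro measure_lborel_mono_bounded sub borel_open open_minkowski_comb bounded_minkowski_comb) auto
  finally show ?thesis .
qed

text \<open>The argument of Hadwiger and Ohmann, by induction on the total number of boxes. A coordinate hyperplane
  that separates two boxes of one family is matched with a parallel hyperplane that cuts the other family
  in the same proportion \<open>\<theta>\<close>. The combinations of corresponding parts lie on different sides of a third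
  hyperplane, so their volumes add up, and the powers of \<open>\<theta>\<close> combine to \<open>\<theta>\<close> itself.\<close>

lemma brunn_minkowski_box_families:
  fixes D1 D2 :: "'a::euclidean_space set set"
  assumes "box_family D1" "box_family D2" "D1 \<noteq> {}" "D2 \<noteq> {}" "0 < t" "t < 1"
  shows "measure lborel (\<Union>D1) powr (1 - t) * measure lborel (\<Union>D2) powr t \<le> measure lborel (minkowski_comb t (\<Union>D1) (\<Union>D2))"
  using assms
proof (induction "card D1 + card D2" arbitrary: D1 D2 t rule: less_induct)
  case less
  have fin: "finite D1" "finite D2" using less.prems by (auto simp: box_family_def)
  have step: "measure lborel (\<Union>D1) powr (1 - t) * measure lborel (\<Union>D2) powr t \<le> measure lborel (minkowski_comb t (\<Union>D1) (\<Union>D2))"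
    if c: "card D1 + card D2 = n" and IH: "\<And>(D1'::'a set set) D2' t. \<lbrakk>card D1' + card D2' < n; box_family D1'; box_family D2'; D1' \<noteq> {}; D2' \<noteq> {}; 0 < t; t < 1\<rbrakk> \<Longrightarrow> measure lborel (\<Union>D1') powr (1 - t) * measure lborel (\<Union>D2') powr t \<le> measure lborel (minkowski_comb t (\<Union>D1') (\<Union>D2'))"
      and D: "box_family D1" "box_family D2" "D2 \<noteq> {}" and E: "E1 \<in> D1" "E2 \<in> D1" "E1 \<noteq> E2" and t: "0 < t" "t < 1"
    for D1 D2 :: "'a set set" and t n E1 E2
  proof -
    obtain a b where ab: "E1 = box a b" "E1 \<noteq> {}" using box_familyD[OF D(1) E(1)] by blast
    obtain a' b' where ab': "E2 = box a' b'" "E2 \<noteq> {}" using box_familyD[OF D(1) E(2)] by blast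
    have "E1 \<inter> E2 = {}" using D E by (auto simp: box_family_def disjoint_def)
    then have "\<exists>i\<in>Basis. b \<bullet> i \<le> a' \<bullet> i \<or> b' \<bullet> i \<le> a \<bullet> i"
      using ab ab' unfolding ab(1) ab'(1) disjoint_interval box_ne_empty by (meson not_le)
    then obtain i c F1 F2 where i: "i \<in> Basis" and F: "F1 \<in> D1" "F2 \<in> D1" "F1 \<noteq> {}" "F2 \<noteq> {}"
      "F1 \<subseteq> {x. x \<bullet> i < c}" "F2 \<subseteq> {x. c < x \<bullet> i}"
    proof (elim bexE disjE)
      fix i :: 'a assume i: "i \<in> Basis" "b \<bullet> i \<le> a' \<bullet> i"
      show thesis
        by (rule that[of i E1 E2 "b \<bullet> i"]) (use i ab ab' E in \<open>auto simp: mem_box intro: le_less_trans\<close>)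
    next
      fix i :: 'a assume i: "i \<in> Basis" "b' \<bullet> i \<le> a \<bullet> i"
      show thesis
        by (rule that[of i E2 E1 "b' \<bullet> i"]) (use i ab ab' E in \<open>auto simp: mem_box intro: le_less_trans\<close>)
    qed
    define A B where "A = \<Union>D1" and "B = \<Union>D2"
    have i0: "i \<noteq> 0" using i by auto
    have A: "open A" "bounded A" and B: "open B" "bounded B"
      using box_family_Union D by (auto simp: A_def B_def)
    define Dm where "Dm = (\<lambda>E. E \<inter> {x. x \<bullet> i < c}) ` D1 - {{}}"
    define Dp where "Dp = (\<lambda>E. E \<inter> {x. c < x \<bullet> i}) ` D1 - {{}}"
    have Dm: "box_family Dm" "\<Union>Dm = A \<inter> {x. x \<bullet> i < c}" "card Dm < card D1" "Dm \<noteq> {}"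
    proof -
      note R = box_family_restrict[OF D(1) box_Int_halfspace(1)[OF i, where c = c]]
      have e: "F2 \<inter> {x. x \<bullet> i < c} = {}" "F1 \<inter> {x. x \<bullet> i < c} = F1" using F by force+
      show "box_family Dm" unfolding Dm_def by (rule R(1))
      show "\<Union>Dm = A \<inter> {x. x \<bullet> i < c}" unfolding Dm_def A_def by (rule R(2))
      show "card Dm < card D1" unfolding Dm_def by (rule R(4)[OF _ e(1)]) (rule F)
      have "F1 \<in> Dm" using e(2) F unfolding Dm_def by blast
      then show "Dm \<noteq> {}" by blast
    qed
    have Dp: "box_family Dp" "\<Union>Dp = A \<inter> {x. c < x \<bullet> i}" "card Dp < card D1" "Dp \<noteq> {}"
    proof -
      note R = box_family_restrict[OF D(1) box_Int_halfspace(2)[OF i, where c = c]]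
      have e: "F1 \<inter> {x. c < x \<bullet> i} = {}" "F2 \<inter> {x. c < x \<bullet> i} = F2" using F by force+
      show "box_family Dp" unfolding Dp_def by (rule R(1))
      show "\<Union>Dp = A \<inter> {x. c < x \<bullet> i}" unfolding Dp_def A_def by (rule R(2))
      show "card Dp < card D1" unfolding Dp_def by (rule R(4)[OF _ e(1)]) (rule F)
      have "F2 \<in> Dp" using e(2) F unfolding Dp_def by blast
      then show "Dp \<noteq> {}" by blast
    qed
    define mA mB where "mA = measure lborel A" and "mB = measure lborel B"
    define \<theta> where "\<theta> = measure lborel (\<Union>Dm) / mA"
    have mA: "mA = measure lborel (\<Union>Dm) + measure lborel (\<Union>Dp)"
      unfolding mA_def Dm(2) Dp(2) by (rule measure_split_hyperplane[OF A i0])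
    have pos: "0 < measure lborel (\<Union>Dm)" "0 < measure lborel (\<Union>Dp)" "0 < mB"
      using box_family_measure_pos[OF Dm(1,4)] box_family_measure_pos[OF Dp(1,4)] box_family_measure_pos[OF D(2,3)]
      unfolding mB_def B_def by blast+
    have mA0: "0 < mA" using mA pos by simp
    have \<theta>: "0 < \<theta>" "\<theta> < 1" "measure lborel (\<Union>Dm) = \<theta> * mA" "measure lborel (\<Union>Dp) = (1 - \<theta>) * mA"
      using mA pos by (auto simp: \<theta>_def field_simps)
    define g where "g c = measure lborel (B \<inter> {x. x \<bullet> i < c})" for c
    obtain M where M: "\<And>x. x \<in> B \<Longrightarrow> norm x \<le> M" using B bounded_iff by metis
    have M': "- M \<le> x \<bullet> i \<and> x \<bullet> i \<le> M" if "x \<in> B" for x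
      using M[OF that] Basis_le_norm[OF i, of x] by auto
    have "g (- M) = 0"
    proof -
      have "B \<inter> {x. x \<bullet> i < - M} = {}" using M' by force
      then show ?thesis by (simp add: g_def)
    qed
    moreover have "g (M + 1) = mB"
    proof -
      have "B \<inter> {x. x \<bullet> i < M + 1} = B" using M' by force
      then show ?thesis by (simp add: g_def mB_def)
    qed
    moreover have "0 \<le> \<theta> * mB" "\<theta> * mB \<le> mB" using \<theta> pos by auto
    moreover have "continuous_on {-M..M+1} g"
      using continuous_measure_halfspace[OF B i0] unfolding g_def by (rule continuous_on_subset) auto
    moreover have "- M \<le> M + 1"
    proof -
      have "B \<noteq> {}" using pos(3) by (auto simp: mB_def)
      then obtain x where "x \<in> B" by blast
      then show ?thesis using M' by fastforce
    qed
    ultimately obtain c' where c': "g c' = \<theta> * mB"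
      using IVT'[of g "-M" "\<theta> * mB" "M + 1"] by auto
    define Em where "Em = (\<lambda>E. E \<inter> {x. x \<bullet> i < c'}) ` D2 - {{}}"
    define Ep where "Ep = (\<lambda>E. E \<inter> {x. c' < x \<bullet> i}) ` D2 - {{}}"
    have Em: "box_family Em" "\<Union>Em = B \<inter> {x. x \<bullet> i < c'}" "card Em \<le> card D2"
      using box_family_restrict[OF D(2) box_Int_halfspace(1)[OF i, where c = c']] 
      unfolding Em_def B_def by (blast+)
    have Ep: "box_family Ep" "\<Union>Ep = B \<inter> {x. c' < x \<bullet> i}" "card Ep \<le> card D2"
      using box_family_restrict[OF D(2) box_Int_halfspace(2)[OF i, where c = c']] 
      unfolding Ep_def B_def by (blast+)
    have mEm: "measure lborel (\<Union>Em) = \<theta> * mB" using c' by (simp add: Em g_def)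
    have mEp: "measure lborel (\<Union>Ep) = (1 - \<theta>) * mB"
      using measure_split_hyperplane[OF B i0, of c'] mEm by (simp add: Em Ep mB_def algebra_simps)
    have "Em \<noteq> {}" using mEm \<theta> pos by auto
    have "Ep \<noteq> {}" using mEp \<theta> pos by auto
    define Cm where "Cm = minkowski_comb t (\<Union>Dm) (\<Union>Em)"
    define Cp where "Cp = minkowski_comb t (\<Union>Dp) (\<Union>Ep)"
    define w where "w = (1 - t) * c + t * c'"
    have IHm: "measure lborel (\<Union>Dm) powr (1 - t) * measure lborel (\<Union>Em) powr t \<le> measure lborel Cm"
      unfolding Cm_def by (rule IH[OF _ Dm(1) Em(1) Dm(4) \<open>Em \<noteq> {}\<close> t]) (use Dm(3) Em(3) c in linarith)
    have IHp: "measure lborel (\<Union>Dp) powr (1 - t) * measure lborel (\<Union>Ep) powr t \<le> measure lborel Cp"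
      unfolding Cp_def by (rule IH[OF _ Dp(1) Ep(1) Dp(4) \<open>Ep \<noteq> {}\<close> t]) (use Dp(3) Ep(3) c in linarith)
    have eqs: "(s * mA) powr (1 - t) * (s * mB) powr t = s * (mA powr (1 - t) * mB powr t)" if "0 < s" for s
    proof -
      have "(s * mA) powr (1 - t) * (s * mB) powr t = (s powr (1 - t) * s powr t) * (mA powr (1 - t) * mB powr t)"
        using that mA0 pos by (simp add: powr_mult)
      also have "s powr (1 - t) * s powr t = s" using that by (simp flip: powr_add)
      finally show ?thesis .
    qed
    have "mA powr (1 - t) * mB powr t = \<theta> * (mA powr (1 - t) * mB powr t) + (1 - \<theta>) * (mA powr (1 - t) * mB powr t)"
      by (simp add: algebra_simps)
    also have "\<dots> \<le> measure lborel Cm + measure lborel Cp"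
      using IHm IHp eqs[of \<theta>] eqs[of "1 - \<theta>"] \<theta> by (simp add: mEm mEp)
    also have "\<dots> \<le> measure lborel (minkowski_comb t A B \<inter> {x. x \<bullet> i < w}) + measure lborel (minkowski_comb t A B \<inter> {x. w < x \<bullet> i})"
    proof (intro add_mono measure_lborel_mono_bounded)
      have op: "open {x. x \<bullet> i < w}" "open {x. w < x \<bullet> i}" by (auto intro!: open_Collect_less continuous_intros)
      show "minkowski_comb t A B \<inter> {x. x \<bullet> i < w} \<in> sets borel" "minkowski_comb t A B \<inter> {x. w < x \<bullet> i} \<in> sets borel"
        using open_minkowski_comb[OF A(1) t(2), of B] op by (auto intro!: borel_open)
      show "bounded (minkowski_comb t A B \<inter> {x. x \<bullet> i < w})" "bounded (minkowski_comb t A B \<inter> {x. w < x \<bullet> i})"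
        using bounded_minkowski_comb[OF A(2) B(2), of t] by auto
      show "Cm \<subseteq> minkowski_comb t A B \<inter> {x. x \<bullet> i < w}"
      proof
        fix z assume "z \<in> Cm"
        then obtain x y where xy: "x \<in> A" "x \<bullet> i < c" "y \<in> B" "y \<bullet> i < c'" "z = (1 - t) *\<^sub>R x + t *\<^sub>R y"
          unfolding Cm_def mem_minkowski_comb Dm(2) Em(2) by auto
        then have "z \<bullet> i < w" using t unfolding w_def by (auto simp: inner_add_left intro!: add_strict_mono)
        then show "z \<in> minkowski_comb t A B \<inter> {x. x \<bullet> i < w}" using xy by (auto simp: mem_minkowski_comb)
      qed
      show "Cp \<subseteq> minkowski_comb t A B \<inter> {x. w < x \<bullet> i}"
      proof
        fix z assume "z \<in> Cp"
        then obtain x y where xy: "x \<in> A" "c < x \<bullet> i" "y \<in> B" "c' < y \<bullet> i" "z = (1 - t) *\<^sub>R x + t *\<^sub>R y"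
          unfolding Cp_def mem_minkowski_comb Dp(2) Ep(2) by auto
        then have "w < z \<bullet> i" using t unfolding w_def by (auto simp: inner_add_left intro!: add_strict_mono)
        then show "z \<in> minkowski_comb t A B \<inter> {x. w < x \<bullet> i}" using xy by (auto simp: mem_minkowski_comb)
      qed
    qed
    also have "\<dots> = measure lborel (minkowski_comb t A B)"
      by (rule measure_split_hyperplane[symmetric]) (use A B t i0 in \<open>auto intro: open_minkowski_comb bounded_minkowski_comb\<close>)
    finally show ?thesis by (simp add: mA_def mB_def A_def B_def)
  qed
  consider (one) E1 E2 where "D1 = {E1}" "D2 = {E2}" | (left) E1 E2 where "E1 \<in> D1" "E2 \<in> D1" "E1 \<noteq> E2"
    | (right) E1 E2 where "E1 \<in> D2" "E2 \<in> D2" "E1 \<noteq> E2"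
    using less.prems(3,4) by blast
  then show ?case
  proof cases
    case one
    then have E: "E1 \<in> D1" "E2 \<in> D2" by auto
    obtain a b where ab: "E1 = box a b" "E1 \<noteq> {}" using box_familyD[OF less.prems(1) E(1)] by blast
    obtain c d where cd: "E2 = box c d" "E2 \<noteq> {}" using box_familyD[OF less.prems(2) E(2)] by blast
    have "\<Union>D1 = box a b" "\<Union>D2 = box c d" using one ab cd by auto
    then show ?thesis using brunn_minkowski_two_boxes[OF less.prems(5,6), of a b c d] ab cd by simp
  next
    case left
    show ?thesis by (rule step[OF refl less.hyps]) (use less.prems left in auto)
  next
    case right
    have "measure lborel (\<Union>D2) powr (1 - (1 - t)) * measure lborel (\<Union>D1) powr (1 - t) \<le> measure lborel (minkowski_comb (1 - t) (\<Union>D2) (\<Union>D1))"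
      by (rule step[OF refl less.hyps]) (use less.prems right in auto)
    then show ?thesis by (simp add: minkowski_comb_commute mult.commute)
  qed
qed

text \<open>The covering lemma, with a gauge that keeps the cells inside \<open>A\<close>, gives countably many nonoverlapping
  cells; finitely many of them exhaust the volume up to \<open>\<epsilon>\<close>, and passing to interiors loses a null set.\<close>

lemma open_box_family_approx:
  fixes A :: "'a::euclidean_space set"
  assumes A: "open A" "bounded A" and e: "0 < \<epsilon>"
  obtains D where "box_family D" "\<Union>D \<subseteq> A" "measure lborel A - \<epsilon> < measure lborel (\<Union>D)"
proof -
  obtain a where a: "A \<subseteq> cbox (- a) a" using bounded_subset_cbox_symmetric[OF A(2)] by blast
  define b where "b = a + One"
  have "cbox (- a) a \<subseteq> cbox (- b) b" by (auto simp: b_def mem_box inner_add_left inner_diff_left dest!: bspec)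
  show thesis
  proof (cases "A = {}")
    case True
    show thesis by (rule that[of "{}"]) (use True e in \<open>auto simp: box_family_def\<close>)
  next
    case False
    then obtain x where x: "x \<in> A" by blast
    have ab: "- a \<bullet> i \<le> x \<bullet> i" "x \<bullet> i \<le> a \<bullet> i" if "i \<in> Basis" for i
      using a x that by (auto simp: mem_box subset_iff)
    have ne: "box (- b) b \<noteq> {}"
      unfolding box_ne_empty
    proof
      fix i :: 'a assume "i \<in> Basis"
      then show "- b \<bullet> i < b \<bullet> i" using ab[of i] by (simp add: b_def inner_add_left inner_diff_left)
    qed
    have g: "gauge (\<lambda>x. if x \<in> A then A else UNIV)"
      using A by (auto simp: gauge_def)
    have sub: "A \<subseteq> cbox (- b) b" using a \<open>cbox (- a) a \<subseteq> cbox (- b) b\<close> by blast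
    obtain \<D> where \<D>: "countable \<D>" "\<And>K. K \<in> \<D> \<Longrightarrow> interior K \<noteq> {} \<and> (\<exists>c d. K = cbox c d)"
      "pairwise (\<lambda>A B. interior A \<inter> interior B = {}) \<D>"
      "\<And>K. K \<in> \<D> \<Longrightarrow> \<exists>x \<in> A \<inter> K. K \<subseteq> (if x \<in> A then A else UNIV)" "A \<subseteq> \<Union>\<D>"
      by (rule covering_lemma[OF sub ne g]) blast
    have subA: "K \<subseteq> A" if "K \<in> \<D>" for K using \<D>(4)[OF that] by auto
    have UA: "\<Union>\<D> = A" using subA \<D>(5) by blast
    have lm: "K \<in> lmeasurable" if "K \<in> \<D>" for K using \<D>(2)[OF that] by auto
    have Alm: "A \<in> lmeasurable" using A by (intro lmeasurable_open) auto
    have lmU: "\<Union>E \<in> lmeasurable" if "E \<subseteq> \<D>" "finite E" for E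
      using that lm by (intro fmeasurable.finite_Union) auto
    have bd: "measure lebesgue (\<Union>E) \<le> measure lebesgue A" if "E \<subseteq> \<D>" "finite E" for E
      by (rule measure_mono_fmeasurable) (use that subA Alm lmU[OF that] in auto)
    obtain D' where D': "finite D'" "D' \<subseteq> \<D>" "measure lebesgue (\<Union>\<D>) - \<epsilon> < measure lebesgue (\<Union>D')"
      by (rule measure_countable_Union_approachable[OF \<D>(1) e lm bd]) auto
    define D where "D = interior ` D'"
    have "disjoint D"
      unfolding D_def
    proof (rule disjointI)
      fix U V assume "U \<in> interior ` D'" "V \<in> interior ` D'" "U \<noteq> V"
      then obtain K L where "K \<in> D'" "L \<in> D'" "U = interior K" "V = interior L" "K \<noteq> L" by blast
      then show "U \<inter> V = {}" using pairwiseD[OF \<D>(3), of K L] D'(2) by blast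
    qed
    then have bf: "box_family D"
      unfolding box_family_def using D' \<D>(2) by (fastforce simp: D_def interior_cbox)
    have "measure lebesgue (\<Union>D') = measure lebesgue (\<Union>D)"
    proof (rule measure_negligible_symdiff[symmetric])
      show "\<Union>D' \<in> lmeasurable" by (rule lmU[OF D'(2,1)])
      have "(\<Union>D' - \<Union>D) \<union> (\<Union>D - \<Union>D') \<subseteq> (\<Union>K\<in>D'. frontier K)"
        unfolding D_def frontier_def using interior_subset closure_subset by fastforce
      moreover have "negligible (\<Union>K\<in>D'. frontier K)"
      proof (rule negligible_Union)
        show "finite (frontier ` D')" using D'(1) by simp
        show "negligible F" if F: "F \<in> frontier ` D'" for F
        proof -
          obtain K where K: "K \<in> D'" "F = frontier K" using F by blast
          then obtain c d where "K = cbox c d" using \<D>(2)[of K] D'(2) by blast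
          then show ?thesis using K by (auto intro!: negligible_convex_frontier)
        qed
      qed
      ultimately show "negligible ((\<Union>D' - \<Union>D) \<union> (\<Union>D - \<Union>D'))" by (rule negligible_subset[rotated])
    qed
    then have "measure lebesgue A - \<epsilon> < measure lebesgue (\<Union>D)" using D'(3) UA by simp
    moreover have "\<Union>D \<subseteq> A" using D'(2) subA interior_subset unfolding D_def by blast
    ultimately show thesis
      using that[OF bf] box_family_Union(1)[OF bf] A by (simp add: measure_completion)
  qed
qed

theorem brunn_minkowski_multiplicative:
  fixes A B :: "'a::euclidean_space set"
  assumes A: "open A" "bounded A" and B: "open B" "bounded B" and t: "0 < t" "t < 1"
  shows "measure lborel A powr (1 - t) * measure lborel B powr t \<le> measure lborel (minkowski_comb t A B)"
proof -
  define C where "C = minkowski_comb t A B"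
  have C: "open C" "bounded C" unfolding C_def using A B t by (auto intro: open_minkowski_comb bounded_minkowski_comb)
  have approx: "x powr (1 - t) * y powr t \<le> measure lborel C"
    if xy: "0 < x" "x < measure lborel A" "0 < y" "y < measure lborel B" for x y
  proof -
    obtain D1 where D1: "box_family D1" "\<Union>D1 \<subseteq> A" "measure lborel A - (measure lborel A - x) < measure lborel (\<Union>D1)"
      using open_box_family_approx[OF A, of "measure lborel A - x"] xy by auto
    obtain D2 where D2: "box_family D2" "\<Union>D2 \<subseteq> B" "measure lborel B - (measure lborel B - y) < measure lborel (\<Union>D2)"
      using open_box_family_approx[OF B, of "measure lborel B - y"] xy by auto
    have "D1 \<noteq> {}" "D2 \<noteq> {}" using D1(3) D2(3) xy by auto
    have "x powr (1 - t) * y powr t \<le> measure lborel (\<Union>D1) powr (1 - t) * measure lborel (\<Union>D2) powr t"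
      using D1(3) D2(3) xy t by (intro mult_mono powr_mono2) auto
    also have "\<dots> \<le> measure lborel (minkowski_comb t (\<Union>D1) (\<Union>D2))"
      using D1 D2 \<open>D1 \<noteq> {}\<close> \<open>D2 \<noteq> {}\<close> t by (intro brunn_minkowski_box_families)
    also have "\<dots> \<le> measure lborel C"
      unfolding C_def using D1 D2 C by (intro measure_lborel_mono_bounded minkowski_comb_mono) (auto simp: C_def)
    finally show ?thesis .
  qed
  show ?thesis
  proof (cases "measure lborel A = 0 \<or> measure lborel B = 0")
    case True
    then show ?thesis by auto
  next
    case False
    then have pos: "0 < measure lborel A" "0 < measure lborel B"
      by (simp_all add: zero_less_measure_iff)
    have lim: "((\<lambda>s. (s * measure lborel A) powr (1 - t) * (s * measure lborel B) powr t) \<longlongrightarrow> (1 * measure lborel A) powr (1 - t) * (1 * measure lborel B) powr t) (at_left 1)"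
      using pos by (intro tendsto_intros) auto
    have "(1 * measure lborel A) powr (1 - t) * (1 * measure lborel B) powr t \<le> measure lborel C"
    proof (rule tendsto_upperbound[OF lim])
      show "\<forall>\<^sub>F s in at_left 1. (s * measure lborel A) powr (1 - t) * (s * measure lborel B) powr t \<le> measure lborel C"
        by (rule eventually_mono[OF eventually_at_left_real[of 0 1]]) (use pos in \<open>auto intro!: approx\<close>)
    qed auto
    then show ?thesis by (simp add: C_def)
  qed
qed

text \<open>The section volume integrated over the thickness \<open>h\<close>. It is the
  \<open>n\<close>-dimensional volume of a convex set, so Brunn--Minkowski applies without lower-dimensional measures,
  and it is continuous also where the section volume jumps.\<close>

definition slab_volume :: "'a::euclidean_space set \<Rightarrow> 'a \<Rightarrow> real \<Rightarrow> real \<Rightarrow> real" where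
  "slab_volume K e h s = measure lborel (K \<inter> {x. s < x \<bullet> e \<and> x \<bullet> e < s + h})"

lemma open_slab: "open {x::'a::euclidean_space. s < x \<bullet> e \<and> x \<bullet> e < s + h}"
  by (intro open_Collect_conj open_Collect_less continuous_intros)

lemma slab_volume_log_concave:
  fixes K :: "'a::euclidean_space set"
  assumes K: "open K" "bounded K" "convex K" and t: "0 < t" "t < 1"
  shows "slab_volume K e h x powr (1 - t) * slab_volume K e h y powr t \<le> slab_volume K e h ((1 - t) * x + t * y)"
proof -
  let ?S = "\<lambda>s. K \<inter> {x. s < x \<bullet> e \<and> x \<bullet> e < s + h}"
  have op: "open (?S s)" "bounded (?S s)" for s using K open_slab by auto
  have "slab_volume K e h x powr (1 - t) * slab_volume K e h y powr t \<le> measure lborel (minkowski_comb t (?S x) (?S y))"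
    unfolding slab_volume_def by (rule brunn_minkowski_multiplicative[OF op op t])
  also have "\<dots> \<le> slab_volume K e h ((1 - t) * x + t * y)"
    unfolding slab_volume_def
  proof (rule measure_lborel_mono_bounded)
    show "minkowski_comb t (?S x) (?S y) \<subseteq> ?S ((1 - t) * x + t * y)"
    proof
      fix z assume "z \<in> minkowski_comb t (?S x) (?S y)"
      then obtain u v where uv: "u \<in> ?S x" "v \<in> ?S y" "z = (1 - t) *\<^sub>R u + t *\<^sub>R v"
        unfolding mem_minkowski_comb by blast
      have zK: "z \<in> K" unfolding uv(3) by (rule convexD[OF K(3)]) (use uv t in auto)
      have z: "z \<bullet> e = (1 - t) * (u \<bullet> e) + t * (v \<bullet> e)" unfolding uv(3) by (simp add: inner_add_left)
      have "(1 - t) * x + t * y < z \<bullet> e"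
        unfolding z using uv t by (intro add_strict_mono mult_strict_left_mono) auto
      moreover have "z \<bullet> e < (1 - t) * (x + h) + t * (y + h)"
        unfolding z using uv t by (intro add_strict_mono mult_strict_left_mono) auto
      then have "z \<bullet> e < (1 - t) * x + t * y + h" by (simp add: algebra_simps)
      ultimately show "z \<in> ?S ((1 - t) * x + t * y)" using zK by simp
    qed
  qed (use op in auto)
  finally show ?thesis .
qed

lemma continuous_slab_volume:
  fixes K :: "'a::euclidean_space set"
  assumes K: "open K" "bounded K" and e: "e \<noteq> 0" and h: "0 \<le> h"
  shows "continuous_on S (slab_volume K e h)"
proof -
  have eq: "slab_volume K e h s = measure lborel (K \<inter> {x. x \<bullet> e < s + h}) - measure lborel (K \<inter> {x. x \<bullet> e < s})" for s
  proof -
    have op: "open {x. x \<bullet> e < c}" for c by (auto intro!: open_Collect_less continuous_intros)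
    define B where "B = K \<inter> {x. x \<bullet> e < s + h}"
    have B: "open B" "bounded B" using K op by (auto simp: B_def)
    have "measure lborel B = measure lborel (B \<inter> {x. x \<bullet> e < s}) + measure lborel (B \<inter> {x. s < x \<bullet> e})"
      by (rule measure_split_hyperplane[OF B e])
    moreover have "B \<inter> {x. x \<bullet> e < s} = K \<inter> {x. x \<bullet> e < s}" using h by (auto simp: B_def)
    moreover have "B \<inter> {x. s < x \<bullet> e} = K \<inter> {x. s < x \<bullet> e \<and> x \<bullet> e < s + h}" by (auto simp: B_def)
    ultimately show ?thesis by (simp add: slab_volume_def B_def)
  qed
  have c: "continuous_on UNIV (\<lambda>c. measure lborel (K \<inter> {x. x \<bullet> e < c}))"
    by (rule continuous_measure_halfspace[OF K e])
  show ?thesis unfolding eq[abs_def]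
    by (intro continuous_on_diff continuous_on_compose2[OF c] continuous_intros) auto
qed

section \<open>Localization to needles\<close>

lemma set_integrable_continuous_bounded:
  fixes f :: "'a::euclidean_space \<Rightarrow> real"
  assumes "continuous_on UNIV f" "bounded K" "K \<in> sets borel"
  shows "set_integrable lborel K f"
proof -
  have "set_integrable lborel (closure K) f"
    unfolding set_integrable_def
    using assms by (intro borel_integrable_compact) (auto intro: continuous_on_subset)
  then show ?thesis
    by (rule set_integrable_subset) (use assms closure_subset in auto)
qed

lemma set_integral_split_hyperplane:
  fixes f :: "'a::euclidean_space \<Rightarrow> real"
  assumes f: "continuous_on UNIV f" and K: "open K" "bounded K" and e: "e \<noteq> 0"
  shows "(LINT x:K|lborel. f x) = (LINT x:K \<inter> {x. x \<bullet> e < c}|lborel. f x) + (LINT x:K \<inter> {x. c < x \<bullet> e}|lborel. f x)"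
proof -
  have op: "open {x. x \<bullet> e < c}" "open {x. c < x \<bullet> e}"
    by (auto intro!: open_Collect_less continuous_intros)
  have int: "set_integrable lborel (K \<inter> {x. x \<bullet> e < c}) f" "set_integrable lborel (K \<inter> {x. c < x \<bullet> e}) f"
    using f K op by (auto intro!: set_integrable_continuous_bounded)
  have fm: "f \<in> borel_measurable lborel" using borel_measurable_continuous_onI[OF f] by simp
  have sets: "K \<in> sets lborel" "K \<inter> {x. x \<bullet> e < c} \<union> K \<inter> {x. c < x \<bullet> e} \<in> sets lborel"
    using K op by (auto intro!: borel_open)
  have "(LINT x:K|lborel. f x) = (LINT x:(K \<inter> {x. x \<bullet> e < c}) \<union> (K \<inter> {x. c < x \<bullet> e})|lborel. f x)"
    unfolding set_lebesgue_integral_def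
  proof (rule integral_cong_AE)
    show "AE x in lborel. indicat_real K x *\<^sub>R f x = indicat_real (K \<inter> {x. x \<bullet> e < c} \<union> K \<inter> {x. c < x \<bullet> e}) x *\<^sub>R f x"
      using AE_lborel_hyperplane[OF e, of c] by eventually_elim (auto simp: indicator_def)
  qed (intro borel_measurable_scaleR borel_measurable_indicator sets fm)+
  also have "\<dots> = (LINT x:K \<inter> {x. x \<bullet> e < c}|lborel. f x) + (LINT x:K \<inter> {x. c < x \<bullet> e}|lborel. f x)"
    by (rule set_integral_Un[OF _ int]) auto
  finally show ?thesis .
qed

text \<open>Rotate the hyperplane through \<open>z\<close> with normal \<open>cos \<theta> i + sin \<theta> j\<close>. The integral of \<open>h\<close> over its positive side
  changes sign after half a turn, because the total integral is zero; hence some \<open>\<theta>\<close> gives integral zero on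
  both sides. One of the two sides has a nonnegative integral of \<open>G\<close>. If the hyperplane misses \<open>K\<close>, then \<open>K\<close>
  itself lies on one side.\<close>

lemma bisect_convex:
  fixes K :: "'a::euclidean_space set" and h G :: "'a \<Rightarrow> real"
  assumes K: "open K" "bounded K" "convex K" "K \<noteq> {}"
    and h: "continuous_on UNIV h" and G: "continuous_on UNIV G"
    and Ih: "(LINT x:K|lborel. h x) = 0" and IG: "0 \<le> (LINT x:K|lborel. G x)"
    and ij: "i \<in> Basis" "j \<in> Basis" "i \<noteq> j"
  shows "\<exists>K' \<alpha> \<beta>. K' \<subseteq> K \<and> open K' \<and> convex K' \<and> K' \<noteq> {} \<and> (LINT x:K'|lborel. h x) = 0 \<and> 0 \<le> (LINT x:K'|lborel. G x)
     \<and> (\<alpha>, \<beta>) \<noteq> (0, 0) \<and> (\<forall>x\<in>K'. 0 \<le> (x - z) \<bullet> (\<alpha> *\<^sub>R i + \<beta> *\<^sub>R j))"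
proof -
  define \<nu> where "\<nu> \<theta> = cos \<theta> *\<^sub>R i + sin \<theta> *\<^sub>R j" for \<theta>
  have \<nu>i: "\<nu> \<theta> \<bullet> i = cos \<theta>" "\<nu> \<theta> \<bullet> j = sin \<theta>" for \<theta>
    using ij by (auto simp: \<nu>_def inner_add_left inner_Basis)
  have \<nu>0: "\<nu> \<theta> \<noteq> 0" for \<theta> using \<nu>i[of \<theta>] sin_cos_squared_add[of \<theta>] by (auto simp del: sin_cos_squared_add)
  have cs0: "(cos \<theta>, sin \<theta>) \<noteq> (0, 0)" for \<theta> :: real using sin_cos_squared_add[of \<theta>] by (auto simp del: sin_cos_squared_add)
  define P where "P \<theta> = K \<inter> {x. z \<bullet> \<nu> \<theta> < x \<bullet> \<nu> \<theta>}" for \<theta>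
  define N where "N \<theta> = K \<inter> {x. x \<bullet> \<nu> \<theta> < z \<bullet> \<nu> \<theta>}" for \<theta>
  have op: "open (P \<theta>)" "open (N \<theta>)" for \<theta>
    unfolding P_def N_def by (auto intro!: open_Int K open_Collect_less continuous_intros)
  have cv: "convex (P \<theta>)" "convex (N \<theta>)" for \<theta>
    unfolding P_def N_def using convex_halfspace_lt[of "\<nu> \<theta>" "z \<bullet> \<nu> \<theta>"] convex_halfspace_gt[of "z \<bullet> \<nu> \<theta>" "\<nu> \<theta>"]
    by (auto intro!: convex_Int K simp: inner_commute)
  have split: "(LINT x:K|lborel. f x) = (LINT x:N \<theta>|lborel. f x) + (LINT x:P \<theta>|lborel. f x)"
    if "continuous_on UNIV f" for f :: "'a \<Rightarrow> real" and \<theta>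
    unfolding P_def N_def by (rule set_integral_split_hyperplane[OF that K(1,2) \<nu>0])
  define g where "g \<theta> = (LINT x:P \<theta>|lborel. h x)" for \<theta>
  have NP: "N \<theta> = P (\<theta> + pi)" for \<theta> by (auto simp: N_def P_def \<nu>_def inner_add_right inner_diff_right)
  have gpi: "g (\<theta> + pi) = - g \<theta>" for \<theta>
    using split[OF h, of \<theta>] Ih by (simp add: g_def NP)
  have contg: "continuous_on {0..pi} g"
    unfolding continuous_on_sequentially comp_def
  proof safe
    fix X :: "nat \<Rightarrow> real" and \<theta> assume X: "X \<longlonglongrightarrow> \<theta>"
    have c: "(\<lambda>n. x \<bullet> \<nu> (X n) - z \<bullet> \<nu> (X n)) \<longlonglongrightarrow> x \<bullet> \<nu> \<theta> - z \<bullet> \<nu> \<theta>" for x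
      unfolding \<nu>_def by (intro tendsto_intros X)
    have hm: "h \<in> borel_measurable borel" using h by (rule borel_measurable_continuous_onI)
    have meas: "(\<lambda>x. indicat_real (P \<theta>) x *\<^sub>R h x) \<in> borel_measurable lborel" for \<theta>
      by (intro borel_measurable_scaleR borel_measurable_indicator) (use op hm in auto)
    show "(\<lambda>n. g (X n)) \<longlonglongrightarrow> g \<theta>"
      unfolding g_def set_lebesgue_integral_def
    proof (rule integral_dominated_convergence[where w = "\<lambda>x. indicator K x *\<^sub>R \<bar>h x\<bar>"])
      have "continuous_on UNIV (\<lambda>x. \<bar>h x\<bar>)" using h by (intro continuous_intros)
      then show "integrable lborel (\<lambda>x. indicat_real K x *\<^sub>R \<bar>h x\<bar>)"
        using set_integrable_continuous_bounded[of "\<lambda>x. \<bar>h x\<bar>" K] K by (simp add: set_integrable_def)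
      show "AE x in lborel. (\<lambda>n. indicat_real (P (X n)) x *\<^sub>R h x) \<longlonglongrightarrow> indicat_real (P \<theta>) x *\<^sub>R h x"
        using AE_lborel_hyperplane[OF \<nu>0[of \<theta>], of "z \<bullet> \<nu> \<theta>"]
      proof eventually_elim
        case (elim x)
        have "\<forall>\<^sub>F n in sequentially. (0 < x \<bullet> \<nu> (X n) - z \<bullet> \<nu> (X n)) = (0 < x \<bullet> \<nu> \<theta> - z \<bullet> \<nu> \<theta>)"
        proof (cases "0 < x \<bullet> \<nu> \<theta> - z \<bullet> \<nu> \<theta>")
          case True
          then show ?thesis using order_tendstoD(1)[OF c True] by (auto elim: eventually_mono)
        next
          case False
          with elim have "x \<bullet> \<nu> \<theta> - z \<bullet> \<nu> \<theta> < 0" by simp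
          from order_tendstoD(2)[OF c this] show ?thesis using False by (auto elim!: eventually_mono)
        qed
        then show ?case
          by (intro tendsto_eventually) (auto elim!: eventually_mono simp: indicator_def P_def)
      qed
    qed (rule meas | simp add: P_def indicator_def)+
  qed
  obtain \<theta> where \<theta>: "g \<theta> = 0"
  proof (cases "g 0 \<le> 0")
    case True
    have "\<exists>x\<ge>0. x \<le> pi \<and> g x = 0"
      using gpi[of 0] True by (intro IVT' contg) auto
    then show ?thesis using that by blast
  next
    case False
    have "\<exists>x\<ge>0. x \<le> pi \<and> g x = 0"
      using gpi[of 0] False by (intro IVT2' contg) auto
    then show ?thesis using that by blast
  qed
  have hP: "(LINT x:P \<theta>|lborel. h x) = 0" using \<theta> by (simp add: g_def)
  have hN: "(LINT x:N \<theta>|lborel. h x) = 0" using split[OF h, of \<theta>] hP Ih by simp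
  have GPN: "0 \<le> (LINT x:N \<theta>|lborel. G x) + (LINT x:P \<theta>|lborel. G x)" using split[OF G, of \<theta>] IG by simp
  have neg: "(x - z) \<bullet> (- cos \<theta> *\<^sub>R i + - sin \<theta> *\<^sub>R j) = - ((x - z) \<bullet> \<nu> \<theta>)" for x
    by (simp add: \<nu>_def inner_add_right inner_diff_right)
  have cs0': "(- cos \<theta>, - sin \<theta>) \<noteq> (0, 0)" using cs0[of \<theta>] by simp
  consider "P \<theta> \<noteq> {}" "0 \<le> (LINT x:P \<theta>|lborel. G x)" | "N \<theta> \<noteq> {}" "0 \<le> (LINT x:N \<theta>|lborel. G x)"
    | "P \<theta> = {}" | "N \<theta> = {}" using GPN by fastforce
  then show ?thesis
  proof cases
    case 1
    then show ?thesis
      using op cv hP cs0[of \<theta>]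
      by (intro exI[of _ "P \<theta>"] exI[of _ "cos \<theta>"] exI[of _ "sin \<theta>"]) (auto simp: P_def inner_diff_left simp flip: \<nu>_def)
  next
    case 2
    then show ?thesis
      using op cv hN cs0' neg
      by (intro exI[of _ "N \<theta>"] exI[of _ "- cos \<theta>"] exI[of _ "- sin \<theta>"] conjI) (auto simp: N_def inner_diff_left simp flip: \<nu>_def)
  next
    case 3
    then have "(x - z) \<bullet> \<nu> \<theta> \<le> 0" if "x \<in> K" for x using that by (force simp: P_def inner_diff_left)
    then show ?thesis
      using K Ih IG cs0' neg
      by (intro exI[of _ K] exI[of _ "- cos \<theta>"] exI[of _ "- sin \<theta>"] conjI) auto
  next
    case 4
    then have "0 \<le> (x - z) \<bullet> \<nu> \<theta>" if "x \<in> K" for x using that by (force simp: N_def inner_diff_left)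
    then show ?thesis
      using K Ih IG cs0[of \<theta>]
      by (intro exI[of _ K] exI[of _ "cos \<theta>"] exI[of _ "sin \<theta>"] conjI) (auto simp flip: \<nu>_def)
  qed
qed

text \<open>Vectors with vanishing \<open>2 \<times> 2\<close> minors in all pairs of coordinates are parallel.\<close>

lemma noncollinear_minor:
  fixes p0 p1 p2 :: "'a::euclidean_space"
  assumes "\<not> collinear {p0, p1, p2}"
  obtains i j where "i \<in> Basis" "j \<in> Basis"
    "((p1 - p0) \<bullet> i) * ((p2 - p0) \<bullet> j) - ((p1 - p0) \<bullet> j) * ((p2 - p0) \<bullet> i) \<noteq> 0"
proof (rule ccontr)
  note witness = that
  assume not: "\<not> thesis"
  define u w where "u = p1 - p0" and "w = p2 - p0"
  have eq: "(u \<bullet> i) * (w \<bullet> j) = (u \<bullet> j) * (w \<bullet> i)" if "i \<in> Basis" "j \<in> Basis" for i j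
  proof (rule ccontr)
    assume "(u \<bullet> i) * (w \<bullet> j) \<noteq> (u \<bullet> j) * (w \<bullet> i)"
    then have thesis by (intro witness[OF that]) (simp add: u_def w_def)
    with not show False ..
  qed
  have u0: "u \<noteq> 0" using assms by (auto simp: u_def insert_commute)
  then obtain i where i: "i \<in> Basis" "u \<bullet> i \<noteq> 0" using euclidean_all_zero_iff[of u] by blast
  define c where "c = (w \<bullet> i) / (u \<bullet> i)"
  have "w = c *\<^sub>R u"
  proof (rule euclidean_eqI)
    fix j :: 'a assume "j \<in> Basis"
    then show "w \<bullet> j = (c *\<^sub>R u) \<bullet> j" using eq[OF i(1), of j] i(2) by (simp add: c_def field_simps)
  qed
  then have "collinear {0, u, w}" by (auto simp: collinear_lemma)
  then have "collinear {p0, p1, p2}" 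
    using collinear_3[of p1 p0 p2] by (simp add: u_def w_def insert_commute)
  then show False using assms by simp
qed

text \<open>Bisect successively through all codimension-two subspaces \<open>z + {i, j}\<^sup>\<bottom>\<close>, with \<open>z\<close> from a countable dense set
  and \<open>i, j\<close> basis vectors. If the intersection \<open>C\<close> of the closures contained a nondegenerate triangle, then
  the projection of the triangle to some coordinate plane would contain some \<open>z\<close> in its interior. The
  cut through this subspace leaves the triangle on one side, although it passes through its interior, so the
  projection would be degenerate. Hence \<open>C\<close> is a segment, and by compactness the sets come close to it.\<close>

theorem needle_localization:
  fixes K :: "'a::euclidean_space set" and h G :: "'a \<Rightarrow> real"
  assumes K: "open K" "bounded K" "convex K" "K \<noteq> {}"
    and h: "continuous_on UNIV h" and G: "continuous_on UNIV G"
    and Ih: "(LINT x:K|lborel. h x) = 0" and IG: "0 \<le> (LINT x:K|lborel. G x)"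
  obtains a b where "a \<in> closure K" "b \<in> closure K"
    "\<And>\<epsilon>. 0 < \<epsilon> \<Longrightarrow> \<exists>K'\<subseteq>K. open K' \<and> convex K' \<and> K' \<noteq> {} \<and> (LINT x:K'|lborel. h x) = 0 \<and> 0 \<le> (LINT x:K'|lborel. G x)
       \<and> (\<forall>x\<in>K'. \<exists>y\<in>closed_segment a b. dist x y < \<epsilon>)"
proof -
  obtain D :: "'a set" where D: "countable D" "\<And>X. open X \<Longrightarrow> X \<noteq> {} \<Longrightarrow> \<exists>d\<in>D. d \<in> X"
    by (rule countable_dense_setE) blast
  define T where "T = (Basis :: 'a set) \<times> (Basis :: 'a set) \<times> D"
  have "countable T" unfolding T_def using D by (intro countable_SIGMA) (auto intro: countable_finite)
  have "D \<noteq> {}" using D(2)[of UNIV] by auto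
  then have "T \<noteq> {}" by (auto simp: T_def)
  define tr where "tr = from_nat_into T"
  have trT: "tr n \<in> T" for n unfolding tr_def by (rule from_nat_into[OF \<open>T \<noteq> {}\<close>])
  have trs: "\<exists>n. tr n = y" if "y \<in> T" for y
    unfolding tr_def using from_nat_into_surj[OF \<open>countable T\<close> that] .
  define good where "good L \<longleftrightarrow> L \<subseteq> K \<and> open L \<and> convex L \<and> L \<noteq> {} \<and> (LINT x:L|lborel. h x) = 0 \<and> 0 \<le> (LINT x:L|lborel. G x)" for L
  define cut where "cut n L' \<longleftrightarrow> (case tr n of (i, j, z) \<Rightarrow> i \<noteq> j \<longrightarrow> 
      (\<exists>\<alpha> \<beta>. (\<alpha>, \<beta>) \<noteq> (0::real, 0::real) \<and> (\<forall>x\<in>L'. 0 \<le> (x - z) \<bullet> (\<alpha> *\<^sub>R i + \<beta> *\<^sub>R j))))" for n L'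
  have "\<exists>F. \<forall>n. good (F n) \<and> (F (Suc n) \<subseteq> F n \<and> cut n (F (Suc n)))"
  proof (rule dependent_nat_choice)
    show "\<exists>L. good L" using K Ih IG by (auto simp: good_def)
    show "\<exists>L'. good L' \<and> (L' \<subseteq> L \<and> cut n L')" if L: "good L" for L n
    proof -
      obtain i j z where t: "tr n = (i, j, z)" by (cases "tr n") auto
      then have ij: "i \<in> Basis" "j \<in> Basis" using trT[of n] by (auto simp: T_def)
      show ?thesis
      proof (cases "i = j")
        case True
        then show ?thesis using L t by (intro exI[of _ L]) (auto simp: cut_def)
      next
        case False
        have "bounded L" using L K(2) by (auto simp: good_def intro: bounded_subset)
        then obtain L' \<alpha> \<beta> where L': "L' \<subseteq> L" "open L'" "convex L'" "L' \<noteq> {}" "(LINT x:L'|lborel. h x) = 0" "0 \<le> (LINT x:L'|lborel. G x)"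
           "(\<alpha>, \<beta>) \<noteq> (0, 0)" "\<forall>x\<in>L'. 0 \<le> (x - z) \<bullet> (\<alpha> *\<^sub>R i + \<beta> *\<^sub>R j)"
          using bisect_convex[of L h G i j z] L h G ij False unfolding good_def by blast
        then have "cut n L'" unfolding cut_def t by auto
        moreover have "good L'" using L' L by (auto simp: good_def)
        ultimately show ?thesis using L' by blast
      qed
    qed
  qed
  then obtain F where F: "\<And>n. good (F n)" "\<And>n. F (Suc n) \<subseteq> F n" "\<And>n. cut n (F (Suc n))" by blast
  have Fmono: "F n \<subseteq> F m" if "m \<le> n" for m n
    using lift_Suc_antimono_le[of F, OF F(2) that] .
  have FK: "F n \<subseteq> K" "F n \<noteq> {}" "convex (F n)" "bounded (F n)" for n
    using F(1)[of n] K(2) by (auto simp: good_def intro: bounded_subset)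
  define C where "C = (\<Inter>n. closure (F n))"
  have cF: "compact (closure (F n))" for n using FK(4)[of n] by (simp add: compact_closure)
  have C: "compact C" "convex C" "C \<noteq> {}"
  proof -
    have "closed C" unfolding C_def by (intro closed_INT) auto
    then have "compact (C \<inter> closure (F 0))" using cF by (rule closed_Int_compact)
    moreover have "C \<inter> closure (F 0) = C" by (auto simp: C_def)
    ultimately show "compact C" by simp
    show "convex C" unfolding C_def using FK by (intro convex_INT convex_closure) auto
    show "C \<noteq> {}" unfolding C_def
    proof (rule compact_nest)
      show "closure (F n) \<subseteq> closure (F m)" if "m \<le> n" for m n
        by (rule closure_mono[OF Fmono[OF that]])
    qed (use cF FK in auto)
  qed
  have col: "collinear C"
  proof (rule ccontr)
    assume nc: "\<not> collinear C"
    obtain p0 where p0: "p0 \<in> C" using C(3) by blast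
    have "\<not> C \<subseteq> {p0}" using nc collinear_subset[of "{p0}" C] by auto
    then obtain p1 where p1: "p1 \<in> C" "p0 \<noteq> p1" by blast
    have "insert p0 (insert p1 C) = C" using p0 p1 by blast
    then obtain p2 where "p2 \<in> C" "\<not> collinear {p0, p1, p2}"
      using nc collinear_triples[OF p1(2), of C] by auto
    with p0 p1 have p: "p0 \<in> C" "p1 \<in> C" "p2 \<in> C" "\<not> collinear {p0, p1, p2}" by auto
    obtain i j where ij: "i \<in> Basis" "j \<in> Basis"
      and m: "((p1 - p0) \<bullet> i) * ((p2 - p0) \<bullet> j) - ((p1 - p0) \<bullet> j) * ((p2 - p0) \<bullet> i) \<noteq> 0"
      using noncollinear_minor[OF p(4)] by blast
    have "i \<noteq> j" using m by auto
    define u w where "u = p1 - p0" and "w = p2 - p0"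
    define \<Delta> where "\<Delta> = (u \<bullet> i) * (w \<bullet> j) - (u \<bullet> j) * (w \<bullet> i)"
    have \<Delta>: "\<Delta> \<noteq> 0" using m by (simp add: \<Delta>_def u_def w_def)
    \<comment> \<open>Cramer's rule: barycentric coordinates of \<open>z\<close> with respect to the projected triangle.\<close>
    define t1 where "t1 z = (((z - p0) \<bullet> i) * (w \<bullet> j) - ((z - p0) \<bullet> j) * (w \<bullet> i)) / \<Delta>" for z
    define t2 where "t2 z = ((u \<bullet> i) * ((z - p0) \<bullet> j) - (u \<bullet> j) * ((z - p0) \<bullet> i)) / \<Delta>" for z
    define S where "S = {z. 0 < t1 z \<and> 0 < t2 z \<and> t1 z + t2 z < 1}"
    have "open S" unfolding S_def t1_def t2_def
      by (intro open_Collect_conj open_Collect_less continuous_intros) (use \<Delta> in auto)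
    moreover have "p0 + (1/3) *\<^sub>R u + (1/3) *\<^sub>R w \<in> S"
    proof -
      have "t1 (p0 + (1/3) *\<^sub>R u + (1/3) *\<^sub>R w) = 1/3" "t2 (p0 + (1/3) *\<^sub>R u + (1/3) *\<^sub>R w) = 1/3"
        using \<Delta> by (simp_all add: t1_def t2_def inner_add_left \<Delta>_def field_simps)
      then show ?thesis by (simp add: S_def)
    qed
    ultimately obtain z where z: "z \<in> D" "z \<in> S"
      using D(2)[of S] by blast
    have sol: "(z - p0) \<bullet> i = t1 z * (u \<bullet> i) + t2 z * (w \<bullet> i)" "(z - p0) \<bullet> j = t1 z * (u \<bullet> j) + t2 z * (w \<bullet> j)"
      using \<Delta> by (simp_all add: t1_def t2_def \<Delta>_def divide_simps) (simp_all add: algebra_simps)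
    obtain n where n: "tr n = (i, j, z)" using trs[of "(i, j, z)"] ij z by (auto simp: T_def)
    obtain \<alpha> \<beta> where ab: "(\<alpha>, \<beta>) \<noteq> (0::real, 0::real)" and half: "\<forall>x\<in>F (Suc n). 0 \<le> (x - z) \<bullet> (\<alpha> *\<^sub>R i + \<beta> *\<^sub>R j)"
      using F(3)[of n] n \<open>i \<noteq> j\<close> by (auto simp: cut_def)
    define \<nu> where "\<nu> = \<alpha> *\<^sub>R i + \<beta> *\<^sub>R j"
    have halfC: "0 \<le> (x - z) \<bullet> \<nu>" if "x \<in> C" for x
    proof -
      have "closed {x. 0 \<le> (x - z) \<bullet> \<nu>}" by (intro closed_Collect_le continuous_intros)
      then have "closure (F (Suc n)) \<subseteq> {x. 0 \<le> (x - z) \<bullet> \<nu>}"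
        using half by (intro closure_minimal) (auto simp: \<nu>_def)
      then show ?thesis using that by (auto simp: C_def)
    qed
    have z\<nu>: "(z - p0) \<bullet> \<nu> = t1 z * (u \<bullet> \<nu>) + t2 z * (w \<bullet> \<nu>)"
      unfolding \<nu>_def inner_add_right inner_scaleR_right sol by (simp add: algebra_simps)
    define q0 q1 q2 where "q0 = (p0 - z) \<bullet> \<nu>" and "q1 = (p1 - z) \<bullet> \<nu>" and "q2 = (p2 - z) \<bullet> \<nu>"
    have q: "0 \<le> q0" "0 \<le> q1" "0 \<le> q2" using halfC p by (auto simp: q0_def q1_def q2_def)
    have uq: "u \<bullet> \<nu> = q1 - q0" "w \<bullet> \<nu> = q2 - q0" by (simp_all add: u_def w_def q0_def q1_def q2_def inner_diff_left)
    have t: "0 < t1 z" "0 < t2 z" "0 < 1 - t1 z - t2 z" using z by (auto simp: S_def)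
    have sum0: "(1 - t1 z - t2 z) * q0 + t1 z * q1 + t2 z * q2 = 0"
    proof -
      have "- q0 = t1 z * (q1 - q0) + t2 z * (q2 - q0)"
        using z\<nu> unfolding uq by (simp add: q0_def inner_diff_left)
      then show ?thesis by (simp add: algebra_simps)
    qed
    have "0 \<le> (1 - t1 z - t2 z) * q0" "0 \<le> t1 z * q1" "0 \<le> t2 z * q2" using t q by auto
    with sum0 have "(1 - t1 z - t2 z) * q0 = 0" "t1 z * q1 = 0" "t2 z * q2 = 0" by linarith+
    then have "q0 = 0" "q1 = 0" "q2 = 0" using t by auto
    then have uw: "u \<bullet> \<nu> = 0" "w \<bullet> \<nu> = 0" using uq by auto
    then have e: "\<alpha> * (u \<bullet> i) + \<beta> * (u \<bullet> j) = 0" "\<alpha> * (w \<bullet> i) + \<beta> * (w \<bullet> j) = 0"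
      by (simp_all add: \<nu>_def inner_add_right)
    have "\<alpha> * \<Delta> = (w \<bullet> j) * (\<alpha> * (u \<bullet> i) + \<beta> * (u \<bullet> j)) - (u \<bullet> j) * (\<alpha> * (w \<bullet> i) + \<beta> * (w \<bullet> j))"
      "\<beta> * \<Delta> = (u \<bullet> i) * (\<alpha> * (w \<bullet> i) + \<beta> * (w \<bullet> j)) - (w \<bullet> i) * (\<alpha> * (u \<bullet> i) + \<beta> * (u \<bullet> j))"
      by (simp_all add: \<Delta>_def algebra_simps)
    then have "\<alpha> * \<Delta> = 0" "\<beta> * \<Delta> = 0" unfolding e by simp_all
    then show False using ab \<Delta> by simp
  qed
  obtain a b where Cab: "C = closed_segment a b"
    using compact_convex_collinear_segment[OF C(3,1,2) col] by blast
  show thesis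
  proof (rule that[of a b])
    have "C \<subseteq> closure (F 0)" by (auto simp: C_def)
    then have "C \<subseteq> closure K" using closure_mono[OF FK(1)[of 0]] by blast
    then show "a \<in> closure K" "b \<in> closure K" using Cab by auto
    fix \<epsilon> :: real assume \<epsilon>: "0 < \<epsilon>"
    define U where "U = (\<Union>y\<in>C. ball y \<epsilon>)"
    have "open U" by (auto simp: U_def)
    have "\<exists>n. F n \<subseteq> U"
    proof (rule ccontr)
      assume no: "\<nexists>n. F n \<subseteq> U"
      have "(\<Inter>n. closure (F n) - U) \<noteq> {}"
      proof (rule compact_nest)
        show "compact (closure (F n) - U)" for n by (intro compact_diff cF \<open>open U\<close>)
        show "closure (F n) - U \<noteq> {}" for n using no closure_subset by fastforce
        show "closure (F n) - U \<subseteq> closure (F m) - U" if "m \<le> n" for m n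
          using closure_mono[OF Fmono[OF that]] by blast
      qed
      then obtain x where "x \<in> C" "x \<notin> U" by (auto simp: C_def)
      then show False using \<epsilon> by (auto simp: U_def)
    qed
    then obtain n where n: "F n \<subseteq> U" by blast
    have "\<forall>x\<in>F n. \<exists>y\<in>closed_segment a b. dist x y < \<epsilon>"
      using n unfolding Cab[symmetric] by (force simp: U_def dist_commute)
    then show "\<exists>K'\<subseteq>K. open K' \<and> convex K' \<and> K' \<noteq> {} \<and> (LINT x:K'|lborel. h x) = 0 \<and> 0 \<le> (LINT x:K'|lborel. G x)
       \<and> (\<forall>x\<in>K'. \<exists>y\<in>closed_segment a b. dist x y < \<epsilon>)"
      using F(1)[of n] unfolding good_def by (intro exI[of _ "F n"]) blast
  qed
qed

section \<open>The Poincare inequality for continuously differentiable functions\<close>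

lemma measure_lborel_open_pos:
  fixes K :: "'a::euclidean_space set"
  assumes "open K" "bounded K" "K \<noteq> {}"
  shows "0 < measure lborel K"
proof -
  have "emeasure lborel K \<noteq> 0"
  proof
    assume "emeasure lborel K = 0"
    then have "K \<in> null_sets lebesgue"
      using assms(1) by (intro null_sets_completionI) auto
    then show False using open_not_negligible[OF assms(1,3)] by (simp add: negligible_iff_null_sets)
  qed
  then show ?thesis
    using bounded_emeasure_lborel_finite[OF assms(2)]
    by (simp add: measure_def enn2real_positive_iff zero_less_iff_neq_zero)
qed

text \<open>Convexity of \<open>|r|\<^sup>p\<close>. Integrated over a set on which \<open>|r|\<^sup>p\<^sup>-\<^sup>2 r\<close> has mean zero, it says that subtracting a
  constant does not decrease the \<open>L\<^sup>p\<close> norm.\<close>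

lemma abs_powr_tangent:
  fixes r c p :: real
  assumes p: "1 < p"
  shows "\<bar>r\<bar> powr p - p * c * (\<bar>r\<bar> powr (p - 2) * r) \<le> \<bar>r - c\<bar> powr p"
proof (cases "r = 0")
  case False
  have e: "\<bar>r\<bar> powr (p - 1) = \<bar>r\<bar> powr (p - 2) * \<bar>r\<bar>" "\<bar>r\<bar> powr p = \<bar>r\<bar> powr (p - 2) * (r * r)"
    using False powr_add[of "\<bar>r\<bar>" "p - 2" 1] powr_add[of "\<bar>r\<bar>" "p - 2" 2] by (simp_all add: power2_eq_square)
  have "p * (\<bar>r\<bar> powr (p - 2) * (r * (r - c))) \<le> p * (\<bar>r\<bar> powr (p - 2) * (\<bar>r\<bar> * \<bar>r - c\<bar>))"
    using p by (intro mult_left_mono) (auto simp flip: abs_mult)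
  also have "\<dots> = p * \<bar>r\<bar> powr (p - 1) * \<bar>r - c\<bar>" by (simp add: e)
  also have "\<dots> \<le> \<bar>r - c\<bar> powr p + (p - 1) * \<bar>r\<bar> powr p" by (rule Young_powr) (use p in auto)
  finally have "p * (\<bar>r\<bar> powr (p - 2) * (r * (r - c))) - (p - 1) * \<bar>r\<bar> powr p \<le> \<bar>r - c\<bar> powr p" by simp
  then show ?thesis unfolding e by (simp add: algebra_simps)
qed auto

lemma continuous_signed_powr:
  fixes f :: "'a::topological_space \<Rightarrow> real"
  assumes p: "1 < p" and f: "continuous_on S f"
  shows "continuous_on S (\<lambda>x. \<bar>f x\<bar> powr (p - 2) * f x)"
proof -
  have eq: "\<bar>r\<bar> powr (p - 2) * r = (max r 0) powr (p - 1) - (max (- r) 0) powr (p - 1)" for r :: real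
  proof (cases "r = 0")
    case False
    have "\<bar>r\<bar> powr (p - 1) = \<bar>r\<bar> powr (p - 2) * \<bar>r\<bar>"
      using False powr_add[of "\<bar>r\<bar>" "p - 2" 1] by simp
    then show ?thesis using False by (cases "r > 0") (auto simp: max_def)
  qed auto
  show ?thesis unfolding eq
    using p by (intro continuous_on_diff continuous_on_powr' continuous_on_max continuous_on_minus continuous_on_const f) auto
qed

text \<open>Integrating a function of \<open>x \<bullet> e\<close> against the slab volume means averaging it over windows of width \<open>h\<close>;
  this transfers the inequality on an interval to \<open>K\<close>.\<close>

lemma slab_fubini:
  fixes K :: "'a::euclidean_space set" and k :: "real \<Rightarrow> real"
  assumes K: "open K" "bounded K" and e: "e \<noteq> 0" and h: "0 < h" and k: "continuous_on UNIV k" "\<And>s. 0 \<le> k s"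
    and rng: "\<And>x. x \<in> K \<Longrightarrow> \<alpha> \<le> x \<bullet> e - h \<and> x \<bullet> e \<le> \<omega>"
  shows "ennreal (integral {\<alpha>..\<omega>} (\<lambda>s. k s * slab_volume K e h s)) =
     (\<integral>\<^sup>+x. (\<integral>\<^sup>+s. ennreal (k s) * indicator {x \<bullet> e - h<..<x \<bullet> e} s \<partial>lborel) * indicator K x \<partial>lborel)"
proof -
  let ?F = "\<lambda>s. k s * slab_volume K e h s"
  have [measurable]: "k \<in> borel_measurable borel" using k(1) by (rule borel_measurable_continuous_onI)
  have [measurable]: "K \<in> sets borel" using K by auto
  have contF: "continuous_on {\<alpha>..\<omega>} ?F"
    using h by (intro continuous_on_mult continuous_on_subset[OF k(1)] continuous_slab_volume K e) auto
  have F0: "0 \<le> ?F s" for s using k(2) by (simp add: slab_volume_def)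
  have si: "set_integrable lborel {\<alpha>..\<omega>} ?F"
    using contF by (rule borel_integrable_atLeastAtMost')
  have out: "slab_volume K e h s = 0" if "s \<notin> {\<alpha>..\<omega>}" for s
  proof -
    have "K \<inter> {x. s < x \<bullet> e \<and> x \<bullet> e < s + h} = {}" using rng that by force
    then show ?thesis by (simp add: slab_volume_def)
  qed
  have "ennreal (integral {\<alpha>..\<omega>} ?F) = ennreal (LINT s:{\<alpha>..\<omega>}|lborel. ?F s)"
    using set_borel_integral_eq_integral(2)[OF si] by simp
  also have "\<dots> = (\<integral>\<^sup>+s. ennreal (indicator {\<alpha>..\<omega>} s *\<^sub>R ?F s) \<partial>lborel)"
    unfolding set_lebesgue_integral_def using si F0
    by (intro nn_integral_eq_integral[symmetric]) (auto simp: set_integrable_def)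
  also have "\<dots> = (\<integral>\<^sup>+s. (\<integral>\<^sup>+x. ennreal (k s) * indicator {x\<in>K. s < x \<bullet> e \<and> x \<bullet> e < s + h} x \<partial>lborel) \<partial>lborel)"
  proof (rule nn_integral_cong)
    fix s :: real
    let ?S = "{x\<in>K. s < x \<bullet> e \<and> x \<bullet> e < s + h}"
    have S: "?S = K \<inter> {x. s < x \<bullet> e \<and> x \<bullet> e < s + h}" by auto
    have op: "open ?S" unfolding S using K open_slab by auto
    have "bounded ?S" using K(2) by (rule bounded_subset) auto
    then have fin: "emeasure lborel ?S = ennreal (slab_volume K e h s)"
      using bounded_emeasure_lborel_finite[of ?S] unfolding slab_volume_def S
      by (intro emeasure_eq_ennreal_measure) auto
    have "(\<integral>\<^sup>+x. ennreal (k s) * indicator ?S x \<partial>lborel) = ennreal (k s) * emeasure lborel ?S"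
      using op by (intro nn_integral_cmult_indicator) auto
    also have "\<dots> = ennreal (?F s)" unfolding fin using k(2) by (simp add: ennreal_mult' slab_volume_def)
    also have "\<dots> = ennreal (indicator {\<alpha>..\<omega>} s *\<^sub>R ?F s)" using out[of s] by (auto simp: indicator_def)
    finally show "ennreal (indicator {\<alpha>..\<omega>} s *\<^sub>R ?F s) = (\<integral>\<^sup>+x. ennreal (k s) * indicator ?S x \<partial>lborel)" by simp
  qed
  also have "\<dots> = (\<integral>\<^sup>+x. (\<integral>\<^sup>+s. ennreal (k s) * indicator {x\<in>K. s < x \<bullet> e \<and> x \<bullet> e < s + h} x \<partial>lborel) \<partial>lborel)"
    by (rule lborel_pair.Fubini') (unfold case_prod_beta, measurable)
  also have "\<dots> = (\<integral>\<^sup>+x. (\<integral>\<^sup>+s. ennreal (k s) * indicator {x \<bullet> e - h<..<x \<bullet> e} s * indicator K x \<partial>lborel) \<partial>lborel)"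
    by (intro nn_integral_cong) (auto simp: indicator_def)
  also have "\<dots> = (\<integral>\<^sup>+x. (\<integral>\<^sup>+s. ennreal (k s) * indicator {x \<bullet> e - h<..<x \<bullet> e} s \<partial>lborel) * indicator K x \<partial>lborel)"
    by (intro nn_integral_cong nn_integral_multc borel_measurable_times_ennreal borel_measurable_indicator
        measurable_compose[OF _ measurable_ennreal]) auto
  finally show ?thesis .
qed

text \<open>Restrict \<open>u\<close> to the line \<open>a + s e\<close> and use the slab volume of thickness \<open>\<epsilon>\<close> as weight. All points that are
  compared lie within \<open>3 \<epsilon>\<close> of each other, so each replacement costs at most \<open>\<eta>\<close> per unit volume. The
  projection of \<open>K\<close> has length at most \<open>l + 2 \<epsilon>\<close>, and the thickness adds another \<open>\<epsilon>\<close>.\<close>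

lemma thin_convex_poincare:
  fixes K :: "'a::euclidean_space set" and u :: "'a \<Rightarrow> real" and g :: "'a \<Rightarrow> 'a"
  assumes p: "1 < p" and m: "0 < m" and Zm: "0 < Zm"
    and L: "L / 2 \<le> integral {0..Zm} (\<lambda>z. 1 / (1 + m * z powr p))"
    and u: "\<And>x. (u has_derivative (\<lambda>v. g x \<bullet> v)) (at x)" and g: "continuous_on UNIV g"
    and K: "open K" "convex K" "K \<noteq> {}" "bounded K"
    and e: "norm e = 1" and \<epsilon>: "0 < \<epsilon>" and l: "0 \<le> l" "l + 3 * \<epsilon> \<le> L"
    and thin: "\<And>x. x \<in> K \<Longrightarrow> \<exists>s\<in>{0..l}. dist x (a + s *\<^sub>R e) < \<epsilon>"
    and close_u: "\<And>x y c. x \<in> K \<Longrightarrow> y \<in> S \<Longrightarrow> c \<in> S \<Longrightarrow> dist x y < 3 * \<epsilon> \<Longrightarrow> \<bar>u x - u c\<bar> powr p \<le> \<bar>u y - u c\<bar> powr p + \<eta>"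
    and close_g: "\<And>x y. x \<in> K \<Longrightarrow> y \<in> S \<Longrightarrow> dist x y < 3 * \<epsilon> \<Longrightarrow> norm (g y) powr p \<le> norm (g x) powr p + \<eta>"
    and S: "\<And>s. s \<in> {- 2 * \<epsilon>..l + \<epsilon>} \<Longrightarrow> a + s *\<^sub>R e \<in> S" and \<eta>: "0 \<le> \<eta>"
  obtains c where "(p - 1) * m * (LINT x:K|lborel. \<bar>u x - c\<bar> powr p)
      \<le> (LINT x:K|lborel. norm (g x) powr p) + ((p - 1) * m + 1) * \<eta> * measure lborel K"
proof -
  define \<mu> where "\<mu> = (p - 1) * m"
  have \<mu>: "0 < \<mu>" using p m by (simp add: \<mu>_def)
  have e0: "e \<noteq> 0" using e by auto
  define \<sigma> where "\<sigma> = a \<bullet> e"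
  define \<alpha> \<omega> where "\<alpha> = \<sigma> - 2 * \<epsilon>" and "\<omega> = \<sigma> + l + \<epsilon>"
  define f where "f = slab_volume K e \<epsilon>"
  have ee: "e \<bullet> e = 1" using e by (simp add: norm_eq_sqrt_inner)
  have near: "x \<bullet> e \<in> {\<sigma> - \<epsilon><..<\<sigma> + l + \<epsilon>} \<and> (\<forall>s. \<bar>s - x \<bullet> e\<bar> \<le> \<epsilon> \<longrightarrow> dist x (a + (s - \<sigma>) *\<^sub>R e) < 3 * \<epsilon>)" if x: "x \<in> K" for x
  proof -
    obtain s0 where s0: "s0 \<in> {0..l}" "dist x (a + s0 *\<^sub>R e) < \<epsilon>" using thin[OF x] by blast
    have "(x - (a + s0 *\<^sub>R e)) \<bullet> e = x \<bullet> e - \<sigma> - s0" by (simp add: inner_diff_left inner_add_left ee \<sigma>_def)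
    moreover have "\<bar>(x - (a + s0 *\<^sub>R e)) \<bullet> e\<bar> \<le> norm (x - (a + s0 *\<^sub>R e)) * norm e" by (rule Cauchy_Schwarz_ineq2)
    ultimately have 1: "\<bar>x \<bullet> e - \<sigma> - s0\<bar> < \<epsilon>" using s0(2) e by (simp add: dist_norm)
    have "dist x (a + (s - \<sigma>) *\<^sub>R e) < 3 * \<epsilon>" if s: "\<bar>s - x \<bullet> e\<bar> \<le> \<epsilon>" for s
    proof -
      have "dist x (a + (s - \<sigma>) *\<^sub>R e) \<le> dist x (a + s0 *\<^sub>R e) + dist (a + s0 *\<^sub>R e) (a + (s - \<sigma>) *\<^sub>R e)"
        by (rule dist_triangle)
      also have "dist (a + s0 *\<^sub>R e) (a + (s - \<sigma>) *\<^sub>R e) = \<bar>s0 - (s - \<sigma>)\<bar>"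
        using e by (simp add: dist_norm flip: scaleR_left_diff_distrib)
      also have "\<dots> \<le> 2 * \<epsilon>" using 1 s by linarith
      finally show ?thesis using s0(2) by linarith
    qed
    then show ?thesis using 1 s0(1) by auto
  qed
  have rng: "\<alpha> \<le> x \<bullet> e - \<epsilon> \<and> x \<bullet> e \<le> \<omega>" if "x \<in> K" for x
    using near[OF that] by (auto simp: \<alpha>_def \<omega>_def)
  have le: "\<alpha> \<le> \<omega>" using l \<epsilon> by (simp add: \<alpha>_def \<omega>_def)
  have contf: "continuous_on {\<alpha>..\<omega>} f" unfolding f_def using \<epsilon> by (intro continuous_slab_volume K e0) auto
  have f0: "0 \<le> f x" for x by (simp add: f_def slab_volume_def)
  have fpos: "\<exists>s\<in>{\<alpha>..\<omega>}. 0 < f s"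
  proof -
    obtain x where x: "x \<in> K" using K(3) by blast
    define s where "s = x \<bullet> e - \<epsilon> / 2"
    let ?S = "K \<inter> {x. s < x \<bullet> e \<and> x \<bullet> e < s + \<epsilon>}"
    have "open ?S" using K(1) open_slab by auto
    moreover have "x \<in> ?S" using x \<epsilon> by (simp add: s_def)
    moreover have "bounded ?S" using K(4) by (rule bounded_subset) auto
    ultimately have "0 < f s" unfolding f_def slab_volume_def by (intro measure_lborel_open_pos) auto
    moreover have "s \<in> {\<alpha>..\<omega>}" using rng[OF x] \<epsilon> by (auto simp: s_def)
    ultimately show ?thesis by blast
  qed
  have L': "(\<omega> - \<alpha>) / 2 \<le> integral {0..Zm} (\<lambda>z. 1 / (1 + m * z powr p))"
    using L l by (simp add: \<alpha>_def \<omega>_def)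
  obtain s0 where s0: "s0 \<in> {\<alpha>..\<omega>}" and P: "\<And>v v'. \<lbrakk>\<And>x. (v has_real_derivative v' x) (at x); continuous_on UNIV v'\<rbrakk> \<Longrightarrow>
      (p - 1) * m * integral {\<alpha>..\<omega>} (\<lambda>x. \<bar>v x - v s0\<bar> powr p * f x) \<le> integral {\<alpha>..\<omega>} (\<lambda>x. \<bar>v' x\<bar> powr p * f x)"
    by (rule log_concave_poincare_interval[OF p m Zm le L' f0 contf fpos])
       (use slab_volume_log_concave[OF K(1,4,2), of _ e \<epsilon>] in \<open>auto simp: f_def\<close>)
  define v where "v s = u (a + (s - \<sigma>) *\<^sub>R e)" for s
  define v' where "v' s = g (a + (s - \<sigma>) *\<^sub>R e) \<bullet> e" for s
  have v: "(v has_real_derivative v' s) (at s)" for s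
  proof -
    have "((\<lambda>s. a + (s - \<sigma>) *\<^sub>R e) has_derivative (\<lambda>t. t *\<^sub>R e)) (at s)"
      by (auto intro!: derivative_eq_intros)
    from has_derivative_compose[OF this u]
    have "(v has_derivative (\<lambda>t. g (a + (s - \<sigma>) *\<^sub>R e) \<bullet> (t *\<^sub>R e))) (at s)" by (simp add: v_def[abs_def])
    then show ?thesis by (simp add: has_field_derivative_def v'_def mult.commute[of _ "_ \<bullet> _"] mult_commute_abs)
  qed
  have contv': "continuous_on UNIV v'" unfolding v'_def
    by (intro continuous_intros continuous_on_compose2[OF g]) auto
  have contv: "continuous_on UNIV v"
    using v by (meson DERIV_continuous_on has_field_derivative_at_within)
  define c where "c = v s0"
  have inS: "a + (s - \<sigma>) *\<^sub>R e \<in> S" if "s \<in> {\<alpha>..\<omega>}" for s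
    using S[of "s - \<sigma>"] that by (auto simp: \<alpha>_def \<omega>_def)
  have cont_u: "continuous_on UNIV u"
    by (intro continuous_at_imp_continuous_on ballI has_derivative_continuous[OF u])
  define A where "A x = \<bar>u x - c\<bar> powr p" for x
  define B where "B x = norm (g x) powr p" for x
  have contA: "continuous_on UNIV A" unfolding A_def
    using p by (intro continuous_on_powr' continuous_intros cont_u) auto
  have contB: "continuous_on UNIV B" unfolding B_def
    using p by (intro continuous_on_powr' continuous_intros g) auto
  define kA where "kA s = \<bar>v s - c\<bar> powr p" for s
  define kB where "kB s = \<bar>v' s\<bar> powr p" for s
  have contk: "continuous_on UNIV kA" "continuous_on UNIV kB" unfolding kA_def kB_def
    using p by (auto intro!: continuous_on_powr' continuous_on_rabs continuous_on_diff contv contv' continuous_on_const)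
  have AB: "A x \<le> kA s + \<eta>" "kB s \<le> B x + \<eta>" if x: "x \<in> K" and s: "s \<in> {x \<bullet> e - \<epsilon><..<x \<bullet> e}" for x s
  proof -
    have sr: "s \<in> {\<alpha>..\<omega>}" using rng[OF x] s by auto
    have d: "dist x (a + (s - \<sigma>) *\<^sub>R e) < 3 * \<epsilon>" using near[OF x] s by auto
    show "A x \<le> kA s + \<eta>" unfolding A_def kA_def c_def v_def
      by (rule close_u[OF x inS[OF sr] inS[OF s0] d])
    have "kB s \<le> norm (g (a + (s - \<sigma>) *\<^sub>R e)) powr p"
      unfolding kB_def v'_def using p Cauchy_Schwarz_ineq2[of "g (a + (s - \<sigma>) *\<^sub>R e)" e] e
      by (intro powr_mono2) auto
    also have "\<dots> \<le> B x + \<eta>" unfolding B_def by (rule close_g[OF x inS[OF sr] d])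
    finally show "kB s \<le> B x + \<eta>" .
  qed
  have [measurable]: "K \<in> sets borel" "kA \<in> borel_measurable borel" "kB \<in> borel_measurable borel"
      "A \<in> borel_measurable borel" "B \<in> borel_measurable borel"
    using K contk contA contB by (auto intro: borel_measurable_continuous_onI)
  have A0: "0 \<le> A x" and B0: "0 \<le> B x" and kA0: "0 \<le> kA s" and kB0: "0 \<le> kB s" for x s by (auto simp: A_def B_def kA_def kB_def)
  have nnK: "(\<integral>\<^sup>+x. ennreal (F x) * indicator K x \<partial>lborel) = ennreal (LINT x:K|lborel. F x)"
    if "continuous_on UNIV F" "\<And>x. 0 \<le> F x" for F :: "'a \<Rightarrow> real"
  proof -
    have "set_integrable lborel K F" using that K by (intro set_integrable_continuous_bounded) auto
    then have "(\<integral>\<^sup>+x. ennreal (indicator K x *\<^sub>R F x) \<partial>lborel) = ennreal (LINT x:K|lborel. F x)"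
      unfolding set_integrable_def set_lebesgue_integral_def using that by (intro nn_integral_eq_integral) auto
    moreover have "ennreal (F x) * indicator K x = ennreal (indicator K x *\<^sub>R F x)" for x by (auto simp: indicator_def)
    ultimately show ?thesis by simp
  qed
  have interval: "(\<integral>\<^sup>+s. ennreal r * indicator {x \<bullet> e - \<epsilon><..<x \<bullet> e} s \<partial>lborel) = ennreal (\<epsilon> * r)" if "0 \<le> r" for r x
    using \<epsilon> that by (subst nn_integral_cmult_indicator) (auto simp: ennreal_mult'[symmetric] mult.commute)
  have I1: "\<epsilon> * (LINT x:K|lborel. A x) \<le> integral {\<alpha>..\<omega>} (\<lambda>s. kA s * f s) + \<epsilon> * \<eta> * measure lborel K"
  proof -
    have "ennreal (\<epsilon> * (LINT x:K|lborel. A x)) = (\<integral>\<^sup>+x. ennreal (\<epsilon> * A x) * indicator K x \<partial>lborel)"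
      by (subst nnK) (use contA A0 \<epsilon> in \<open>auto intro!: continuous_intros\<close>)
    also have "\<dots> \<le> (\<integral>\<^sup>+x. ((\<integral>\<^sup>+s. ennreal (kA s) * indicator {x \<bullet> e - \<epsilon><..<x \<bullet> e} s \<partial>lborel) * indicator K x + ennreal (\<epsilon> * \<eta>) * indicator K x) \<partial>lborel)"
    proof (rule nn_integral_mono)
      fix x :: 'a
      show "ennreal (\<epsilon> * A x) * indicator K x \<le> (\<integral>\<^sup>+s. ennreal (kA s) * indicator {x \<bullet> e - \<epsilon><..<x \<bullet> e} s \<partial>lborel) * indicator K x + ennreal (\<epsilon> * \<eta>) * indicator K x"
      proof (cases "x \<in> K")
        case True
        have "ennreal (\<epsilon> * A x) = (\<integral>\<^sup>+s. ennreal (A x) * indicator {x \<bullet> e - \<epsilon><..<x \<bullet> e} s \<partial>lborel)"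
          using interval[OF A0] by simp
        also have "\<dots> \<le> (\<integral>\<^sup>+s. (ennreal (kA s) * indicator {x \<bullet> e - \<epsilon><..<x \<bullet> e} s + ennreal \<eta> * indicator {x \<bullet> e - \<epsilon><..<x \<bullet> e} s) \<partial>lborel)"
          using AB(1)[OF True] kA0 \<eta> by (intro nn_integral_mono) (auto simp: indicator_def ennreal_plus[symmetric] simp del: ennreal_plus intro!: ennreal_leI)
        also have "\<dots> = (\<integral>\<^sup>+s. ennreal (kA s) * indicator {x \<bullet> e - \<epsilon><..<x \<bullet> e} s \<partial>lborel) + ennreal (\<epsilon> * \<eta>)"
          using interval[OF \<eta>] by (subst nn_integral_add) auto
        finally show ?thesis using True by simp
      qed auto
    qed
    also have "\<dots> = (\<integral>\<^sup>+x. (\<integral>\<^sup>+s. ennreal (kA s) * indicator {x \<bullet> e - \<epsilon><..<x \<bullet> e} s \<partial>lborel) * indicator K x \<partial>lborel) + (\<integral>\<^sup>+x. ennreal (\<epsilon> * \<eta>) * indicator K x \<partial>lborel)"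
    proof (rule nn_integral_add)
      have eq: "(\<lambda>x. \<integral>\<^sup>+s. ennreal (kA s) * indicator {x \<bullet> e - \<epsilon><..<x \<bullet> e} s \<partial>lborel)
          = (\<lambda>x. \<integral>\<^sup>+s. (if x \<bullet> e - \<epsilon> < s \<and> s < x \<bullet> e then ennreal (kA s) else 0) \<partial>lborel)"
        by (auto intro!: ext nn_integral_cong simp: indicator_def)
      have "(\<lambda>x. \<integral>\<^sup>+s. ennreal (kA s) * indicator {x \<bullet> e - \<epsilon><..<x \<bullet> e} s \<partial>lborel) \<in> borel_measurable lborel"
        unfolding eq by measurable
      then show "(\<lambda>x. (\<integral>\<^sup>+s. ennreal (kA s) * indicator {x \<bullet> e - \<epsilon><..<x \<bullet> e} s \<partial>lborel) * indicator K x) \<in> borel_measurable lborel"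
        by measurable
    qed simp
    also have "(\<integral>\<^sup>+x. (\<integral>\<^sup>+s. ennreal (kA s) * indicator {x \<bullet> e - \<epsilon><..<x \<bullet> e} s \<partial>lborel) * indicator K x \<partial>lborel) = ennreal (integral {\<alpha>..\<omega>} (\<lambda>s. kA s * f s))"
      unfolding f_def by (rule slab_fubini[symmetric]) (use K e0 \<epsilon> contk kA0 rng in auto)
    also have "(\<integral>\<^sup>+x. ennreal (\<epsilon> * \<eta>) * indicator K x \<partial>lborel) = ennreal (\<epsilon> * \<eta> * measure lborel K)"
      using \<epsilon> \<eta> by (subst nnK) (auto simp: set_lebesgue_integral_def intro!: continuous_intros)
    finally have "ennreal (\<epsilon> * (LINT x:K|lborel. A x)) \<le> ennreal (integral {\<alpha>..\<omega>} (\<lambda>s. kA s * f s)) + ennreal (\<epsilon> * \<eta> * measure lborel K)" .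
    moreover have "0 \<le> integral {\<alpha>..\<omega>} (\<lambda>s. kA s * f s)"
      by (intro integral_nonneg integrable_continuous_real continuous_on_mult contf continuous_on_subset[OF contk(1)]) (auto simp: kA0 f0)
    moreover have "0 \<le> \<epsilon> * \<eta> * measure lborel K" using \<epsilon> \<eta> by simp
    ultimately show ?thesis
      by (metis ennreal_plus ennreal_le_iff add_nonneg_nonneg)
  qed
  have I2: "integral {\<alpha>..\<omega>} (\<lambda>s. kB s * f s) \<le> \<epsilon> * (LINT x:K|lborel. B x) + \<epsilon> * \<eta> * measure lborel K"
  proof -
    have "ennreal (integral {\<alpha>..\<omega>} (\<lambda>s. kB s * f s)) = (\<integral>\<^sup>+x. (\<integral>\<^sup>+s. ennreal (kB s) * indicator {x \<bullet> e - \<epsilon><..<x \<bullet> e} s \<partial>lborel) * indicator K x \<partial>lborel)"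
      unfolding f_def by (rule slab_fubini) (use K e0 \<epsilon> contk kB0 rng in auto)
    also have "\<dots> \<le> (\<integral>\<^sup>+x. ennreal (\<epsilon> * (B x + \<eta>)) * indicator K x \<partial>lborel)"
    proof (rule nn_integral_mono)
      fix x :: 'a
      show "(\<integral>\<^sup>+s. ennreal (kB s) * indicator {x \<bullet> e - \<epsilon><..<x \<bullet> e} s \<partial>lborel) * indicator K x \<le> ennreal (\<epsilon> * (B x + \<eta>)) * indicator K x"
      proof (cases "x \<in> K")
        case True
        have "(\<integral>\<^sup>+s. ennreal (kB s) * indicator {x \<bullet> e - \<epsilon><..<x \<bullet> e} s \<partial>lborel) \<le> (\<integral>\<^sup>+s. ennreal (B x + \<eta>) * indicator {x \<bullet> e - \<epsilon><..<x \<bullet> e} s \<partial>lborel)"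
          using AB(2)[OF True] by (intro nn_integral_mono) (auto simp: indicator_def intro!: ennreal_leI)
        also have "\<dots> = ennreal (\<epsilon> * (B x + \<eta>))" using interval[of "B x + \<eta>"] B0 \<eta> by simp
        finally show ?thesis using True by simp
      qed auto
    qed
    also have "\<dots> = ennreal (LINT x:K|lborel. \<epsilon> * (B x + \<eta>))"
      by (rule nnK) (use contB B0 \<eta> \<epsilon> in \<open>auto intro!: continuous_intros\<close>)
    also have "(LINT x:K|lborel. \<epsilon> * (B x + \<eta>)) = \<epsilon> * (LINT x:K|lborel. B x) + \<epsilon> * \<eta> * measure lborel K"
    proof -
      have "(LINT x:K|lborel. B x + \<eta>) = (LINT x:K|lborel. B x) + (LINT x:K|lborel. \<eta>)"
        using contB K by (intro set_integral_add set_integrable_continuous_bounded) auto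
      moreover have "(LINT x:K|lborel. \<eta>) = \<eta> * measure lborel K"
        by (simp add: set_lebesgue_integral_def)
      moreover have "(LINT x:K|lborel. \<epsilon> * (B x + \<eta>)) = \<epsilon> * (LINT x:K|lborel. B x + \<eta>)"
        by (rule set_integral_mult_right)
      ultimately show ?thesis by (simp add: distrib_left)
    qed
    finally show ?thesis
      using \<epsilon> \<eta> B0 by (subst (asm) ennreal_le_iff) (auto intro!: add_nonneg_nonneg mult_nonneg_nonneg simp: set_lebesgue_integral_def)
  qed
  have I3: "\<mu> * integral {\<alpha>..\<omega>} (\<lambda>s. kA s * f s) \<le> integral {\<alpha>..\<omega>} (\<lambda>s. kB s * f s)"
    using P[OF v contv'] by (simp add: kA_def kB_def c_def \<mu>_def)
  have "\<mu> * (\<epsilon> * (LINT x:K|lborel. A x)) \<le> \<mu> * (integral {\<alpha>..\<omega>} (\<lambda>s. kA s * f s) + \<epsilon> * \<eta> * measure lborel K)"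
    using I1 \<mu> by simp
  also have "\<dots> \<le> \<epsilon> * (LINT x:K|lborel. B x) + \<epsilon> * \<eta> * measure lborel K + \<mu> * (\<epsilon> * \<eta> * measure lborel K)"
    using I2 I3 by (simp add: distrib_left)
  finally have "\<epsilon> * (\<mu> * (LINT x:K|lborel. A x)) \<le> \<epsilon> * ((LINT x:K|lborel. B x) + (\<mu> + 1) * \<eta> * measure lborel K)"
    by (simp add: algebra_simps)
  then have "\<mu> * (LINT x:K|lborel. A x) \<le> (LINT x:K|lborel. B x) + (\<mu> + 1) * \<eta> * measure lborel K"
    using \<epsilon> by simp
  then show thesis using that[of c] by (simp add: \<mu>_def A_def B_def)
qed

text \<open>If the inequality failed, it would still fail by \<open>\<delta>\<close> per unit volume on thin convex subsets with the same
  constraint, by localization. There the constraint lets one subtract any constant, and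
  \<open>thin_convex_poincare\<close> contradicts the failure once its error is below \<open>\<delta>\<close>.\<close>

theorem C1_poincare_convex:
  fixes \<Omega> :: "'a::euclidean_space set" and u :: "'a \<Rightarrow> real" and g :: "'a \<Rightarrow> 'a"
  assumes p: "1 < p" and m: "0 < m" and Zm: "0 < Zm" and dL: "d < L"
    and L: "L / 2 \<le> integral {0..Zm} (\<lambda>z. 1 / (1 + m * z powr p))"
    and u: "\<And>x. (u has_derivative (\<lambda>v. g x \<bullet> v)) (at x)" and g: "continuous_on UNIV g"
    and \<Omega>: "open \<Omega>" "bounded \<Omega>" "convex \<Omega>" and d: "\<And>x y. x \<in> \<Omega> \<Longrightarrow> y \<in> \<Omega> \<Longrightarrow> dist x y \<le> d"
    and mean: "(LINT x:\<Omega>|lborel. \<bar>u x\<bar> powr (p - 2) * u x) = 0"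
  shows "(p - 1) * m * (LINT x:\<Omega>|lborel. \<bar>u x\<bar> powr p) \<le> (LINT x:\<Omega>|lborel. norm (g x) powr p)"
proof (rule ccontr)
  assume neg: "\<not> ?thesis"
  define \<mu> where "\<mu> = (p - 1) * m"
  have \<mu>: "0 < \<mu>" using p m by (simp add: \<mu>_def)
  have cont_u: "continuous_on UNIV u"
    by (intro continuous_at_imp_continuous_on ballI has_derivative_continuous[OF u])
  define h where "h x = \<bar>u x\<bar> powr (p - 2) * u x" for x
  define A where "A x = \<bar>u x\<bar> powr p" for x
  define B where "B x = norm (g x) powr p" for x
  have conth: "continuous_on UNIV h" unfolding h_def by (rule continuous_signed_powr[OF p cont_u])
  have contA: "continuous_on UNIV A" unfolding A_def
    using p by (intro continuous_on_powr' continuous_intros cont_u) auto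
  have contB: "continuous_on UNIV B" unfolding B_def
    using p by (intro continuous_on_powr' continuous_intros g) auto
  define I where "I = (LINT x:\<Omega>|lborel. \<mu> * A x - B x)"
  have si: "set_integrable lborel K F" if "continuous_on UNIV F" "open K" "bounded K" for F :: "'a \<Rightarrow> real" and K
    using that by (intro set_integrable_continuous_bounded) auto
  have lin: "(LINT x:K|lborel. \<mu> * A x - B x) = \<mu> * (LINT x:K|lborel. A x) - (LINT x:K|lborel. B x)"
    if "open K" "bounded K" for K
    using si[OF contA that] si[OF contB that] by (simp add: set_integral_diff)
  have I: "0 < I" using neg lin[OF \<Omega>(1,2)] by (simp add: I_def A_def B_def \<mu>_def)
  then have "\<Omega> \<noteq> {}" by (auto simp: I_def set_lebesgue_integral_def)
  define \<delta> where "\<delta> = I / measure lborel \<Omega>"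
  have \<delta>: "0 < \<delta>" "\<delta> * measure lborel \<Omega> = I" using I measure_lborel_open_pos[OF \<Omega>(1,2) \<open>\<Omega> \<noteq> {}\<close>] by (auto simp: \<delta>_def)
  define G where "G x = \<mu> * A x - B x - \<delta>" for x
  have contG: "continuous_on UNIV G" unfolding G_def by (intro continuous_intros contA contB)
  have GI: "(LINT x:K|lborel. G x) = \<mu> * (LINT x:K|lborel. A x) - (LINT x:K|lborel. B x) - \<delta> * measure lborel K"
    if K: "open K" "bounded K" for K
  proof -
    have c: "continuous_on UNIV (\<lambda>x. \<mu> * A x - B x)" "continuous_on UNIV (\<lambda>x::'a. \<delta>)" by (intro continuous_intros contA contB)+
    have "(LINT x:K|lborel. G x) = (LINT x:K|lborel. \<mu> * A x - B x) - (LINT x:K|lborel. \<delta>)"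
      unfolding G_def by (rule set_integral_diff(2)[OF si[OF c(1) K] si[OF c(2) K]])
    then show ?thesis using lin[OF K] by (simp add: set_lebesgue_integral_def mult.commute)
  qed
  have IG: "0 \<le> (LINT x:\<Omega>|lborel. G x)"
    using GI[OF \<Omega>(1,2)] lin[OF \<Omega>(1,2)] \<delta> by (simp add: I_def)
  obtain a b where ab: "a \<in> closure \<Omega>" "b \<in> closure \<Omega>"
    and loc: "\<And>\<epsilon>. 0 < \<epsilon> \<Longrightarrow> \<exists>K'\<subseteq>\<Omega>. open K' \<and> convex K' \<and> K' \<noteq> {} \<and> (LINT x:K'|lborel. h x) = 0 \<and> 0 \<le> (LINT x:K'|lborel. G x)
       \<and> (\<forall>x\<in>K'. \<exists>y\<in>closed_segment a b. dist x y < \<epsilon>)"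
    by (rule needle_localization[OF \<Omega> \<open>\<Omega> \<noteq> {}\<close> conth contG _ IG]) (use mean in \<open>auto simp: h_def\<close>)
  define l where "l = dist a b"
  have l: "0 \<le> l" "l \<le> d"
  proof -
    have "diameter \<Omega> \<le> d" using d \<open>\<Omega> \<noteq> {}\<close> by (intro diameter_le) (auto simp: dist_norm)
    moreover have "l \<le> diameter (closure \<Omega>)" unfolding l_def using ab \<Omega>(2) by (intro diameter_bounded_bound) auto
    ultimately show "0 \<le> l" "l \<le> d" using \<Omega>(2) by (auto simp: l_def diameter_closure)
  qed
  obtain e where e: "norm e = 1" "b = a + l *\<^sub>R e"
  proof (cases "a = b")
    case True
    obtain i :: 'a where "i \<in> Basis" using nonempty_Basis by blast
    then show thesis using that[of i] True by (simp add: l_def)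
  next
    case False
    then show thesis using that[of "(1/l) *\<^sub>R (b - a)"] by (simp add: l_def dist_norm norm_minus_commute)
  qed
  have seg: "\<exists>s\<in>{0..l}. y = a + s *\<^sub>R e" if "y \<in> closed_segment a b" for y
  proof -
    obtain t where t: "0 \<le> t" "t \<le> 1" "y = (1 - t) *\<^sub>R a + t *\<^sub>R b" using \<open>y \<in> closed_segment a b\<close> by (auto simp: in_segment)
    have "y = a + (t * l) *\<^sub>R e" unfolding t(3) e(2) by (simp add: algebra_simps)
    moreover have "t * l \<in> {0..l}" using t l by (auto intro: mult_left_le_one_le)
    ultimately show ?thesis by blast
  qed
  obtain R where R: "\<And>x. x \<in> \<Omega> \<Longrightarrow> norm x \<le> R" using \<Omega>(2) bounded_iff by metis
  define S where "S = cball (0::'a) (\<bar>R\<bar> + norm a + l + 2)"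
  \<comment> \<open>The error per unit volume for thin sets is \<open>(\<mu> + 1) \<eta>\<close>, half of \<open>\<delta>\<close>.\<close>
  define \<eta> where "\<eta> = \<delta> / 2 / (\<mu> + 1)"
  have \<eta>: "0 < \<eta>" using \<delta> \<mu> by (simp add: \<eta>_def)
  have ucA: "uniformly_continuous_on (S \<times> S) (\<lambda>z. \<bar>u (fst z) - u (snd z)\<bar> powr p)"
  proof (rule compact_uniformly_continuous)
    show "compact (S \<times> S)" by (simp add: S_def compact_Times)
    show "continuous_on (S \<times> S) (\<lambda>z. \<bar>u (fst z) - u (snd z)\<bar> powr p)"
      using p by (intro continuous_on_powr' continuous_on_rabs continuous_on_diff continuous_on_const
        continuous_on_compose2[OF cont_u] continuous_on_fst continuous_on_snd continuous_on_id) auto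
  qed
  have ucB: "uniformly_continuous_on S B"
    by (rule compact_uniformly_continuous) (auto simp: S_def intro: continuous_on_subset[OF contB])
  obtain r1 where r1: "0 < r1" "\<And>z z'. z \<in> S \<times> S \<Longrightarrow> z' \<in> S \<times> S \<Longrightarrow> dist z' z < r1 \<Longrightarrow> dist (\<bar>u (fst z') - u (snd z')\<bar> powr p) (\<bar>u (fst z) - u (snd z)\<bar> powr p) < \<eta>"
    using ucA \<eta> unfolding uniformly_continuous_on_def by metis
  obtain r2 where r2: "0 < r2" "\<And>z z'. z \<in> S \<Longrightarrow> z' \<in> S \<Longrightarrow> dist z' z < r2 \<Longrightarrow> dist (B z') (B z) < \<eta>"
    using ucB \<eta> unfolding uniformly_continuous_on_def by metis
  define \<epsilon> where "\<epsilon> = Min {r1 / 3, r2 / 3, 1/2, (L - d) / 3}"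
  have "\<epsilon> \<le> r1 / 3" "\<epsilon> \<le> r2 / 3" "\<epsilon> \<le> 1/2" "\<epsilon> \<le> (L - d) / 3" unfolding \<epsilon>_def by (rule Min_le; simp)+
  moreover have "0 < \<epsilon>" using r1(1) r2(1) dL by (simp add: \<epsilon>_def)
  ultimately have \<epsilon>: "0 < \<epsilon>" "3 * \<epsilon> \<le> r1" "3 * \<epsilon> \<le> r2" "\<epsilon> \<le> 1/2" "3 * \<epsilon> \<le> L - d"
    by (simp_all add: field_simps)
  obtain K where K: "K \<subseteq> \<Omega>" "open K" "convex K" "K \<noteq> {}" "(LINT x:K|lborel. h x) = 0" "0 \<le> (LINT x:K|lborel. G x)"
     "\<forall>x\<in>K. \<exists>y\<in>closed_segment a b. dist x y < \<epsilon>"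
    using loc[OF \<epsilon>(1)] by blast
  have bK: "bounded K" using K(1) \<Omega>(2) bounded_subset by blast
  have KS: "x \<in> S" if "x \<in> K" for x
  proof -
    have "norm x \<le> R" using R that K(1) by blast
    then have "norm x \<le> \<bar>R\<bar> + norm a + l + 2" using l(1) norm_ge_zero[of a] by linarith
    then show ?thesis by (simp add: S_def)
  qed
  obtain c where c: "\<mu> * (LINT x:K|lborel. \<bar>u x - c\<bar> powr p)
      \<le> (LINT x:K|lborel. norm (g x) powr p) + (\<mu> + 1) * \<eta> * measure lborel K"
  proof (rule thin_convex_poincare[OF p m Zm L u g K(2,3,4) bK e(1) \<epsilon>(1) l(1), where S = S and \<eta> = \<eta> and a = a])
    show "l + 3 * \<epsilon> \<le> L" using l \<epsilon> by linarith
    show "\<exists>s\<in>{0..l}. dist x (a + s *\<^sub>R e) < \<epsilon>" if "x \<in> K" for x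
      using K(7) that seg by blast
    show "\<bar>u x - u c\<bar> powr p \<le> \<bar>u y - u c\<bar> powr p + \<eta>" if "x \<in> K" "y \<in> S" "c \<in> S" "dist x y < 3 * \<epsilon>" for x y c
      using r1(2)[of "(y, c)" "(x, c)"] that KS[of x] \<epsilon>(2) by (auto simp: dist_Pair_Pair dist_real_def)
    show "norm (g y) powr p \<le> norm (g x) powr p + \<eta>" if "x \<in> K" "y \<in> S" "dist x y < 3 * \<epsilon>" for x y
      using r2(2)[of y x] that KS[of x] \<epsilon>(3) by (auto simp: B_def dist_real_def)
    show "a + s *\<^sub>R e \<in> S" if "s \<in> {- 2 * \<epsilon>..l + \<epsilon>}" for s
    proof -
      have "norm (a + s *\<^sub>R e) \<le> norm a + \<bar>s\<bar>" using norm_triangle_ineq[of a "s *\<^sub>R e"] e(1) by simp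
      also have "\<bar>s\<bar> \<le> l + 1" using that \<epsilon> l by auto
      finally show ?thesis by (simp add: S_def)
    qed
  qed (use \<eta> in \<open>auto simp: \<mu>_def\<close>)
  have "(LINT x:K|lborel. A x) \<le> (LINT x:K|lborel. \<bar>u x - c\<bar> powr p)"
  proof -
    have cc: "continuous_on UNIV (\<lambda>x. \<bar>u x - c\<bar> powr p)"
      using p by (intro continuous_on_powr' continuous_intros cont_u) auto
    have ch: "continuous_on UNIV (\<lambda>x. p * c * h x)" by (intro continuous_intros conth)
    have "(LINT x:K|lborel. A x) = (LINT x:K|lborel. A x) - (LINT x:K|lborel. p * c * h x)"
      using K(5) by simp
    also have "\<dots> = (LINT x:K|lborel. A x - p * c * h x)"
      by (rule set_integral_diff(2)[OF si[OF contA K(2) bK] si[OF ch K(2) bK], symmetric])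
    also have "\<dots> \<le> (LINT x:K|lborel. \<bar>u x - c\<bar> powr p)"
    proof (rule set_integral_mono)
      show "A x - p * c * h x \<le> \<bar>u x - c\<bar> powr p" for x
        unfolding A_def h_def by (rule abs_powr_tangent[OF p])
    qed (intro si cc contA ch continuous_intros K bK)+
    finally show ?thesis .
  qed
  then have "\<mu> * (LINT x:K|lborel. A x) \<le> \<mu> * (LINT x:K|lborel. \<bar>u x - c\<bar> powr p)" using \<mu> by simp
  also have "\<dots> \<le> (LINT x:K|lborel. B x) + \<delta> / 2 * measure lborel K"
  proof -
    have "\<mu> + 1 \<noteq> 0" using \<mu> by simp
    then have "(\<mu> + 1) * \<eta> = \<delta> / 2"
      unfolding \<eta>_def by (metis nonzero_mult_div_cancel_left times_divide_eq_right)
    from c[unfolded this] show ?thesis unfolding B_def .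
  qed
  finally have "\<delta> * measure lborel K \<le> \<delta> / 2 * measure lborel K"
    using K(6) GI[OF K(2) bK] by linarith
  then show False using \<delta>(1) measure_lborel_open_pos[OF K(2) bK K(4)] by simp
qed

section \<open>Smooth bump functions\<close>

lemma Ck_SucI:
  assumes "\<And>x. (f has_derivative f' x) (at x)" "\<And>b. b \<in> Basis \<Longrightarrow> Ck k (\<lambda>x. f' x b)"
  shows "Ck (Suc k) f"
proof -
  have "frechet_derivative f (at x) = f' x" for x
    using frechet_derivative_at[OF assms(1)] by simp
  then show ?thesis using assms by (auto simp: differentiable_def)
qed

lemma Ck_Suc_imp: "Ck (Suc k) f \<Longrightarrow> Ck k f"
proof (induction k arbitrary: f)
  case 0
  then show ?case
    by (auto intro!: continuous_at_imp_continuous_on differentiable_imp_continuous_within)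
qed auto

lemma Ck_const: "Ck k (\<lambda>x. c)"
proof (induction k arbitrary: c)
  case (Suc k)
  show ?case by (rule Ck_SucI[where f' = "\<lambda>_ _. 0"]) (use Suc in auto)
qed auto

lemma Ck_add: "Ck k f \<Longrightarrow> Ck k g \<Longrightarrow> Ck k (\<lambda>x. f x + g x)"
proof (induction k arbitrary: f g)
  case 0 then show ?case by (auto intro: continuous_intros)
next
  case (Suc k)
  show ?case
  proof (rule Ck_SucI)
    show "((\<lambda>x. f x + g x) has_derivative (\<lambda>v. frechet_derivative f (at x) v + frechet_derivative g (at x) v)) (at x)" for x
      using Suc.prems by (intro has_derivative_add) (auto simp flip: frechet_derivative_works)
  qed (use Suc in auto)
qed

lemma Ck_mult: "Ck k f \<Longrightarrow> Ck k g \<Longrightarrow> Ck k (\<lambda>x. f x * g x)"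
proof (induction k arbitrary: f g)
  case 0 then show ?case by (auto intro: continuous_intros)
next
  case (Suc k)
  have fg: "Ck k f" "Ck k g" using Suc.prems Ck_Suc_imp by blast+
  show ?case
  proof (rule Ck_SucI)
    show "((\<lambda>x. f x * g x) has_derivative (\<lambda>v. f x * frechet_derivative g (at x) v + frechet_derivative f (at x) v * g x)) (at x)" for x
      using Suc.prems by (intro has_derivative_mult) (auto simp flip: frechet_derivative_works)
  qed (use Suc fg in \<open>auto intro!: Ck_add Suc.IH\<close>)
qed

lemma Ck_inner: "Ck k (\<lambda>x. (x - y) \<bullet> b)"
proof (cases k)
  case 0 then show ?thesis by (auto intro!: continuous_intros)
next
  case (Suc k)
  show ?thesis unfolding Suc
    by (rule Ck_SucI[where f' = "\<lambda>_ v. v \<bullet> b"]) (auto intro!: derivative_eq_intros Ck_const)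
qed

text \<open>The functions \<open>exp(-1/t) / t\<^sup>j\<close> form a family whose span is closed under differentiation, so smoothness
  of the bump function follows by induction over all \<open>j\<close> at once.\<close>

definition flat_exp :: "nat \<Rightarrow> real \<Rightarrow> real" where
  "flat_exp j t = (if 0 < t then exp (- 1 / t) / t ^ j else 0)"

text \<open>One term of the exponential series; all \<open>flat_exp j\<close> vanish at \<open>0\<close> to infinite order.\<close>

lemma flat_exp_le:
  assumes "0 \<le> t"
  shows "flat_exp j t \<le> fact (j + n) * t ^ n"
proof (cases "t = 0")
  case False
  with assms have t: "0 < t" by simp
  have "(1 / t) ^ (j + n) / fact (j + n) \<le> exp (1 / t)"
  proof -
    have "(1 / t) ^ (j + n) / fact (j + n) \<le> (\<Sum>k<Suc (j + n). (1 / t) ^ k / fact k)"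
      using t by (intro member_le_sum) auto
    also have "\<dots> \<le> exp (1 / t)"
      using sum_le_suminf[OF summable_exp_generic[of "1/t"], of "{..<Suc (j+n)}"] t
      by (simp add: exp_def divide_inverse mult.commute)
    finally show ?thesis .
  qed
  then have "exp (- 1 / t) \<le> fact (j + n) * t ^ (j + n)"
    using t by (simp add: exp_minus power_divide divide_simps mult.commute)
  then show ?thesis using t by (simp add: flat_exp_def power_add divide_simps mult_ac)
qed (simp add: flat_exp_def)

lemma flat_exp_nonneg: "0 \<le> flat_exp j t" by (simp add: flat_exp_def)

lemma has_derivative_flat_exp:
  "(flat_exp j has_real_derivative - real j * flat_exp (j + 1) t + flat_exp (j + 2) t) (at t)"
proof -
  consider "0 < t" | "t < 0" | "t = 0" by linarith
  then show ?thesis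
  proof cases
    case 1
    have "((\<lambda>t. exp (- 1 / t) / t ^ j) has_real_derivative - real j * flat_exp (j + 1) t + flat_exp (j + 2) t) (at t)"
    proof (cases j)
      case 0
      then show ?thesis using 1 by (auto intro!: derivative_eq_intros simp: flat_exp_def power2_eq_square)
    next
      case (Suc i)
      have d1: "((\<lambda>t. exp (- 1 / t)) has_real_derivative exp (- 1 / t) * (inverse t)\<^sup>2) (at t)"
        using 1 by (auto intro!: derivative_eq_intros simp: power2_eq_square field_simps)
      have d2: "((\<lambda>t. (inverse t) ^ Suc i) has_real_derivative (1 + real i) * (- (inverse t ^ Suc (Suc 0)) * inverse t ^ i)) (at t)"
        using DERIV_power_Suc[OF DERIV_inverse[of t UNIV], of i] 1 by simp
      have "((\<lambda>t. exp (- 1 / t) * (inverse t) ^ Suc i) has_real_derivative - real j * flat_exp (j + 1) t + flat_exp (j + 2) t) (at t)"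
        by (rule DERIV_cong[OF DERIV_mult[OF d1 d2]])
           (use 1 in \<open>simp add: Suc flat_exp_def power2_eq_square field_simps\<close>)
      then show ?thesis by (simp only: Suc divide_inverse power_inverse)
    qed
    then show ?thesis
      by (rule DERIV_cong_ev[OF refl _ refl, THEN iffD1, rotated])
         (use 1 eventually_nhds_in_open[of "{0<..}" t] in \<open>auto elim!: eventually_mono simp: flat_exp_def\<close>)
  next
    case 2
    have "((\<lambda>t. 0) has_real_derivative - real j * flat_exp (j + 1) t + flat_exp (j + 2) t) (at t)"
      using 2 by (simp add: flat_exp_def)
    then show ?thesis
      by (rule DERIV_cong_ev[OF refl _ refl, THEN iffD1, rotated])
         (use 2 eventually_nhds_in_open[of "{..<0}" t] in \<open>auto elim!: eventually_mono simp: flat_exp_def\<close>)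
  next
    case 3
    have "((\<lambda>h. flat_exp j h / h) \<longlongrightarrow> 0) (at 0)"
    proof (rule Lim_null_comparison)
      show "\<forall>\<^sub>F h in at 0. norm (flat_exp j h / h) \<le> fact (j + 2) * \<bar>h\<bar>"
      proof (rule eventuallyI)
        fix h :: real
        show "norm (flat_exp j h / h) \<le> fact (j + 2) * \<bar>h\<bar>"
        proof (cases "0 < h")
          case True
          then show ?thesis using flat_exp_le[of h j 2] flat_exp_nonneg[of j h]
            by (simp add: power2_eq_square divide_simps mult_ac)
        next
          case False
          then have "flat_exp j h = 0" by (simp add: flat_exp_def)
          then show ?thesis by (simp del: fact_Suc)
        qed
      qed
      have "((\<lambda>h. fact (j + 2) * \<bar>h\<bar>) \<longlongrightarrow> fact (j + 2) * \<bar>0::real\<bar>) (at 0)" by (intro tendsto_intros)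
      then show "((\<lambda>h. fact (j + 2) * \<bar>h\<bar>) \<longlongrightarrow> 0) (at (0::real))" by simp
    qed
    then show ?thesis using 3 by (simp add: DERIV_def flat_exp_def)
  qed
qed

definition bump :: "nat \<Rightarrow> real \<Rightarrow> 'a::euclidean_space \<Rightarrow> real" where
  "bump j r x = flat_exp j (1 - (x \<bullet> x) / r\<^sup>2)"

text \<open>The gradient of \<open>bump j r\<close> at \<open>x\<close> is this multiple of \<open>x\<close>.\<close>

definition bump_slope :: "nat \<Rightarrow> real \<Rightarrow> 'a::euclidean_space \<Rightarrow> real" where
  "bump_slope j r x = (- real j * bump (j + 1) r x + bump (j + 2) r x) * (- 2 / r\<^sup>2)"

lemma has_derivative_bump:
  fixes x :: "'a::euclidean_space"
  shows "(bump j r has_derivative (\<lambda>v. (bump_slope j r x *\<^sub>R x) \<bullet> v)) (at x)"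
proof -
  have 1: "((\<lambda>x. 1 - (x \<bullet> x) / r\<^sup>2) has_derivative (\<lambda>v. - 2 / r\<^sup>2 * (x \<bullet> v))) (at x)"
  proof -
    have "((\<lambda>x. 1 - (1 / r\<^sup>2) * (x \<bullet> x)) has_derivative (\<lambda>v. 0 - (1 / r\<^sup>2) * (x \<bullet> v + v \<bullet> x))) (at x)"
      by (intro derivative_intros)
    moreover have "(\<lambda>v. 0 - (1 / r\<^sup>2) * (x \<bullet> v + v \<bullet> x)) = (\<lambda>v. - 2 / r\<^sup>2 * (x \<bullet> v))"
      by (simp add: fun_eq_iff inner_commute)
    ultimately show ?thesis by simp
  qed
  have 2: "(flat_exp j has_derivative (\<lambda>s. (- real j * bump (j + 1) r x + bump (j + 2) r x) * s)) (at (1 - (x \<bullet> x) / r\<^sup>2))"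
    using has_derivative_flat_exp[of j "1 - (x \<bullet> x) / r\<^sup>2"] unfolding has_field_derivative_def bump_def .
  have "(bump j r has_derivative (\<lambda>v. (- real j * bump (j + 1) r x + bump (j + 2) r x) * (- 2 / r\<^sup>2 * (x \<bullet> v)))) (at x)"
    using has_derivative_compose[OF 1 2] by (simp add: bump_def[abs_def])
  then show ?thesis unfolding bump_slope_def inner_scaleR_left by (simp only: mult.assoc)
qed

lemma Ck_bump: "Ck k (\<lambda>x. bump j r (x - y))"
proof (induction k arbitrary: j)
  case 0
  have "continuous_on UNIV (bump j r)"
    by (intro continuous_at_imp_continuous_on ballI has_derivative_continuous[OF has_derivative_bump])
  then have "continuous_on UNIV (\<lambda>x. bump j r (x - y))"
    by (rule continuous_on_compose2) (auto intro!: continuous_intros)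
  then show ?case by simp
next
  case (Suc k)
  show ?case
  proof (rule Ck_SucI)
    show "((\<lambda>x. bump j r (x - y)) has_derivative (\<lambda>v. (bump_slope j r (x - y) *\<^sub>R (x - y)) \<bullet> v)) (at x)" for x
    proof -
      have "((\<lambda>x. x - y) has_derivative (\<lambda>v. v)) (at x)" by (auto intro!: derivative_eq_intros)
      from has_derivative_compose[OF this has_derivative_bump] show ?thesis by simp
    qed
    show "Ck k (\<lambda>x. (bump_slope j r (x - y) *\<^sub>R (x - y)) \<bullet> b)" for b
      unfolding bump_slope_def inner_scaleR_left by (intro Ck_mult Ck_add Ck_const Suc.IH Ck_inner)
  qed
qed

lemma bump_eq_0: "0 < r \<Longrightarrow> r \<le> norm x \<Longrightarrow> bump j r x = 0"
proof -
  assume "0 < r" "r \<le> norm x"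
  then have "r\<^sup>2 \<le> x \<bullet> x" by (simp add: power2_norm_eq_inner[symmetric] power_mono)
  then show ?thesis using \<open>0 < r\<close> by (simp add: bump_def flat_exp_def divide_simps)
qed

lemma bump_pos: "0 < r \<Longrightarrow> norm x < r \<Longrightarrow> 0 < bump j r x"
proof -
  assume "0 < r" "norm x < r"
  then have "x \<bullet> x < r\<^sup>2" by (simp add: power2_norm_eq_inner[symmetric] power_strict_mono)
  then show ?thesis using \<open>0 < r\<close> by (simp add: bump_def flat_exp_def divide_simps)
qed

lemma bump_nonneg: "0 \<le> bump j r x" by (simp add: bump_def flat_exp_nonneg)

lemma bump_minus: "bump j r (- x) = bump j r x" by (simp add: bump_def)

lemma continuous_bump: "continuous_on S (bump j r)"
  by (intro continuous_at_imp_continuous_on ballI has_derivative_continuous[OF has_derivative_bump])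

lemma continuous_bump_slope: "continuous_on S (bump_slope j r)"
  unfolding bump_slope_def by (intro continuous_intros continuous_bump)

lemma bump_test_function:
  assumes r: "0 < r" and sub: "cball y r \<subseteq> \<Omega>"
  shows "(\<lambda>x. bump 0 r (x - y)) \<in> test_functions \<Omega>"
proof -
  have "{x. bump 0 r (x - y) \<noteq> 0} \<subseteq> cball y r"
    using bump_eq_0[OF r, of _ 0] by (force simp: dist_norm norm_minus_commute)
  then have "closure {x. bump 0 r (x - y) \<noteq> 0} \<subseteq> cball y r" by (simp add: closure_minimal)
  moreover from this have "compact (closure {x. bump 0 r (x - y) \<noteq> 0})"
    by (metis bounded_cball bounded_subset closed_closure compact_eq_bounded_closed)
  ultimately show ?thesis using sub by (auto simp: test_functions_def Ck_bump)
qed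

section \<open>Continuity of translations in the mean\<close>

lemma lborel_distr_translate: "distr lborel borel (\<lambda>x. x - w) = (lborel :: 'a::euclidean_space measure)"
proof -
  have "(\<lambda>x. x - w) = (+) (- w)" by auto
  then show ?thesis using lborel_distr_plus[of "- w"] by simp
qed

lemma lborel_distr_reflect: "distr lborel borel (\<lambda>x. w - x) = (lborel :: 'a::euclidean_space measure)"
proof -
  have "(lborel :: 'a measure) = density (distr lborel borel (\<lambda>x. w + (- 1) *\<^sub>R x)) (\<lambda>_. \<bar>- 1 :: real\<bar> ^ DIM('a))"
    by (rule lborel_affine) simp
  then show ?thesis by (simp add: density_1)
qed

lemma integral_translate:
  fixes f :: "'a::euclidean_space \<Rightarrow> 'b::{banach, second_countable_topology}"
  assumes "f \<in> borel_measurable borel"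
  shows "(LINT x|lborel. f (x - w)) = (LINT x|lborel. f x)" "integrable lborel (\<lambda>x. f (x - w)) \<longleftrightarrow> integrable lborel f"
    "(LINT x|lborel. f (w - x)) = (LINT x|lborel. f x)" "integrable lborel (\<lambda>x. f (w - x)) \<longleftrightarrow> integrable lborel f"
proof -
  show "(LINT x|lborel. f (x - w)) = (LINT x|lborel. f x)"
    using integral_distr[of "\<lambda>x. x - w" lborel borel f] assms by (simp add: lborel_distr_translate)
  show "integrable lborel (\<lambda>x. f (x - w)) \<longleftrightarrow> integrable lborel f"
    using integrable_distr_eq[of "\<lambda>x. x - w" lborel borel f] assms by (simp add: lborel_distr_translate)
  show "(LINT x|lborel. f (w - x)) = (LINT x|lborel. f x)"
    using integral_distr[of "\<lambda>x. w - x" lborel borel f] assms by (simp add: lborel_distr_reflect)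
  show "integrable lborel (\<lambda>x. f (w - x)) \<longleftrightarrow> integrable lborel f"
    using integrable_distr_eq[of "\<lambda>x. w - x" lborel borel f] assms by (simp add: lborel_distr_reflect)
qed

definition L1_modulus :: "('a::euclidean_space \<Rightarrow> real) \<Rightarrow> 'a \<Rightarrow> real" where
  "L1_modulus f w = (LINT x|lborel. \<bar>f (x - w) - f x\<bar>)"

lemma L1_modulus_integrable:
  fixes f :: "'a::euclidean_space \<Rightarrow> real"
  assumes "integrable lborel f"
  shows "integrable lborel (\<lambda>x. \<bar>f (x - w) - f x\<bar>)"
  using assms integral_translate(2)[of f w] borel_measurable_integrable[OF assms]
  by (intro integrable_abs Bochner_Integration.integrable_diff) auto

lemma L1_modulus_triangle:
  fixes f g :: "'a::euclidean_space \<Rightarrow> real"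
  assumes f: "integrable lborel f" and g: "integrable lborel g"
  shows "L1_modulus f w \<le> L1_modulus g w + 2 * (LINT x|lborel. \<bar>f x - g x\<bar>)"
proof -
  let ?d = "\<lambda>x. \<bar>f x - g x\<bar>"
  have d: "integrable lborel ?d" using f g by auto
  have m: "?d \<in> borel_measurable borel" using borel_measurable_integrable[OF d] by simp
  have "L1_modulus f w \<le> (LINT x|lborel. \<bar>g (x - w) - g x\<bar> + (?d (x - w) + ?d x))"
    unfolding L1_modulus_def
    using L1_modulus_integrable[OF f] L1_modulus_integrable[OF g] d integral_translate(2)[OF m]
    by (intro integral_mono) auto
  also have "\<dots> = L1_modulus g w + ((LINT x|lborel. ?d (x - w)) + (LINT x|lborel. ?d x))"
    unfolding L1_modulus_def
    using L1_modulus_integrable[OF g] d integral_translate(2)[OF m, of w] by simp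
  also have "(LINT x|lborel. ?d (x - w)) = (LINT x|lborel. ?d x)" by (rule integral_translate(1)[OF m])
  finally show ?thesis by simp
qed

text \<open>For an open set the part of \<open>U\<close> outside its translate tends to a null set by dominated convergence, and
  the part of the translate outside \<open>U\<close> has the same volume.\<close>

lemma L1_modulus_open:
  fixes U :: "'a::euclidean_space set" and X :: "nat \<Rightarrow> 'a"
  assumes U: "open U" "emeasure lborel U < \<infinity>" and X: "X \<longlonglongrightarrow> 0"
  shows "(\<lambda>n. L1_modulus (indicator U) (X n)) \<longlonglongrightarrow> 0"
proof -
  let ?i = "indicator U :: 'a \<Rightarrow> real"
  have [measurable]: "U \<in> sets borel" using U by auto
  have iU: "integrable lborel ?i" using U by (simp add: integrable_indicator_iff)
  have mi: "?i \<in> borel_measurable borel" by simp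
  have iUw: "integrable lborel (\<lambda>x. ?i (x - w))" for w using integral_translate(2)[OF mi] iU by blast
  have iP: "integrable lborel (\<lambda>x. ?i x * (1 - ?i (x - w)))" for w
    by (rule Bochner_Integration.integrable_bound[OF iU]) (auto simp: indicator_def)
  have eq: "L1_modulus ?i w = 2 * (LINT x|lborel. ?i x * (1 - ?i (x - w)))" for w
  proof -
    have "\<bar>?i (x - w) - ?i x\<bar> = 2 * (?i x * (1 - ?i (x - w))) + (?i (x - w) - ?i x)" for x
      by (auto simp: indicator_def)
    then have "L1_modulus ?i w = (LINT x|lborel. 2 * (?i x * (1 - ?i (x - w))) + (?i (x - w) - ?i x))"
      unfolding L1_modulus_def by presburger
    also have "\<dots> = (LINT x|lborel. 2 * (?i x * (1 - ?i (x - w)))) + ((LINT x|lborel. ?i (x - w)) - (LINT x|lborel. ?i x))"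
      using iP[of w] iU iUw[of w] by (subst Bochner_Integration.integral_add) auto
    also have "(LINT x|lborel. ?i (x - w)) = (LINT x|lborel. ?i x)" by (rule integral_translate(1)[OF mi])
    finally show ?thesis by simp
  qed
  have "(\<lambda>n. LINT x|lborel. ?i x * (1 - ?i (x - X n))) \<longlonglongrightarrow> (LINT x|(lborel::'a measure). (0::real))"
  proof (rule integral_dominated_convergence[where w = ?i])
    show "AE x in lborel. (\<lambda>n. ?i x * (1 - ?i (x - X n))) \<longlonglongrightarrow> 0"
    proof (rule AE_I2)
      fix x :: 'a
      show "(\<lambda>n. ?i x * (1 - ?i (x - X n))) \<longlonglongrightarrow> 0"
      proof (cases "x \<in> U")
        case True
        have "(\<lambda>n. x - X n) \<longlonglongrightarrow> x - 0" by (intro tendsto_intros X)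
        then have "\<forall>\<^sub>F n in sequentially. x - X n \<in> U" using topological_tendstoD[OF _ U(1)] True by auto
        then show ?thesis by (intro tendsto_eventually) (auto elim!: eventually_mono simp: indicator_def)
      qed simp
    qed
  next
    show "(\<lambda>x. ?i x * (1 - ?i (x - X n))) \<in> borel_measurable lborel" for n
      using iP by (rule borel_measurable_integrable)
  qed (use iU in \<open>auto simp: indicator_def\<close>)
  then have "(\<lambda>n. 2 * (LINT x|lborel. ?i x * (1 - ?i (x - X n)))) \<longlonglongrightarrow> 2 * 0" by (intro tendsto_intros) simp
  then show ?thesis unfolding eq by simp
qed

lemma L1_modulus_tendsto_approx:
  fixes f :: "'a::euclidean_space \<Rightarrow> real" and X :: "nat \<Rightarrow> 'a"
  assumes f: "integrable lborel f"
    and approx: "\<And>\<epsilon>. 0 < \<epsilon> \<Longrightarrow> \<exists>g. integrable lborel g \<and> (LINT x|lborel. \<bar>f x - g x\<bar>) < \<epsilon> \<and> (\<lambda>n. L1_modulus g (X n)) \<longlonglongrightarrow> 0"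
  shows "(\<lambda>n. L1_modulus f (X n)) \<longlonglongrightarrow> 0"
proof (rule order_tendstoI)
  have nn: "0 \<le> L1_modulus f w" for w by (simp add: L1_modulus_def)
  fix a :: real assume "a < 0"
  then show "\<forall>\<^sub>F n in sequentially. a < L1_modulus f (X n)" using nn by (auto intro!: always_eventually intro: less_le_trans)
next
  fix a :: real assume "0 < a"
  then obtain g where g: "integrable lborel g" "(LINT x|lborel. \<bar>f x - g x\<bar>) < a / 4" "(\<lambda>n. L1_modulus g (X n)) \<longlonglongrightarrow> 0"
    using approx[of "a / 4"] by auto
  have "\<forall>\<^sub>F n in sequentially. L1_modulus g (X n) < a / 2" using order_tendstoD(2)[OF g(3), of "a / 2"] \<open>0 < a\<close> by simp
  then show "\<forall>\<^sub>F n in sequentially. L1_modulus f (X n) < a"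
  proof (rule eventually_mono)
    fix n assume "L1_modulus g (X n) < a / 2"
    then show "L1_modulus f (X n) < a" using L1_modulus_triangle[OF f g(1), of "X n"] g(2) by linarith
  qed
qed

text \<open>Integrable functions are limits of simple functions, and measurable sets of finite measure are
  approximated by open ones; \<open>L1_modulus_triangle\<close> makes both steps uniform in the translation.\<close>

lemma L1_modulus_seq:
  fixes f :: "'a::euclidean_space \<Rightarrow> real" and X :: "nat \<Rightarrow> 'a"
  assumes "integrable lborel f" and X: "X \<longlonglongrightarrow> 0"
  shows "(\<lambda>n. L1_modulus f (X n)) \<longlonglongrightarrow> 0"
  using assms(1)
proof (induction rule: integrable_induct)
  case (base A c)
  have [measurable]: "A \<in> sets borel" using base by simp
  have iA: "integrable lborel (indicator A :: 'a \<Rightarrow> real)" using base by (simp add: integrable_indicator_iff)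
  have "(\<lambda>n. L1_modulus (indicator A) (X n)) \<longlonglongrightarrow> 0"
  proof (rule L1_modulus_tendsto_approx[OF iA])
    fix \<epsilon> :: real assume \<epsilon>: "0 < \<epsilon>"
    have "A \<in> lmeasurable" using base by (auto simp: fmeasurable_def)
    then obtain U where U: "open U" "A \<subseteq> U" "U - A \<in> lmeasurable" "emeasure lebesgue (U - A) < ennreal \<epsilon>"
      using sets_lebesgue_outer_open[of A \<epsilon>] \<epsilon> by (auto dest: fmeasurableD)
    have "emeasure lborel U = emeasure lborel A + emeasure lborel (U - A)"
      using U by (subst plus_emeasure) (auto simp: Un_absorb1 borel_open)
    moreover have dUA: "emeasure lborel (U - A) < ennreal \<epsilon>" using U(4) U(1) by (simp add: emeasure_completion)
    ultimately have fU: "emeasure lborel U < \<infinity>" using base by (auto simp: less_top[symmetric])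
    have "(LINT x|lborel. \<bar>indicator A x - indicator U x :: real\<bar>) = (LINT x|lborel. indicator (U - A) x)"
      using U(2) by (intro Bochner_Integration.integral_cong) (auto simp: indicator_def)
    also have "\<dots> = measure lborel (U - A)" by simp
    also have "\<dots> < \<epsilon>" using dUA \<epsilon> by (simp add: measure_def) (metis enn2real_less_iff ennreal_less_top less_trans order_less_imp_le)
    finally have "(LINT x|lborel. \<bar>indicator A x - indicator U x :: real\<bar>) < \<epsilon>" .
    moreover have "integrable lborel (indicator U :: 'a \<Rightarrow> real)" using fU U(1) by (simp add: integrable_indicator_iff)
    ultimately show "\<exists>g. integrable lborel g \<and> (LINT x|lborel. \<bar>indicator A x - g x\<bar>) < \<epsilon> \<and> (\<lambda>n. L1_modulus g (X n)) \<longlonglongrightarrow> 0"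
      using L1_modulus_open[OF U(1) fU X] by blast
  qed
  then have "(\<lambda>n. \<bar>c\<bar> * L1_modulus (indicator A) (X n)) \<longlonglongrightarrow> \<bar>c\<bar> * 0" by (intro tendsto_intros)
  moreover have "L1_modulus (\<lambda>x. indicator A x *\<^sub>R c) w = \<bar>c\<bar> * L1_modulus (indicator A) w" for w
    unfolding L1_modulus_def by (simp flip: integral_mult_right_zero add: abs_mult[symmetric] algebra_simps)
  ultimately show ?case by simp
next
  case (add f g)
  have "(\<lambda>n. L1_modulus f (X n) + L1_modulus g (X n)) \<longlonglongrightarrow> 0 + 0" by (intro tendsto_intros add)
  then have lim: "(\<lambda>n. L1_modulus f (X n) + L1_modulus g (X n)) \<longlonglongrightarrow> 0" by simp
  have ub: "L1_modulus (\<lambda>x. f x + g x) w \<le> L1_modulus f w + L1_modulus g w" for w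
  proof -
    have "L1_modulus (\<lambda>x. f x + g x) w \<le> (LINT x|lborel. \<bar>f (x - w) - f x\<bar> + \<bar>g (x - w) - g x\<bar>)"
      unfolding L1_modulus_def using L1_modulus_integrable[OF add(1)] L1_modulus_integrable[OF add(2)]
        L1_modulus_integrable[OF Bochner_Integration.integrable_add[OF add(1,2)]]
      by (intro integral_mono) auto
    also have "\<dots> = L1_modulus f w + L1_modulus g w"
      unfolding L1_modulus_def using L1_modulus_integrable[OF add(1)] L1_modulus_integrable[OF add(2)] by simp
    finally show ?thesis .
  qed
  show ?case
  proof (rule tendsto_sandwich[OF _ _ tendsto_const lim])
    show "\<forall>\<^sub>F n in sequentially. 0 \<le> L1_modulus (\<lambda>x. f x + g x) (X n)"
      by (simp add: L1_modulus_def)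
  qed (simp add: ub)
next
  case (lim f s)
  show ?case
  proof (rule L1_modulus_tendsto_approx[OF lim(4)])
    fix \<epsilon> :: real assume \<epsilon>: "0 < \<epsilon>"
    have "(\<lambda>i. LINT x|lborel. \<bar>f x - s i x\<bar>) \<longlonglongrightarrow> (LINT x|(lborel::'a measure). (0::real))"
    proof (rule integral_dominated_convergence[where w = "\<lambda>x. 3 * \<bar>f x\<bar>"])
      show "integrable lborel (\<lambda>x. 3 * \<bar>f x\<bar>)" using lim(4) by auto
      show "AE x in lborel. (\<lambda>i. \<bar>f x - s i x\<bar>) \<longlonglongrightarrow> 0"
      proof (rule AE_I2)
        fix x :: 'a
        have "(\<lambda>i. s i x) \<longlonglongrightarrow> f x" using lim(2) by simp
        then have "(\<lambda>i. \<bar>f x - s i x\<bar>) \<longlonglongrightarrow> \<bar>f x - f x\<bar>" by (intro tendsto_intros)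
        then show "(\<lambda>i. \<bar>f x - s i x\<bar>) \<longlonglongrightarrow> 0" by simp
      qed
      show "AE x in lborel. norm \<bar>f x - s i x\<bar> \<le> 3 * \<bar>f x\<bar>" for i
      proof (rule AE_I2)
        fix x :: 'a
        have "\<bar>s i x\<bar> \<le> 2 * \<bar>f x\<bar>" using lim(3)[of x i] by simp
        then show "norm \<bar>f x - s i x\<bar> \<le> 3 * \<bar>f x\<bar>" by simp
      qed
    qed (use lim(1,4) in auto)
    then have lim0: "(\<lambda>i. LINT x|lborel. \<bar>f x - s i x\<bar>) \<longlonglongrightarrow> 0" by simp
    have "\<exists>i. (LINT x|lborel. \<bar>f x - s i x\<bar>) < \<epsilon>"
      using order_tendstoD(2)[OF lim0 \<epsilon>] by (auto simp: eventually_sequentially)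
    then show "\<exists>g. integrable lborel g \<and> (LINT x|lborel. \<bar>f x - g x\<bar>) < \<epsilon> \<and> (\<lambda>n. L1_modulus g (X n)) \<longlonglongrightarrow> 0"
      using lim(1,5) by blast
  qed
qed

lemma L1_modulus_small:
  fixes f :: "'a::euclidean_space \<Rightarrow> real"
  assumes "integrable lborel f" "0 < \<epsilon>"
  shows "\<exists>r>0. \<forall>w. norm w < r \<longrightarrow> L1_modulus f w < \<epsilon>"
proof -
  have "(L1_modulus f \<longlongrightarrow> 0) (at 0)"
    unfolding LIMSEQ_SEQ_conv[symmetric] using L1_modulus_seq[OF assms(1)] by auto
  from order_tendstoD(2)[OF this assms(2)] obtain r where r: "r > 0" "\<forall>w. w \<noteq> 0 \<and> dist w 0 < r \<longrightarrow> L1_modulus f w < \<epsilon>"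
    by (auto simp: eventually_at)
  have "L1_modulus f 0 = 0" by (simp add: L1_modulus_def)
  then show ?thesis using r assms(2) by (metis dist_0_norm dist_commute)
qed

section \<open>Mollification\<close>

lemma integrable_scaleR_bounded:
  fixes f :: "'a::euclidean_space \<Rightarrow> real" and k :: "'a \<Rightarrow> 'b::euclidean_space"
  assumes f: "integrable lborel f" and k: "k \<in> borel_measurable borel" "\<And>x. norm (k x) \<le> C"
  shows "integrable lborel (\<lambda>x. f x *\<^sub>R k x)"
proof (rule Bochner_Integration.integrable_bound)
  show "integrable lborel (\<lambda>x. C * \<bar>f x\<bar>)" using f by auto
  have "norm (f x *\<^sub>R k x) \<le> norm (C * \<bar>f x\<bar>)" for x
    using mult_left_mono[OF k(2)[of x], of "\<bar>f x\<bar>"] abs_ge_self[of "C * \<bar>f x\<bar>"] by (simp add: mult.commute)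
  then show "AE x in lborel. norm (f x *\<^sub>R k x) \<le> norm (C * \<bar>f x\<bar>)" by simp
qed (use borel_measurable_integrable[OF f] k in auto)

lemma compact_support_uniformly_continuous:
  fixes G :: "'a::euclidean_space \<Rightarrow> 'b::real_normed_vector"
  assumes G: "continuous_on UNIV G" and supp: "\<And>w. R \<le> norm w \<Longrightarrow> G w = 0" and e: "0 < e"
  shows "\<exists>d>0. \<forall>z w. dist z w < d \<longrightarrow> norm (G z - G w) < e"
proof -
  have "uniformly_continuous_on (cball 0 (\<bar>R\<bar> + 1)) G"
    by (rule compact_uniformly_continuous) (auto intro: continuous_on_subset[OF G])
  then obtain d where d: "d > 0" "\<And>z w. z \<in> cball 0 (\<bar>R\<bar> + 1) \<Longrightarrow> w \<in> cball 0 (\<bar>R\<bar> + 1) \<Longrightarrow> dist w z < d \<Longrightarrow> dist (G w) (G z) < e"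
    unfolding uniformly_continuous_on_def using e by metis
  have "norm (G z - G w) < e" if dz: "dist z w < min d 1" for z w
  proof (cases "norm z \<le> \<bar>R\<bar> + 1 \<and> norm w \<le> \<bar>R\<bar> + 1")
    case True
    then show ?thesis using d(2)[of w z] dz by (simp add: dist_norm)
  next
    case False
    have "norm z \<le> norm w + norm (z - w)" "norm w \<le> norm z + norm (z - w)"
      using norm_triangle_ineq[of w "z - w"] norm_triangle_ineq[of z "w - z"] by (simp_all add: norm_minus_commute)
    then have "R \<le> norm z" "R \<le> norm w" using False dz by (auto simp: dist_norm)
    then show ?thesis using supp e by simp
  qed
  then show ?thesis using d(1) by (intro exI[of _ "min d 1"]) auto
qed

lemma compact_support_bounded:
  fixes G :: "'a::euclidean_space \<Rightarrow> 'b::real_normed_vector"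
  assumes G: "continuous_on UNIV G" and supp: "\<And>w. R \<le> norm w \<Longrightarrow> G w = 0"
  shows "\<exists>C. \<forall>w. norm (G w) \<le> C"
proof -
  have "compact (G ` cball 0 R)" by (rule compact_continuous_image) (auto intro: continuous_on_subset[OF G])
  then have "bounded (G ` cball 0 R)" by (rule compact_imp_bounded)
  then obtain C where C: "\<forall>y\<in>G ` cball 0 R. norm y \<le> C" unfolding bounded_iff by blast
  have "norm (G w) \<le> \<bar>C\<bar>" for w
  proof (cases "R \<le> norm w")
    case False
    then have "norm (G w) \<le> C" using C by simp
    then show ?thesis by simp
  qed (simp add: supp)
  then show ?thesis by blast
qed

text \<open>First-order Taylor expansion of \<open>\<rho>\<close> under the integral; its remainder is uniformly \<open>o(|h|)\<close> because the
  gradient \<open>G\<close> has compact support.\<close>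

lemma convolution_C1:
  fixes f \<rho> :: "'a::euclidean_space \<Rightarrow> real" and G :: "'a \<Rightarrow> 'a"
  assumes f: "integrable lborel f" and \<rho>: "\<And>w. (\<rho> has_derivative (\<lambda>v. G w \<bullet> v)) (at w)"
    and \<rho>0: "\<And>w. R \<le> norm w \<Longrightarrow> \<rho> w = 0"
    and G: "continuous_on UNIV G" and G0: "\<And>w. R \<le> norm w \<Longrightarrow> G w = 0"
  defines "g \<equiv> \<lambda>x. LINT y|lborel. f y *\<^sub>R G (x - y)"
  shows "((\<lambda>x. LINT y|lborel. f y * \<rho> (x - y)) has_derivative (\<lambda>v. g x \<bullet> v)) (at x)"
    and "continuous_on UNIV g"
proof -
  have fm [measurable]: "f \<in> borel_measurable borel" using borel_measurable_integrable[OF f] by simp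
  have cont\<rho>: "continuous_on UNIV \<rho>"
    by (intro continuous_at_imp_continuous_on ballI has_derivative_continuous[OF \<rho>])
  have [measurable]: "\<rho> \<in> borel_measurable borel" "G \<in> borel_measurable borel"
    using cont\<rho> G by (auto intro: borel_measurable_continuous_onI)
  obtain C1 where C1: "\<And>w. norm (\<rho> w) \<le> C1" using compact_support_bounded[OF cont\<rho> \<rho>0] by blast
  obtain C2 where C2: "\<And>w. norm (G w) \<le> C2" using compact_support_bounded[OF G G0] by blast
  have i\<rho>: "integrable lborel (\<lambda>y. f y * \<rho> (x - y))" for x
    using integrable_scaleR_bounded[OF f, of "\<lambda>y. \<rho> (x - y)" C1] C1 by simp
  have iG: "integrable lborel (\<lambda>y. f y *\<^sub>R G (x - y))" for x
    by (rule integrable_scaleR_bounded[OF f _ C2]) measurable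
  have iGv: "integrable lborel (\<lambda>y. f y * (G (x - y) \<bullet> v))" for x v
    using integrable_inner_left[of v lborel "\<lambda>y. f y *\<^sub>R G (x - y)"] iG by simp
  have gv: "g x \<bullet> v = (LINT y|lborel. f y * (G (x - y) \<bullet> v))" for x v
    unfolding g_def using integral_inner_left[of v lborel "\<lambda>y. f y *\<^sub>R G (x - y)"] iG by simp
  define I where "I = (LINT y|lborel. \<bar>f y\<bar>) + 1"
  have I: "0 < I" "(LINT y|lborel. \<bar>f y\<bar>) \<le> I" by (auto simp: I_def intro: add_nonneg_pos)
  have scale: "(LINT y|lborel. \<bar>f y\<bar> * (e / I * t)) \<le> e * t" if "0 \<le> e" "0 \<le> t" for e t
  proof -
    have "(LINT y|lborel. \<bar>f y\<bar> * (e / I * t)) = (LINT y|lborel. \<bar>f y\<bar>) * (e / I * t)" by simp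
    also have "\<dots> \<le> I * (e / I * t)" using I that by (intro mult_right_mono) auto
    also have "\<dots> = e * t" using I(1) by simp
    finally show ?thesis .
  qed
  show "((\<lambda>x. LINT y|lborel. f y * \<rho> (x - y)) has_derivative (\<lambda>v. g x \<bullet> v)) (at x)"
    unfolding has_derivative_at_alt
  proof (intro conjI allI impI)
    show "bounded_linear (\<lambda>v. g x \<bullet> v)" by (rule bounded_linear_inner_right)
    fix e :: real assume e: "0 < e"
    then have e': "0 < e / I" using I by simp
    obtain d where d: "d > 0" "\<And>z w. dist z w < d \<Longrightarrow> norm (G z - G w) < e / I"
      using compact_support_uniformly_continuous[OF G G0 e'] by blast
    have taylor: "\<bar>\<rho> (w + h) - \<rho> w - G w \<bullet> h\<bar> \<le> e / I * norm h" if h: "norm h < d" for w h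
    proof -
      have "norm ((\<rho> (w + h) - G w \<bullet> (w + h)) - (\<rho> w - G w \<bullet> w)) \<le> e / I * norm ((w + h) - w)"
      proof (rule differentiable_bound[where S = "ball w d" and f' = "\<lambda>z v. G z \<bullet> v - G w \<bullet> v"])
        fix z assume z: "z \<in> ball w d"
        show "((\<lambda>z. \<rho> z - G w \<bullet> z) has_derivative (\<lambda>v. G z \<bullet> v - G w \<bullet> v)) (at z within ball w d)"
          by (intro has_derivative_diff has_derivative_at_withinI[OF \<rho>] has_derivative_inner_right has_derivative_ident)
        show "onorm (\<lambda>v. G z \<bullet> v - G w \<bullet> v) \<le> e / I"
        proof (rule onorm_le)
          fix v
          have "norm (G z \<bullet> v - G w \<bullet> v) \<le> norm (G z - G w) * norm v"
            using Cauchy_Schwarz_ineq2[of "G z - G w" v] by (simp add: inner_diff_left)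
          also have "\<dots> \<le> e / I * norm v"
            using d(2)[of z w] z by (intro mult_right_mono) (auto simp: dist_commute)
          finally show "norm (G z \<bullet> v - G w \<bullet> v) \<le> e / I * norm v" .
        qed
      qed (use h d in \<open>auto simp: dist_norm\<close>)
      then show ?thesis by (simp add: inner_add_right algebra_simps)
    qed
    show "\<exists>d>0. \<forall>y. norm (y - x) < d \<longrightarrow> norm ((LINT t|lborel. f t * \<rho> (y - t)) - (LINT t|lborel. f t * \<rho> (x - t)) - g x \<bullet> (y - x)) \<le> e * norm (y - x)"
    proof (intro exI[of _ d] conjI allI impI d(1))
      fix y assume y: "norm (y - x) < d"
      have "(LINT t|lborel. f t * \<rho> (y - t)) - (LINT t|lborel. f t * \<rho> (x - t)) - g x \<bullet> (y - x)
          = (LINT t|lborel. f t * \<rho> (y - t) - f t * \<rho> (x - t) - f t * (G (x - t) \<bullet> (y - x)))"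
        using i\<rho> iGv by (simp add: gv)
      also have "norm \<dots> \<le> (LINT t|lborel. \<bar>f t\<bar> * (e / I * norm (y - x)))"
      proof (rule Bochner_Integration.integral_norm_bound_integral)
        show "integrable lborel (\<lambda>t. f t * \<rho> (y - t) - f t * \<rho> (x - t) - f t * (G (x - t) \<bullet> (y - x)))"
          using i\<rho> iGv by auto
        show "integrable lborel (\<lambda>t. \<bar>f t\<bar> * (e / I * norm (y - x)))" using f by auto
        fix t :: 'a
        have "f t * \<rho> (y - t) - f t * \<rho> (x - t) - f t * (G (x - t) \<bullet> (y - x))
           = f t * (\<rho> ((x - t) + (y - x)) - \<rho> (x - t) - G (x - t) \<bullet> (y - x))"
          by (simp add: algebra_simps)
        then show "norm (f t * \<rho> (y - t) - f t * \<rho> (x - t) - f t * (G (x - t) \<bullet> (y - x))) \<le> \<bar>f t\<bar> * (e / I * norm (y - x))"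
          using mult_left_mono[OF taylor[OF y, of "x - t"], of "\<bar>f t\<bar>"] by (simp add: abs_mult)
      qed
      also have "\<dots> \<le> e * norm (y - x)" by (rule scale) (use e in auto)
      finally show "norm ((LINT t|lborel. f t * \<rho> (y - t)) - (LINT t|lborel. f t * \<rho> (x - t)) - g x \<bullet> (y - x)) \<le> e * norm (y - x)" .
    qed
  qed
  show "continuous_on UNIV g"
    unfolding continuous_on_iff
  proof (intro ballI allI impI)
    fix x and e :: real assume e: "0 < e"
    then have e': "0 < e / 2 / I" using I by simp
    obtain d where d: "d > 0" "\<And>z w. dist z w < d \<Longrightarrow> norm (G z - G w) < e / 2 / I"
      using compact_support_uniformly_continuous[OF G G0 e'] by blast
    show "\<exists>d>0. \<forall>y\<in>UNIV. dist y x < d \<longrightarrow> dist (g y) (g x) < e"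
    proof (intro exI[of _ d] conjI ballI impI d(1))
      fix y assume y: "dist y x < d"
      have "g y - g x = (LINT t|lborel. f t *\<^sub>R G (y - t) - f t *\<^sub>R G (x - t))"
        unfolding g_def using iG by simp
      also have "norm \<dots> \<le> (LINT t|lborel. \<bar>f t\<bar> * (e / 2 / I * 1))"
      proof (rule Bochner_Integration.integral_norm_bound_integral)
        show "integrable lborel (\<lambda>t. f t *\<^sub>R G (y - t) - f t *\<^sub>R G (x - t))" using iG by auto
        show "integrable lborel (\<lambda>t. \<bar>f t\<bar> * (e / 2 / I * 1))" using f by auto
        fix t :: 'a
        have "norm (G (y - t) - G (x - t)) \<le> e / 2 / I" using d(2)[of "y - t" "x - t"] y by (simp add: dist_norm)
        from mult_left_mono[OF this, of "\<bar>f t\<bar>"]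
        show "norm (f t *\<^sub>R G (y - t) - f t *\<^sub>R G (x - t)) \<le> \<bar>f t\<bar> * (e / 2 / I * 1)"
          by (simp flip: scaleR_right_diff_distrib)
      qed
      also have "\<dots> \<le> e / 2 * 1" by (rule scale) (use e in auto)
      finally show "dist (g y) (g x) < e" using e by (simp add: dist_norm)
    qed
  qed
qed

text \<open>The type argument fixes the space of integration, which \<open>r\<close> alone does not determine.\<close>

definition bump_mass :: "real \<Rightarrow> 'a::euclidean_space itself \<Rightarrow> real" where
  "bump_mass r _ = (LINT w|lborel. bump 0 r (w::'a))"

lemma integrable_bump:
  assumes "0 < r"
  shows "integrable lborel (bump 0 r :: 'a::euclidean_space \<Rightarrow> real)"
proof -
  have "integrable lborel (\<lambda>x::'a. indicator (cball 0 r) x *\<^sub>R bump 0 r x)"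
    by (rule borel_integrable_compact) (auto intro: continuous_bump)
  moreover have "(\<lambda>x::'a. indicator (cball 0 r) x *\<^sub>R bump 0 r x) = bump 0 r"
    by (auto simp: fun_eq_iff indicator_def intro!: bump_eq_0[OF assms])
  ultimately show ?thesis by simp
qed

lemma bump_mass_pos:
  assumes "0 < r"
  shows "0 < bump_mass r TYPE('a::euclidean_space)"
proof -
  have nn: "0 \<le> bump_mass r TYPE('a)" by (simp add: bump_mass_def bump_nonneg)
  moreover have "bump_mass r TYPE('a) \<noteq> 0"
  proof
    assume "bump_mass r TYPE('a) = 0"
    then have "AE x::'a in lborel. bump 0 r x = 0"
      using integral_nonneg_eq_0_iff_AE[OF integrable_bump[OF assms, where 'a = 'a]] by (simp add: bump_mass_def bump_nonneg)
    then have "AE x::'a in lborel. x \<notin> ball 0 r"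
    proof eventually_elim
      case (elim x)
      then show ?case using bump_pos[OF assms, of x 0] by auto
    qed
    then have "ball (0::'a) r \<in> null_sets lborel"
      by (subst (asm) AE_iff_null_sets[symmetric]) auto
    then have "negligible (ball (0::'a) r)"
      by (simp add: negligible_iff_null_sets null_sets_completionI)
    then show False using open_not_negligible[of "ball (0::'a) r"] assms by simp
  qed
  ultimately show ?thesis by simp
qed

definition mollify :: "real \<Rightarrow> ('a::euclidean_space \<Rightarrow> real) \<Rightarrow> 'a \<Rightarrow> real" where
  "mollify r u x = (LINT y|lborel. u y * bump 0 r (x - y)) / bump_mass r TYPE('a)"

definition mollify_gradient :: "real \<Rightarrow> ('a::euclidean_space \<Rightarrow> real) \<Rightarrow> 'a \<Rightarrow> 'a" where
  "mollify_gradient r u x = (1 / bump_mass r TYPE('a)) *\<^sub>R (LINT y|lborel. u y *\<^sub>R (bump_slope 0 r (x - y) *\<^sub>R (x - y)))"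

lemma mollify_C1:
  fixes u :: "'a::euclidean_space \<Rightarrow> real"
  assumes r: "0 < r" and u: "integrable lborel u"
  shows "(mollify r u has_derivative (\<lambda>v. mollify_gradient r u x \<bullet> v)) (at x)"
    and "continuous_on UNIV (mollify_gradient r u)"
proof -
  have z: "bump_slope 0 r w *\<^sub>R w = 0" if "r \<le> norm w" for w :: 'a
    using bump_eq_0[OF r that] by (simp add: bump_slope_def)
  have c: "continuous_on UNIV (\<lambda>w::'a. bump_slope 0 r w *\<^sub>R w)"
    by (intro continuous_intros continuous_bump_slope)
  note C = convolution_C1[OF u has_derivative_bump bump_eq_0[OF r] c z]
  have "((\<lambda>x. (1 / bump_mass r TYPE('a)) *\<^sub>R (LINT y|lborel. u y * bump 0 r (x - y))) has_derivative
      (\<lambda>v. (1 / bump_mass r TYPE('a)) *\<^sub>R ((LINT y|lborel. u y *\<^sub>R (bump_slope 0 r (x - y) *\<^sub>R (x - y))) \<bullet> v))) (at x)"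
    by (rule has_derivative_scaleR_right[OF C(1)])
  then show "(mollify r u has_derivative (\<lambda>v. mollify_gradient r u x \<bullet> v)) (at x)"
    by (simp add: mollify_def[abs_def] mollify_gradient_def)
  show "continuous_on UNIV (mollify_gradient r u)"
    unfolding mollify_gradient_def by (intro continuous_intros C(2))
qed

text \<open>The translated bump is a test function of \<open>\<Omega>\<close> as long as its ball lies in \<open>\<Omega>\<close>, so the derivative can be
  moved to the weak gradient.\<close>

lemma mollify_gradient_eq:
  fixes u :: "'a::euclidean_space \<Rightarrow> real" and D :: "'a \<Rightarrow> 'a"
  assumes r: "0 < r" and u: "integrable lborel u" and D: "integrable lborel D" and sub: "cball x r \<subseteq> \<Omega>"
    and weak: "\<And>\<phi> b. \<phi> \<in> test_functions \<Omega> \<Longrightarrow> b \<in> Basis \<Longrightarrow>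
       (LINT y|lborel. u y * frechet_derivative \<phi> (at y) b) = - (LINT y|lborel. (D y \<bullet> b) * \<phi> y)"
  shows "mollify_gradient r u x = (1 / bump_mass r TYPE('a)) *\<^sub>R (LINT y|lborel. bump 0 r (x - y) *\<^sub>R D y)"
    and "integrable lborel (\<lambda>y. bump 0 r (x - y) *\<^sub>R D y)"
proof -
  have [measurable]: "(bump 0 r :: 'a \<Rightarrow> real) \<in> borel_measurable borel" "(bump_slope 0 r :: 'a \<Rightarrow> real) \<in> borel_measurable borel"
    by (intro borel_measurable_continuous_onI continuous_bump continuous_bump_slope)+
  have [measurable]: "D \<in> borel_measurable borel" using borel_measurable_integrable[OF D] by simp
  obtain C where C: "\<And>w::'a. norm (bump 0 r w :: real) \<le> C"
    using compact_support_bounded[OF continuous_bump bump_eq_0[OF r]] by blast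
  show iD: "integrable lborel (\<lambda>y. bump 0 r (x - y) *\<^sub>R D y)"
  proof (rule Bochner_Integration.integrable_bound)
    show "integrable lborel (\<lambda>y. C * norm (D y))" using D by auto
    have "norm (bump 0 r (x - y) *\<^sub>R D y) \<le> norm (C * norm (D y))" for y
      using mult_right_mono[OF C[of "x - y"], of "norm (D y)"] abs_ge_self[of "C * norm (D y)"] by simp
    then show "AE y in lborel. norm (bump 0 r (x - y) *\<^sub>R D y) \<le> norm (C * norm (D y))" by simp
  qed measurable
  have z: "bump_slope 0 r w *\<^sub>R w = 0" if "r \<le> norm w" for w :: 'a
    using bump_eq_0[OF r that] by (simp add: bump_slope_def)
  have c: "continuous_on UNIV (\<lambda>w::'a. bump_slope 0 r w *\<^sub>R w)"
    by (intro continuous_intros continuous_bump_slope)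
  obtain C2 where C2: "\<And>w::'a. norm (bump_slope 0 r w *\<^sub>R w) \<le> C2"
    using compact_support_bounded[OF c z] by blast
  have iu: "integrable lborel (\<lambda>y. u y *\<^sub>R (bump_slope 0 r (x - y) *\<^sub>R (x - y)))"
    by (rule integrable_scaleR_bounded[OF u _ C2]) measurable
  define \<phi> where "\<phi> y = bump 0 r (y - x)" for y
  have \<phi>: "\<phi> \<in> test_functions \<Omega>" unfolding \<phi>_def by (rule bump_test_function[OF r sub])
  have d\<phi>: "frechet_derivative \<phi> (at y) b = - ((bump_slope 0 r (x - y) *\<^sub>R (x - y)) \<bullet> b)" for y b
  proof -
    have "((\<lambda>y. y - x) has_derivative (\<lambda>v. v)) (at y)" by (auto intro!: derivative_eq_intros)
    from has_derivative_compose[OF this has_derivative_bump]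
    have "(\<phi> has_derivative (\<lambda>v. (bump_slope 0 r (y - x) *\<^sub>R (y - x)) \<bullet> v)) (at y)" by (simp add: \<phi>_def[abs_def])
    then have "frechet_derivative \<phi> (at y) = (\<lambda>v. (bump_slope 0 r (y - x) *\<^sub>R (y - x)) \<bullet> v)"
      using frechet_derivative_at by metis
    moreover have "bump_slope 0 r (y - x) = bump_slope 0 r (x - y)"
      using bump_minus[of _ r "x - y"] by (simp add: bump_slope_def)
    ultimately show ?thesis by (simp add: inner_diff_left algebra_simps)
  qed
  have "(LINT y|lborel. u y *\<^sub>R (bump_slope 0 r (x - y) *\<^sub>R (x - y))) = (LINT y|lborel. bump 0 r (x - y) *\<^sub>R D y)"
  proof (rule euclidean_eqI)
    fix b :: 'a assume b: "b \<in> Basis"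
    have "(LINT y|lborel. u y *\<^sub>R (bump_slope 0 r (x - y) *\<^sub>R (x - y))) \<bullet> b = (LINT y|lborel. (u y *\<^sub>R (bump_slope 0 r (x - y) *\<^sub>R (x - y))) \<bullet> b)"
      using iu by (intro integral_inner_left[symmetric]) auto
    also have "\<dots> = - (LINT y|lborel. u y * frechet_derivative \<phi> (at y) b)"
      unfolding d\<phi> by (simp add: mult.assoc)
    also have "\<dots> = (LINT y|lborel. (D y \<bullet> b) * \<phi> y)" using weak[OF \<phi> b] by simp
    also have "\<dots> = (LINT y|lborel. (bump 0 r (x - y) *\<^sub>R D y) \<bullet> b)"
      using bump_minus[of 0 r "x - _"] by (intro Bochner_Integration.integral_cong) (auto simp: \<phi>_def mult.commute bump_minus[of 0 r "x - _", simplified])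
    also have "\<dots> = (LINT y|lborel. bump 0 r (x - y) *\<^sub>R D y) \<bullet> b"
      using iD by (intro integral_inner_left) auto
    finally show "(LINT y|lborel. u y *\<^sub>R (bump_slope 0 r (x - y) *\<^sub>R (x - y))) \<bullet> b = (LINT y|lborel. bump 0 r (x - y) *\<^sub>R D y) \<bullet> b" .
  qed
  then show "mollify_gradient r u x = (1 / bump_mass r TYPE('a)) *\<^sub>R (LINT y|lborel. bump 0 r (x - y) *\<^sub>R D y)"
    by (simp add: mollify_gradient_def)
qed

text \<open>Integrate the tangent inequality \<open>Young_powr\<close> at the mean value.\<close>

lemma Jensen_powr_weighted:
  fixes a w :: "'a::euclidean_space \<Rightarrow> real"
  assumes p: "1 < p" and a: "\<And>y. 0 \<le> a y" and w: "\<And>y. 0 \<le> w y" and iw: "integrable lborel w" "(LINT y|lborel. w y) = 1"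
    and iaw: "integrable lborel (\<lambda>y. w y * a y)" and iap: "integrable lborel (\<lambda>y. w y * a y powr p)"
  shows "(LINT y|lborel. w y * a y) powr p \<le> (LINT y|lborel. w y * a y powr p)"
proof -
  define c where "c = (LINT y|lborel. w y * a y)"
  have c: "0 \<le> c" unfolding c_def using a w by (intro integral_nonneg_AE) auto
  show ?thesis
  proof (cases "c = 0")
    case True
    have "0 \<le> (LINT y|lborel. w y * a y powr p)" using w by (intro integral_nonneg_AE) auto
    then show ?thesis using True p by (simp add: c_def)
  next
    case False
    then have cp: "c powr (p - 1) * c = c powr p" using c powr_add[of c "p - 1" 1] by simp
    have "p * c powr (p - 1) * c = (LINT y|lborel. p * c powr (p - 1) * (w y * a y))" by (simp add: c_def)
    also have "\<dots> \<le> (LINT y|lborel. w y * a y powr p + (p - 1) * c powr p * w y)"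
    proof (rule integral_mono)
      show "integrable lborel (\<lambda>y. p * c powr (p - 1) * (w y * a y))" using iaw by auto
      show "integrable lborel (\<lambda>y. w y * a y powr p + (p - 1) * c powr p * w y)" using iap iw by auto
      fix y
      have "w y * (p * c powr (p - 1) * a y) \<le> w y * (a y powr p + (p - 1) * c powr p)"
        by (intro mult_left_mono Young_powr p a c w)
      then show "p * c powr (p - 1) * (w y * a y) \<le> w y * a y powr p + (p - 1) * c powr p * w y"
        by (simp add: algebra_simps)
    qed
    also have "\<dots> = (LINT y|lborel. w y * a y powr p) + (p - 1) * c powr p"
      using iap iw by simp
    finally have "p * c powr p \<le> (LINT y|lborel. w y * a y powr p) + (p - 1) * c powr p"
      by (simp only: mult.assoc cp)
    then have "c powr p \<le> (LINT y|lborel. w y * a y powr p)" by (simp add: algebra_simps)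
    then show ?thesis by (simp only: c_def)
  qed
qed

text \<open>Jensen's inequality pointwise, then Fubini, since the translates of the mollifier have integral one.\<close>

lemma mollify_gradient_energy:
  fixes u :: "'a::euclidean_space \<Rightarrow> real" and D :: "'a \<Rightarrow> 'a"
  assumes p: "1 < p" and r: "0 < r" and u: "integrable lborel u" and D: "integrable lborel D"
    and Dp: "integrable lborel (\<lambda>y. norm (D y) powr p)"
    and S: "open S" "bounded S" "\<And>x. x \<in> S \<Longrightarrow> cball x r \<subseteq> \<Omega>"
    and weak: "\<And>\<phi> b. \<phi> \<in> test_functions \<Omega> \<Longrightarrow> b \<in> Basis \<Longrightarrow>
       (LINT y|lborel. u y * frechet_derivative \<phi> (at y) b) = - (LINT y|lborel. (D y \<bullet> b) * \<phi> y)"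
  shows "(LINT x:S|lborel. norm (mollify_gradient r u x) powr p) \<le> (LINT y|lborel. norm (D y) powr p)"
proof -
  define N where "N = bump_mass r TYPE('a)"
  have N: "0 < N" unfolding N_def by (rule bump_mass_pos[OF r])
  define B where "B w = bump 0 r (w::'a) / N" for w
  have B0: "0 \<le> B w" for w using N by (simp add: B_def bump_nonneg)
  have contB: "continuous_on UNIV B" unfolding B_def by (intro continuous_intros continuous_bump) (use N in auto)
  then have [measurable]: "B \<in> borel_measurable borel" by (rule borel_measurable_continuous_onI)
  have [measurable]: "D \<in> borel_measurable borel" using borel_measurable_integrable[OF D] by simp
  have [measurable]: "S \<in> sets borel" using S by auto
  have iB: "integrable lborel B" unfolding B_def using integrable_bump[OF r] by auto
  have IB: "(LINT w|lborel. B w) = 1" using N by (simp add: B_def N_def bump_mass_def)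
  have iBx: "integrable lborel (\<lambda>y. B (x - y))" "(LINT y|lborel. B (x - y)) = 1" for x
    using integral_translate(3,4)[of B x] iB IB by auto
  have iBx': "(LINT x|lborel. B (x - y)) = 1" "integrable lborel (\<lambda>x. B (x - y))" for y
    using integral_translate(1,2)[of B y] iB IB by auto
  obtain C where C: "\<And>w. norm (B w) \<le> C"
    using compact_support_bounded[OF contB, of r] bump_eq_0[OF r] by (auto simp: B_def)
  have iBf: "integrable lborel (\<lambda>y. B (x - y) * f y)" if "integrable lborel f" for x and f :: "'a \<Rightarrow> real"
    using integrable_scaleR_bounded[OF that, of "\<lambda>y. B (x - y)" C] C by (simp add: mult.commute)
  define g where "g = mollify_gradient r u"
  have contg: "continuous_on UNIV g" unfolding g_def by (rule mollify_C1(2)[OF r u])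
  then have [measurable]: "g \<in> borel_measurable borel" by (rule borel_measurable_continuous_onI)
  have pt: "norm (g x) powr p \<le> (LINT y|lborel. B (x - y) * norm (D y) powr p)" if x: "x \<in> S" for x
  proof -
    have "g x = (1 / N) *\<^sub>R (LINT y|lborel. bump 0 r (x - y) *\<^sub>R D y)"
      unfolding g_def N_def by (rule mollify_gradient_eq(1)[OF r u D S(3)[OF x]]) (rule weak)
    also have "\<dots> = (LINT y|lborel. (1 / N) *\<^sub>R (bump 0 r (x - y) *\<^sub>R D y))"
      by (rule integral_scaleR_right[symmetric])
    finally have "g x = (LINT y|lborel. B (x - y) *\<^sub>R D y)"
      by (simp add: B_def)
    moreover have "norm (LINT y|lborel. B (x - y) *\<^sub>R D y) \<le> (LINT y|lborel. norm (B (x - y) *\<^sub>R D y))"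
      by (rule integral_norm_bound)
    ultimately have "norm (g x) \<le> (LINT y|lborel. B (x - y) * norm (D y))" using B0 by simp
    then have "norm (g x) powr p \<le> (LINT y|lborel. B (x - y) * norm (D y)) powr p"
      using p by (intro powr_mono2) auto
    also have "\<dots> \<le> (LINT y|lborel. B (x - y) * norm (D y) powr p)"
      by (rule Jensen_powr_weighted[OF p _ B0 iBx iBf iBf[OF Dp]]) (use D in auto)
    finally show ?thesis .
  qed
  have gp: "continuous_on UNIV (\<lambda>x. norm (g x) powr p)"
    using p by (intro continuous_on_powr' continuous_intros contg) auto
  have si: "set_integrable lborel S (\<lambda>x. norm (g x) powr p)"
    by (rule set_integrable_continuous_bounded[OF gp S(2)]) simp
  have "ennreal (LINT x:S|lborel. norm (g x) powr p) = (\<integral>\<^sup>+x. ennreal (indicator S x *\<^sub>R norm (g x) powr p) \<partial>lborel)"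
    unfolding set_lebesgue_integral_def using si by (intro nn_integral_eq_integral[symmetric]) (auto simp: set_integrable_def)
  also have "\<dots> \<le> (\<integral>\<^sup>+x. (\<integral>\<^sup>+y. ennreal (B (x - y) * norm (D y) powr p) \<partial>lborel) \<partial>lborel)"
  proof (rule nn_integral_mono)
    fix x :: 'a
    show "ennreal (indicator S x *\<^sub>R norm (g x) powr p) \<le> (\<integral>\<^sup>+y. ennreal (B (x - y) * norm (D y) powr p) \<partial>lborel)"
    proof (cases "x \<in> S")
      case True
      have "(\<integral>\<^sup>+y. ennreal (B (x - y) * norm (D y) powr p) \<partial>lborel) = ennreal (LINT y|lborel. B (x - y) * norm (D y) powr p)"
        using B0 by (intro nn_integral_eq_integral iBf Dp) auto
      then show ?thesis using pt[OF True] True by (simp add: ennreal_leI)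
    qed simp
  qed
  also have "\<dots> = (\<integral>\<^sup>+y. (\<integral>\<^sup>+x. ennreal (B (x - y) * norm (D y) powr p) \<partial>lborel) \<partial>lborel)"
    by (rule lborel_pair.Fubini'[symmetric]) (unfold case_prod_beta, measurable)
  also have "\<dots> = (\<integral>\<^sup>+y. ennreal (norm (D y) powr p) \<partial>lborel)"
  proof (rule nn_integral_cong)
    fix y :: 'a
    have "(\<integral>\<^sup>+x. ennreal (B (x - y) * norm (D y) powr p) \<partial>lborel) = ennreal (LINT x|lborel. B (x - y) * norm (D y) powr p)"
      using B0 iBx'(2) by (intro nn_integral_eq_integral) auto
    then show "(\<integral>\<^sup>+x. ennreal (B (x - y) * norm (D y) powr p) \<partial>lborel) = ennreal (norm (D y) powr p)"
      using iBx'(1)[of y] by simp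
  qed
  also have "\<dots> = ennreal (LINT y|lborel. norm (D y) powr p)"
    using Dp by (intro nn_integral_eq_integral) auto
  finally show ?thesis by (simp add: g_def ennreal_le_iff)
qed

text \<open>The mollification is an average of translates by vectors of length less than \<open>r\<close>.\<close>

lemma mollify_L1:
  fixes u :: "'a::euclidean_space \<Rightarrow> real"
  assumes r: "0 < r" and u: "integrable lborel u" and small: "\<And>w. norm w < r \<Longrightarrow> L1_modulus u w \<le> \<epsilon>"
  shows "integrable lborel (mollify r u)" "(LINT x|lborel. \<bar>mollify r u x - u x\<bar>) \<le> \<epsilon>"
proof -
  define N where "N = bump_mass r TYPE('a)"
  have N: "0 < N" unfolding N_def by (rule bump_mass_pos[OF r])
  have \<epsilon>: "0 \<le> \<epsilon>" using small[of 0] r by (simp add: L1_modulus_def)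
  define B where "B w = bump 0 r (w::'a) / N" for w
  have B0: "0 \<le> B w" for w using N by (simp add: B_def bump_nonneg)
  have contB: "continuous_on UNIV B" unfolding B_def by (intro continuous_intros continuous_bump) (use N in auto)
  then have [measurable]: "B \<in> borel_measurable borel" by (rule borel_measurable_continuous_onI)
  have [measurable]: "u \<in> borel_measurable borel" using borel_measurable_integrable[OF u] by simp
  have iB: "integrable lborel B" unfolding B_def using integrable_bump[OF r] by auto
  have IB: "(LINT w|lborel. B w) = 1" using N by (simp add: B_def N_def bump_mass_def)
  obtain C where C: "\<And>w. norm (B w) \<le> C"
    using compact_support_bounded[OF contB, of r] bump_eq_0[OF r] by (auto simp: B_def)
  have cont: "continuous_on UNIV (mollify r u)"
    by (intro continuous_at_imp_continuous_on ballI has_derivative_continuous[OF mollify_C1(1)[OF r u]])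
  then have [measurable]: "mollify r u \<in> borel_measurable borel" by (rule borel_measurable_continuous_onI)
  have i1: "integrable lborel (\<lambda>w. u (x - w) * B w)" for x
    using integrable_scaleR_bounded[of "\<lambda>w. u (x - w)" B C] C integral_translate(4)[of u x] u by simp
  have m: "mollify r u x = (LINT w|lborel. u (x - w) * B w)" for x
  proof -
    have "mollify r u x = (LINT y|lborel. u y * B (x - y))"
      by (simp add: mollify_def B_def N_def)
    also have "\<dots> = (LINT w|lborel. u (x - w) * B (x - (x - w)))"
      by (rule integral_translate(3)[symmetric, of "\<lambda>y. u y * B (x - y)"]) measurable
    finally show ?thesis by simp
  qed
  have d: "mollify r u x - u x = (LINT w|lborel. (u (x - w) - u x) * B w)" for x
  proof -
    have "(LINT w|lborel. (u (x - w) - u x) * B w) = (LINT w|lborel. u (x - w) * B w) - (LINT w|lborel. u x * B w)"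
      unfolding left_diff_distrib using i1 iB by (intro Bochner_Integration.integral_diff) auto
    then show ?thesis using IB by (simp add: m)
  qed
  have nn: "(\<integral>\<^sup>+x. ennreal \<bar>mollify r u x - u x\<bar> \<partial>lborel) \<le> ennreal \<epsilon>"
  proof -
    have "(\<integral>\<^sup>+x. ennreal \<bar>mollify r u x - u x\<bar> \<partial>lborel) \<le> (\<integral>\<^sup>+x. (\<integral>\<^sup>+w. ennreal (\<bar>u (x - w) - u x\<bar> * B w) \<partial>lborel) \<partial>lborel)"
    proof (rule nn_integral_mono)
      fix x :: 'a
      have "integrable lborel (\<lambda>w. (u (x - w) - u x) * B w)"
        unfolding left_diff_distrib using i1 iB by auto
      from integral_norm_bound_ennreal[OF this]
      show "ennreal \<bar>mollify r u x - u x\<bar> \<le> (\<integral>\<^sup>+w. ennreal (\<bar>u (x - w) - u x\<bar> * B w) \<partial>lborel)"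
        unfolding d using B0 by (simp add: abs_mult)
    qed
    also have "\<dots> = (\<integral>\<^sup>+w. (\<integral>\<^sup>+x. ennreal (\<bar>u (x - w) - u x\<bar> * B w) \<partial>lborel) \<partial>lborel)"
      by (rule lborel_pair.Fubini'[symmetric]) (unfold case_prod_beta, measurable)
    also have "\<dots> \<le> (\<integral>\<^sup>+w. ennreal (\<epsilon> * B w) \<partial>lborel)"
    proof (rule nn_integral_mono)
      fix w :: 'a
      have "(\<integral>\<^sup>+x. ennreal (\<bar>u (x - w) - u x\<bar> * B w) \<partial>lborel) = ennreal (LINT x|lborel. \<bar>u (x - w) - u x\<bar> * B w)"
        using B0 L1_modulus_integrable[OF u] by (intro nn_integral_eq_integral) auto
      also have "(LINT x|lborel. \<bar>u (x - w) - u x\<bar> * B w) = L1_modulus u w * B w" by (simp add: L1_modulus_def)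
      also have "\<dots> \<le> \<epsilon> * B w"
      proof (cases "norm w < r")
        case True
        then show ?thesis using small B0 by (intro mult_right_mono) auto
      next
        case False
        then show ?thesis using bump_eq_0[OF r, of w] by (simp add: B_def)
      qed
      finally show "(\<integral>\<^sup>+x. ennreal (\<bar>u (x - w) - u x\<bar> * B w) \<partial>lborel) \<le> ennreal (\<epsilon> * B w)" by (simp add: ennreal_leI)
    qed
    also have "\<dots> = ennreal (LINT w|lborel. \<epsilon> * B w)"
      using B0 \<epsilon> iB by (intro nn_integral_eq_integral) auto
    also have "(LINT w|lborel. \<epsilon> * B w) = \<epsilon>" using IB by simp
    finally show ?thesis .
  qed
  have id: "integrable lborel (\<lambda>x. mollify r u x - u x)"
    using nn by (intro integrableI_bounded) (auto intro: le_less_trans)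
  from Bochner_Integration.integrable_add[OF this u] show "integrable lborel (mollify r u)" by simp
  have "ennreal (LINT x|lborel. \<bar>mollify r u x - u x\<bar>) = (\<integral>\<^sup>+x. ennreal \<bar>mollify r u x - u x\<bar> \<partial>lborel)"
    using id by (intro nn_integral_eq_integral[symmetric]) auto
  then have "ennreal (LINT x|lborel. \<bar>mollify r u x - u x\<bar>) \<le> ennreal \<epsilon>" using nn by simp
  then show "(LINT x|lborel. \<bar>mollify r u x - u x\<bar>) \<le> \<epsilon>" using ennreal_le_iff[OF \<epsilon>] by blast
qed

section \<open>Sobolev functions and the Neumann eigenvalue\<close>

text \<open>The integral depends continuously on \<open>c\<close> and changes sign between the bounds of \<open>w\<close> on \<open>K\<close>.\<close>

lemma exists_p_mean:
  fixes w :: "'a::euclidean_space \<Rightarrow> real"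
  assumes p: "1 < p" and w: "continuous_on UNIV w" and K: "open K" "bounded K"
  shows "\<exists>c. (LINT x:K|lborel. \<bar>w x - c\<bar> powr (p - 2) * (w x - c)) = 0"
proof -
  have "compact (w ` closure K)"
    using K(2) by (intro compact_continuous_image continuous_on_subset[OF w]) (auto simp: compact_closure)
  then have "bounded (w ` closure K)" by (rule compact_imp_bounded)
  then obtain M0 where M0: "\<forall>y\<in>w ` closure K. norm y \<le> M0" unfolding bounded_iff by blast
  define M where "M = \<bar>M0\<bar>"
  have M: "\<bar>w x\<bar> \<le> M" if "x \<in> K" for x
    using M0 closure_subset that by (fastforce simp: M_def)
  define \<Phi> where "\<Phi> c = (LINT x:K|lborel. \<bar>w x - c\<bar> powr (p - 2) * (w x - c))" for c
  have cont: "continuous_on UNIV (\<lambda>x. \<bar>w x - c\<bar> powr (p - 2) * (w x - c))" for c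
    by (intro continuous_signed_powr p continuous_intros w)
  have abs: "\<bar>\<bar>s\<bar> powr (p - 2) * s\<bar> = \<bar>s\<bar> powr (p - 1)" for s :: real
    using powr_add[of "\<bar>s\<bar>" "p - 2" 1] by (cases "s = 0") (auto simp: abs_mult)
  have [measurable]: "K \<in> sets borel" using K by auto
  have mb: "(\<lambda>x. \<bar>w x - c\<bar> powr (p - 2) * (w x - c)) \<in> borel_measurable borel" for c
    using cont by (rule borel_measurable_continuous_onI)
  have "continuous_on {-M..M} \<Phi>"
    unfolding continuous_on_sequentially comp_def
  proof safe
    fix X and c :: real assume XM: "\<forall>n. X n \<in> {-M..M}" and c: "c \<in> {-M..M}" and X: "X \<longlonglongrightarrow> c"
    show "(\<lambda>n. \<Phi> (X n)) \<longlonglongrightarrow> \<Phi> c"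
      unfolding \<Phi>_def set_lebesgue_integral_def
    proof (rule integral_dominated_convergence[where w = "\<lambda>x. (2 * M) powr (p - 1) * indicator K x"])
      show "(\<lambda>x. indicat_real K x *\<^sub>R (\<bar>w x - c\<bar> powr (p - 2) * (w x - c))) \<in> borel_measurable lborel" for c
        using mb[of c] by (intro borel_measurable_scaleR borel_measurable_indicator) auto
      then show "(\<lambda>x. indicat_real K x *\<^sub>R (\<bar>w x - X n\<bar> powr (p - 2) * (w x - X n))) \<in> borel_measurable lborel" for n .
      show "integrable lborel (\<lambda>x. (2 * M) powr (p - 1) * indicat_real K x)"
        using bounded_emeasure_lborel_finite[OF K(2)] by (intro integrable_mult_right) (auto simp: integrable_indicator_iff)
      show "AE x in lborel. (\<lambda>n. indicat_real K x *\<^sub>R (\<bar>w x - X n\<bar> powr (p - 2) * (w x - X n))) \<longlonglongrightarrow> indicat_real K x *\<^sub>R (\<bar>w x - c\<bar> powr (p - 2) * (w x - c))"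
      proof (rule AE_I2)
        fix x :: 'a
        have "continuous_on UNIV (\<lambda>s::real. \<bar>s\<bar> powr (p - 2) * s)" by (rule continuous_signed_powr[OF p continuous_on_id])
        moreover have "(\<lambda>n. w x - X n) \<longlonglongrightarrow> w x - c" by (intro tendsto_intros X)
        ultimately have "(\<lambda>n. \<bar>w x - X n\<bar> powr (p - 2) * (w x - X n)) \<longlonglongrightarrow> \<bar>w x - c\<bar> powr (p - 2) * (w x - c)"
          by (rule continuous_on_tendsto_compose) auto
        then show "(\<lambda>n. indicat_real K x *\<^sub>R (\<bar>w x - X n\<bar> powr (p - 2) * (w x - X n))) \<longlonglongrightarrow> indicat_real K x *\<^sub>R (\<bar>w x - c\<bar> powr (p - 2) * (w x - c))"
          by (rule tendsto_scaleR[OF tendsto_const])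
      qed
      show "AE x in lborel. norm (indicat_real K x *\<^sub>R (\<bar>w x - X n\<bar> powr (p - 2) * (w x - X n))) \<le> (2 * M) powr (p - 1) * indicat_real K x" for n
      proof (rule AE_I2)
        fix x :: 'a
        show "norm (indicat_real K x *\<^sub>R (\<bar>w x - X n\<bar> powr (p - 2) * (w x - X n))) \<le> (2 * M) powr (p - 1) * indicat_real K x"
        proof (cases "x \<in> K")
          case True
          have "\<bar>w x - X n\<bar> \<le> 2 * M" using M[OF True] XM[rule_format, of n] by auto
          then have "\<bar>w x - X n\<bar> powr (p - 1) \<le> (2 * M) powr (p - 1)" using p by (intro powr_mono2) auto
          then show ?thesis using True abs[of "w x - X n"] by simp
        qed simp
      qed
    qed
  qed
  moreover have "\<Phi> M \<le> 0"
  proof -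
    have "0 \<le> (LINT x:K|lborel. - (\<bar>w x - M\<bar> powr (p - 2) * (w x - M)))"
      unfolding set_lebesgue_integral_def using M by (intro integral_nonneg_AE) (force simp: indicator_def mult_nonneg_nonpos)
    then show ?thesis by (simp add: \<Phi>_def set_lebesgue_integral_def)
  qed
  moreover have "0 \<le> \<Phi> (- M)"
    unfolding \<Phi>_def set_lebesgue_integral_def using M by (intro integral_nonneg_AE) (force simp: indicator_def)
  ultimately have "\<exists>c\<ge>- M. c \<le> M \<and> \<Phi> c = 0" by (intro IVT2') (auto simp: M_def)
  then show ?thesis by (auto simp: \<Phi>_def)
qed

lemma inner_parallel_convex:
  fixes \<Omega> :: "'a::euclidean_space set"
  assumes "convex \<Omega>"
  shows "convex {x. cball x r \<subseteq> \<Omega>}"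
proof (rule convexI, safe)
  fix x y z and s t :: real
  assume xy: "cball x r \<subseteq> \<Omega>" "cball y r \<subseteq> \<Omega>" and st: "0 \<le> s" "0 \<le> t" "s + t = 1" and z: "z \<in> cball (s *\<^sub>R x + t *\<^sub>R y) r"
  define w where "w = z - (s *\<^sub>R x + t *\<^sub>R y)"
  have "norm w \<le> r" using z by (simp add: w_def dist_norm norm_minus_commute)
  then have "x + w \<in> \<Omega>" "y + w \<in> \<Omega>" using xy by (auto simp: subset_iff dist_norm)
  then have "s *\<^sub>R (x + w) + t *\<^sub>R (y + w) \<in> \<Omega>" using convexD[OF assms] st by blast
  moreover have "s *\<^sub>R (x + w) + t *\<^sub>R (y + w) = s *\<^sub>R x + t *\<^sub>R y + (s + t) *\<^sub>R w" by (simp add: algebra_simps)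
  ultimately show "z \<in> \<Omega>" by (simp add: st(3) w_def)
qed

text \<open>Apply the inequality for \<open>C\<^sup>1\<close> functions to mollifications \<open>v n\<close> on inner parallel sets \<open>S n\<close>, with constants
  \<open>c n\<close> that restore the constraint. All \<open>S n\<close> contain one fixed ball, on which the bounds on \<open>v n - c n\<close> and
  \<open>v n\<close> keep \<open>c n\<close> bounded. So along a subsequence \<open>v n\<close> converges almost everywhere and \<open>c n\<close>
  converges, and Fatou's lemma gives the bound for the limit.\<close>

theorem sobolev_poincare_convex:
  fixes \<Omega> :: "'a::euclidean_space set" and u :: "'a \<Rightarrow> real" and D :: "'a \<Rightarrow> 'a"
  assumes p: "1 < p" and m: "0 < m" and Zm: "0 < Zm" and dL: "d < L"
    and L: "L / 2 \<le> integral {0..Zm} (\<lambda>z. 1 / (1 + m * z powr p))"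
    and \<Omega>: "open \<Omega>" "bounded \<Omega>" "convex \<Omega>" "\<Omega> \<noteq> {}" and d: "\<And>x y. x \<in> \<Omega> \<Longrightarrow> y \<in> \<Omega> \<Longrightarrow> dist x y \<le> d"
    and u: "integrable lborel u" and D: "integrable lborel D" and Dp: "integrable lborel (\<lambda>y. norm (D y) powr p)"
    and weak: "\<And>\<phi> b. \<phi> \<in> test_functions \<Omega> \<Longrightarrow> b \<in> Basis \<Longrightarrow>
       (LINT y|lborel. u y * frechet_derivative \<phi> (at y) b) = - (LINT y|lborel. (D y \<bullet> b) * \<phi> y)"
  shows "\<exists>c. (\<integral>\<^sup>+x. ennreal (\<bar>u x - c\<bar> powr p) * indicator \<Omega> x \<partial>lborel)
            \<le> ennreal ((LINT y|lborel. norm (D y) powr p) / ((p - 1) * m))"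
proof -
  define M where "M = (p - 1) * m"
  have M: "0 < M" using p m by (simp add: M_def)
  define R where "R = (LINT y|lborel. norm (D y) powr p)"
  have R: "0 \<le> R" by (simp add: R_def)
  have [measurable]: "u \<in> borel_measurable borel" using borel_measurable_integrable[OF u] by simp
  obtain x0 where x0: "x0 \<in> \<Omega>" using \<Omega>(4) by blast
  obtain s0 where s0: "s0 > 0" "ball x0 s0 \<subseteq> \<Omega>" using \<Omega>(1) x0 openE by blast
  define s where "s = s0 / 2"
  have s: "0 < s" "ball x0 (2 * s) \<subseteq> \<Omega>" using s0 by (auto simp: s_def)
  have "\<exists>r. \<forall>n. 0 < r n \<and> r n \<le> s \<and> r n \<le> 1 / Suc n \<and> (\<forall>w. norm w < r n \<longrightarrow> L1_modulus u w \<le> 1 / Suc n)"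
  proof (rule choice, rule allI)
    fix n :: nat
    obtain r where r: "r > 0" "\<forall>w. norm w < r \<longrightarrow> L1_modulus u w < 1 / Suc n"
      using L1_modulus_small[OF u, of "1 / Suc n"] by auto
    then show "\<exists>r. 0 < r \<and> r \<le> s \<and> r \<le> 1 / Suc n \<and> (\<forall>w. norm w < r \<longrightarrow> L1_modulus u w \<le> 1 / Suc n)"
      using s(1) by (intro exI[of _ "min r (min s (1 / Suc n))"]) (auto intro: less_imp_le)
  qed
  then obtain r where r: "\<And>n. 0 < r n" "\<And>n. r n \<le> s" "\<And>n. r n \<le> 1 / Suc n" "\<And>n w. norm w < r n \<Longrightarrow> L1_modulus u w \<le> 1 / Suc n"
    by blast
  define v where "v n = mollify (r n) u" for n
  define g where "g n = mollify_gradient (r n) u" for n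
  have v: "(v n has_derivative (\<lambda>h. g n x \<bullet> h)) (at x)" "continuous_on UNIV (g n)" for n x
    unfolding v_def g_def using mollify_C1[OF r(1) u] by auto
  have contv: "continuous_on UNIV (v n)" for n
    by (intro continuous_at_imp_continuous_on ballI has_derivative_continuous[OF v(1)])
  then have [measurable]: "v n \<in> borel_measurable borel" for n by (rule borel_measurable_continuous_onI)
  have vint: "integrable lborel (v n)" and vL1: "(LINT x|lborel. \<bar>v n x - u x\<bar>) \<le> 1 / Suc n" for n
    unfolding v_def using mollify_L1[OF r(1) u r(4)] by auto
  define S where "S n = interior {x. cball x (r n) \<subseteq> \<Omega>}" for n
  have S: "open (S n)" "convex (S n)" "S n \<subseteq> \<Omega>" "bounded (S n)" and Scb: "x \<in> S n \<Longrightarrow> cball x (r n) \<subseteq> \<Omega>" for n x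
  proof -
    show "open (S n)" by (simp add: S_def)
    show "convex (S n)" unfolding S_def by (intro convex_interior inner_parallel_convex \<Omega>)
    show cb: "x \<in> S n \<Longrightarrow> cball x (r n) \<subseteq> \<Omega>" for x using interior_subset by (force simp: S_def)
    show sub: "S n \<subseteq> \<Omega>" using cb r(1)[of n] by (force simp: less_imp_le)
    then show "bounded (S n)" using \<Omega>(2) bounded_subset by blast
  qed
  have inS: "ball x t \<subseteq> S n" if "ball x (2 * t) \<subseteq> \<Omega>" "r n \<le> t" for x t n
    unfolding S_def
  proof (rule interior_maximal)
    show "ball x t \<subseteq> {x. cball x (r n) \<subseteq> \<Omega>}"
    proof safe
      fix y z assume "y \<in> ball x t" "z \<in> cball y (r n)"
      then have "dist x z < 2 * t" using dist_triangle[of x z y] that(2) by auto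
      then show "z \<in> \<Omega>" using that(1) by auto
    qed
  qed auto
  have "\<exists>c. \<forall>n. (LINT x:S n|lborel. \<bar>v n x - c n\<bar> powr (p - 2) * (v n x - c n)) = 0"
    by (rule choice) (use exists_p_mean[OF p contv S(1,4)] in blast)
  then obtain c where c: "\<And>n. (LINT x:S n|lborel. \<bar>v n x - c n\<bar> powr (p - 2) * (v n x - c n)) = 0" by blast
  have contp: "continuous_on UNIV (\<lambda>x. \<bar>v n x - c n\<bar> powr p)" for n
    using p by (intro continuous_on_powr' continuous_intros contv) auto
  have sip: "set_integrable lborel K (\<lambda>x. \<bar>v n x - c n\<bar> powr p)" if "open K" "bounded K" for K n
    using that contp by (intro set_integrable_continuous_bounded) auto
  have bnd: "(LINT x:S n|lborel. \<bar>v n x - c n\<bar> powr p) \<le> R / M" for n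
  proof -
    have "(p - 1) * m * (LINT x:S n|lborel. \<bar>v n x - c n\<bar> powr p) \<le> (LINT x:S n|lborel. norm (g n x) powr p)"
    proof (rule C1_poincare_convex[OF p m Zm dL L _ v(2) S(1,4,2)])
      show "((\<lambda>x. v n x - c n) has_derivative (\<lambda>h. g n x \<bullet> h)) (at x)" for x
        using has_derivative_diff[OF v(1) has_derivative_const] by simp
      show "dist x y \<le> d" if "x \<in> S n" "y \<in> S n" for x y using d that S(3) by blast
    qed (rule c)
    also have "\<dots> \<le> R" unfolding g_def R_def
      by (rule mollify_gradient_energy[OF p r(1) u D Dp S(1,4) Scb weak])
    finally show ?thesis using M by (simp add: M_def pos_le_divide_eq mult.commute)
  qed
  define B where "B = ball x0 s"
  have B: "open B" "bounded B" "B \<subseteq> S n" for n using inS[OF s(2) r(2)] by (auto simp: B_def)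
  have mB: "0 < measure lborel B" using s(1) by (intro measure_lborel_open_pos B) (auto simp: B_def)
  have c_bd: "\<bar>c n\<bar> \<le> (measure lborel B + R / M + (LINT x|lborel. \<bar>u x\<bar>) + 1) / measure lborel B" for n
  proof -
    have si1: "set_integrable lborel B (\<lambda>x. \<bar>v n x\<bar>)" "set_integrable lborel B (\<lambda>x. 1 + \<bar>v n x - c n\<bar> powr p)"
       "set_integrable lborel B (\<lambda>x. \<bar>c n\<bar>)" "set_integrable lborel B (\<lambda>x. 1::real)"
    proof -
      have sB: "set_integrable lborel B f" if "continuous_on UNIV f" for f :: "'a \<Rightarrow> real"
        using B(1,2) that by (intro set_integrable_continuous_bounded) auto
      show "set_integrable lborel B (\<lambda>x. \<bar>v n x\<bar>)" "set_integrable lborel B (\<lambda>x. 1 + \<bar>v n x - c n\<bar> powr p)"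
       "set_integrable lborel B (\<lambda>x. \<bar>c n\<bar>)" "set_integrable lborel B (\<lambda>x. 1::real)"
        by (intro sB continuous_on_rabs contv continuous_on_add contp continuous_on_const)+
    qed
    have "\<bar>c n\<bar> * measure lborel B = (LINT x:B|lborel. \<bar>c n\<bar>)" by (simp add: set_lebesgue_integral_def)
    also have "\<dots> \<le> (LINT x:B|lborel. (1 + \<bar>v n x - c n\<bar> powr p) + \<bar>v n x\<bar>)"
    proof (rule set_integral_mono[OF si1(3) set_integral_add(1)[OF si1(2,1)]])
      fix x assume "x \<in> B"
      have "\<bar>v n x - c n\<bar> \<le> 1 + \<bar>v n x - c n\<bar> powr p"
      proof (cases "\<bar>v n x - c n\<bar> \<le> 1")
        case False
        then have "\<bar>v n x - c n\<bar> powr 1 \<le> \<bar>v n x - c n\<bar> powr p" using p by (intro powr_mono) auto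
        then show ?thesis using False by simp
      qed (auto intro: order_trans)
      then show "\<bar>c n\<bar> \<le> (1 + \<bar>v n x - c n\<bar> powr p) + \<bar>v n x\<bar>" by linarith
    qed
    also have "\<dots> = (LINT x:B|lborel. 1 + \<bar>v n x - c n\<bar> powr p) + (LINT x:B|lborel. \<bar>v n x\<bar>)"
      by (rule set_integral_add(2)[OF si1(2,1)])
    also have "(LINT x:B|lborel. 1 + \<bar>v n x - c n\<bar> powr p) = (LINT x:B|lborel. 1) + (LINT x:B|lborel. \<bar>v n x - c n\<bar> powr p)"
      by (rule set_integral_add(2)[OF si1(4) sip[OF B(1,2)]])
    also have "(LINT x:B|lborel. \<bar>v n x - c n\<bar> powr p) \<le> (LINT x:S n|lborel. \<bar>v n x - c n\<bar> powr p)"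
      unfolding set_lebesgue_integral_def using sip[OF B(1,2)] sip[OF S(1,4)] B(3)[of n]
      by (intro integral_mono) (auto simp: set_integrable_def indicator_def)
    also have "\<dots> \<le> R / M" by (rule bnd)
    also have "(LINT x:B|lborel. (1::real)) = measure lborel B" by (simp add: set_lebesgue_integral_def)
    also have "(LINT x:B|lborel. \<bar>v n x\<bar>) \<le> (LINT x|lborel. \<bar>v n x - u x\<bar> + \<bar>u x\<bar>)"
      unfolding set_lebesgue_integral_def using si1(1) vint[of n] u
      by (intro integral_mono) (auto simp: set_integrable_def indicator_def)
    also have "\<dots> = (LINT x|lborel. \<bar>v n x - u x\<bar>) + (LINT x|lborel. \<bar>u x\<bar>)" using vint[of n] u by simp
    also have "\<dots> \<le> 1 + (LINT x|lborel. \<bar>u x\<bar>)" using vL1[of n] by (simp add: divide_le_eq_1 order_trans)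
    finally show ?thesis using mB by (simp add: pos_le_divide_eq algebra_simps)
  qed
  have "(\<lambda>n. LINT x|lborel. norm (v n x - u x)) \<longlonglongrightarrow> 0"
  proof (rule tendsto_sandwich[OF _ _ tendsto_const LIMSEQ_inverse_real_of_nat])
    show "\<forall>\<^sub>F n in sequentially. (LINT x|lborel. norm (v n x - u x)) \<le> inverse (real (Suc n))"
      using vL1 by (simp add: inverse_eq_divide)
  qed simp
  then obtain q where q: "strict_mono q" "AE x in lborel. (\<lambda>n. v (q n) x - u x) \<longlonglongrightarrow> 0"
    using tendsto_L1_AE_subseq[of lborel "\<lambda>n x. v n x - u x"] vint u by auto
  have "bounded (range (c \<circ> q))"
    unfolding bounded_iff using c_bd by (auto intro!: exI)
  then obtain cl q' where q': "strict_mono q'" "((c \<circ> q) \<circ> q') \<longlonglongrightarrow> cl"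
    using bounded_imp_convergent_subsequence by blast
  define k where "k n = q (q' n)" for n
  have k: "strict_mono k" using q(1) q'(1) by (auto simp: strict_mono_def k_def)
  have ck: "(\<lambda>n. c (k n)) \<longlonglongrightarrow> cl" using q'(2) by (simp add: k_def comp_def)
  define F where "F n x = ennreal (\<bar>v (k n) x - c (k n)\<bar> powr p) * indicator (S (k n)) x" for n x
  have [measurable]: "S n \<in> sets borel" for n using S(1) by auto
  have Fm [measurable]: "F n \<in> borel_measurable lborel" for n unfolding F_def by measurable
  have FI: "(\<integral>\<^sup>+x. F n x \<partial>lborel) \<le> ennreal (R / M)" for n
  proof -
    have "F n x = ennreal (indicator (S (k n)) x *\<^sub>R \<bar>v (k n) x - c (k n)\<bar> powr p)" for x by (auto simp: F_def indicator_def)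
    then have "(\<integral>\<^sup>+x. F n x \<partial>lborel) = ennreal (LINT x:S (k n)|lborel. \<bar>v (k n) x - c (k n)\<bar> powr p)"
      unfolding set_lebesgue_integral_def using sip[OF S(1,4)]
      by (simp only:) (intro nn_integral_eq_integral, auto simp: set_integrable_def)
    then show ?thesis using bnd[of "k n"] by (simp add: ennreal_leI)
  qed
  have r0: "r \<longlonglongrightarrow> 0"
  proof (rule tendsto_sandwich[OF _ _ tendsto_const LIMSEQ_inverse_real_of_nat])
    show "\<forall>\<^sub>F n in sequentially. 0 \<le> r n" using r(1) by (simp add: less_imp_le)
    show "\<forall>\<^sub>F n in sequentially. r n \<le> inverse (real (Suc n))" using r(3) by (simp add: inverse_eq_divide)
  qed
  have "(\<integral>\<^sup>+x. ennreal (\<bar>u x - cl\<bar> powr p) * indicator \<Omega> x \<partial>lborel) \<le> (\<integral>\<^sup>+x. liminf (\<lambda>n. F n x) \<partial>lborel)"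
  proof (rule nn_integral_mono_AE)
    show "AE x in lborel. ennreal (\<bar>u x - cl\<bar> powr p) * indicator \<Omega> x \<le> liminf (\<lambda>n. F n x)"
      using q(2)
    proof eventually_elim
      case (elim x)
      show ?case
      proof (cases "x \<in> \<Omega>")
        case True
        then obtain t0 where t0: "t0 > 0" "ball x t0 \<subseteq> \<Omega>" using \<Omega>(1) openE by blast
        have "\<forall>\<^sub>F n in sequentially. r (k n) < t0 / 2"
          using LIMSEQ_subseq_LIMSEQ[OF r0 k] t0(1) by (auto dest!: order_tendstoD(2)[of _ _ _ "t0 / 2"] simp: comp_def)
        then have ev: "\<forall>\<^sub>F n in sequentially. x \<in> S (k n)"
        proof (rule eventually_mono)
          fix n assume "r (k n) < t0 / 2"
          then have "ball x (t0 / 2) \<subseteq> S (k n)" using t0 by (intro inS) auto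
          then show "x \<in> S (k n)" using t0(1) by auto
        qed
        have "(\<lambda>n. v (k n) x - u x) \<longlonglongrightarrow> 0"
          using LIMSEQ_subseq_LIMSEQ[OF elim q'(1)] by (simp add: comp_def k_def)
        then have vk: "(\<lambda>n. v (k n) x) \<longlonglongrightarrow> u x" by (simp add: LIM_zero_iff)
        have "continuous_on UNIV (\<lambda>t::real. \<bar>t\<bar> powr p)"
          using p by (intro continuous_on_powr' continuous_intros) auto
        from continuous_on_tendsto_compose[OF this tendsto_diff[OF vk ck]]
        have "(\<lambda>n. \<bar>v (k n) x - c (k n)\<bar> powr p) \<longlonglongrightarrow> \<bar>u x - cl\<bar> powr p" by simp
        then have "(\<lambda>n. ennreal (\<bar>v (k n) x - c (k n)\<bar> powr p)) \<longlonglongrightarrow> ennreal (\<bar>u x - cl\<bar> powr p)" by (rule tendsto_ennrealI)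
        then have "(\<lambda>n. F n x) \<longlonglongrightarrow> ennreal (\<bar>u x - cl\<bar> powr p)"
          by (rule Lim_transform_eventually) (use ev in \<open>auto elim!: eventually_mono simp: F_def\<close>)
        then show ?thesis using True lim_imp_Liminf[of sequentially "\<lambda>n. F n x"] by simp
      qed simp
    qed
  qed
  also have "\<dots> \<le> liminf (\<lambda>n. \<integral>\<^sup>+x. F n x \<partial>lborel)" by (rule nn_integral_liminf) (rule Fm)
  also have "\<dots> \<le> liminf (\<lambda>n. ennreal (R / M))" by (intro Liminf_mono always_eventually allI FI)
  also have "\<dots> = ennreal (R / M)" by (simp add: Liminf_const)
  finally show ?thesis by (auto simp: R_def M_def)
qed

lemma lebesgue_on_integral_borel:
  fixes f :: "'a::euclidean_space \<Rightarrow> 'b::euclidean_space"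
  assumes \<Omega>: "\<Omega> \<in> sets borel" and f: "f \<in> borel_measurable borel"
  shows "integrable (lebesgue_on \<Omega>) f \<longleftrightarrow> set_integrable lborel \<Omega> f"
    and "(LINT x|lebesgue_on \<Omega>. f x) = (LINT x:\<Omega>|lborel. f x)"
proof -
  have m: "(\<lambda>x. indicat_real \<Omega> x *\<^sub>R f x) \<in> borel_measurable lborel"
    using \<Omega> f by (intro borel_measurable_scaleR borel_measurable_indicator) auto
  have s: "\<Omega> \<inter> space lebesgue \<in> sets lebesgue" using \<Omega> by auto
  show "integrable (lebesgue_on \<Omega>) f \<longleftrightarrow> set_integrable lborel \<Omega> f"
    using integrable_restrict_space[OF s, of f] integrable_completion[OF m] by (simp add: set_integrable_def)
  show "(LINT x|lebesgue_on \<Omega>. f x) = (LINT x:\<Omega>|lborel. f x)"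
    using integral_restrict_space[OF s, of f] integral_completion[OF m] by (simp add: set_lebesgue_integral_def)
qed

text \<open>Fubini and convolutions live on Borel functions; the components of \<open>f\<close>, extended by zero, are Lebesgue
  measurable and hence agree with Borel functions almost everywhere.\<close>

lemma borel_representative:
  fixes f :: "'a::euclidean_space \<Rightarrow> 'b::euclidean_space"
  assumes \<Omega>: "\<Omega> \<in> sets borel" and f: "f \<in> borel_measurable (lebesgue_on \<Omega>)"
  obtains g where "g \<in> borel_measurable borel" "\<And>x. x \<notin> \<Omega> \<Longrightarrow> g x = 0" "AE x in lebesgue_on \<Omega>. f x = g x"
proof -
  have s: "\<Omega> \<inter> space lebesgue \<in> sets lebesgue" using \<Omega> by auto
  have "\<exists>h. h \<in> borel_measurable lborel \<and> (AE x in lborel. indicat_real \<Omega> x *\<^sub>R (f x \<bullet> b) = h x)" for b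
  proof -
    have "(\<lambda>x. f x \<bullet> b) \<in> borel_measurable (lebesgue_on \<Omega>)" using f by measurable
    then have "(\<lambda>x. indicat_real \<Omega> x *\<^sub>R (f x \<bullet> b)) \<in> borel_measurable lebesgue"
      using borel_measurable_restrict_space_iff[OF s, of "\<lambda>x. f x \<bullet> b"] by simp
    from completion_ex_borel_measurable_real[OF this] show ?thesis by blast
  qed
  then obtain h where h: "\<And>b. h b \<in> borel_measurable lborel" "\<And>b. AE x in lborel. indicat_real \<Omega> x *\<^sub>R (f x \<bullet> b) = h b x"
    by metis
  define g where "g x = (\<Sum>b\<in>Basis. (indicat_real \<Omega> x * h b x) *\<^sub>R b)" for x
  have [measurable]: "h b \<in> borel_measurable borel" for b using h(1) by simp
  have [measurable]: "\<Omega> \<in> sets borel" by fact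
  show thesis
  proof (rule that[of g])
    show "g \<in> borel_measurable borel" unfolding g_def by measurable
    show "g x = 0" if "x \<notin> \<Omega>" for x using that by (simp add: g_def)
    have "AE x in lborel. \<forall>b\<in>Basis. indicat_real \<Omega> x *\<^sub>R (f x \<bullet> b) = h b x"
      using h(2) by (intro AE_finite_allI) auto
    then have "AE x in lebesgue. \<forall>b\<in>Basis. indicat_real \<Omega> x *\<^sub>R (f x \<bullet> b) = h b x" by (rule AE_completion)
    then have "AE x in lebesgue. x \<in> \<Omega> \<longrightarrow> f x = g x"
    proof eventually_elim
      case (elim x)
      show ?case
      proof
        assume x: "x \<in> \<Omega>"
        show "f x = g x"
        proof (rule euclidean_eqI)
          fix b :: 'b assume b: "b \<in> Basis"
          have "h b x = f x \<bullet> b" using elim b x by force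
          then show "f x \<bullet> b = g x \<bullet> b" using b x by (simp add: g_def)
        qed
      qed
    qed
    then show "AE x in lebesgue_on \<Omega>. f x = g x" using s by (simp add: AE_restrict_space_iff)
  qed
qed

lemma test_function_facts:
  assumes "\<phi> \<in> test_functions \<Omega>"
  shows "(\<phi> has_derivative frechet_derivative \<phi> (at x)) (at x)"
    and "continuous_on UNIV \<phi>"
    and "b \<in> Basis \<Longrightarrow> continuous_on UNIV (\<lambda>x. frechet_derivative \<phi> (at x) b)"
    and "x \<notin> \<Omega> \<Longrightarrow> \<phi> x = 0"
    and "x \<notin> \<Omega> \<Longrightarrow> frechet_derivative \<phi> (at x) = (\<lambda>v. 0)"
    and "\<exists>R. \<forall>x. R \<le> norm x \<longrightarrow> \<phi> x = 0"
proof -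
  have C: "Ck k \<phi>" for k using assms by (simp add: test_functions_def)
  have C1: "Ck (Suc 0) \<phi>" by (rule C)
  show "(\<phi> has_derivative frechet_derivative \<phi> (at x)) (at x)" using C1 by (simp add: frechet_derivative_works)
  show "continuous_on UNIV \<phi>" using C[of 0] by simp
  show "b \<in> Basis \<Longrightarrow> continuous_on UNIV (\<lambda>x. frechet_derivative \<phi> (at x) b)" using C1 by simp
  have sub: "closure {x. \<phi> x \<noteq> 0} \<subseteq> \<Omega>" "compact (closure {x. \<phi> x \<noteq> 0})" using assms by (auto simp: test_functions_def)
  have cl: "{x. \<phi> x \<noteq> 0} \<subseteq> closure {x. \<phi> x \<noteq> 0}" by (rule closure_subset)
  show "\<phi> x = 0" if "x \<notin> \<Omega>" using that subset_trans[OF cl sub(1)] by auto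
  show "frechet_derivative \<phi> (at x) = (\<lambda>v. 0)" if "x \<notin> \<Omega>"
  proof -
    have "open (- closure {x. \<phi> x \<noteq> 0})" by auto
    moreover have "x \<in> - closure {x. \<phi> x \<noteq> 0}" using that sub by auto
    moreover have "0 = \<phi> y" if "y \<in> - closure {x. \<phi> x \<noteq> 0}" for y using that cl by auto
    ultimately have "(\<phi> has_derivative (\<lambda>v. 0)) (at x)"
      by (rule has_derivative_transform_within_open[OF has_derivative_const])
    then show ?thesis using frechet_derivative_at by metis
  qed
  obtain B where B: "\<forall>x\<in>closure {x. \<phi> x \<noteq> 0}. norm x \<le> B" using compact_imp_bounded[OF sub(2)] by (auto simp: bounded_iff)
  have "\<phi> x = 0" if "B + 1 \<le> norm x" for x using B that cl by force
  then show "\<exists>R. \<forall>x. R \<le> norm x \<longrightarrow> \<phi> x = 0" by blast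
qed

text \<open>Pass to Borel representatives; the constraint on \<open>u\<close> then disposes of the constant \<open>c\<close> of
  \<open>sobolev_poincare_convex\<close>.\<close>

lemma W1p_poincare:
  fixes \<Omega> :: "'a::euclidean_space set" and u :: "'a \<Rightarrow> real" and Du :: "'a \<Rightarrow> 'a"
  assumes p: "1 < p" and m: "0 < m" and Zm: "0 < Zm" and dL: "d < L"
    and L: "L / 2 \<le> integral {0..Zm} (\<lambda>z. 1 / (1 + m * z powr p))"
    and \<Omega>: "open \<Omega>" "bounded \<Omega>" "convex \<Omega>" "\<Omega> \<noteq> {}" and d: "\<And>x y. x \<in> \<Omega> \<Longrightarrow> y \<in> \<Omega> \<Longrightarrow> dist x y \<le> d"
    and W: "in_W1p p \<Omega> u Du" and mean: "(LINT x|lebesgue_on \<Omega>. \<bar>u x\<bar> powr (p - 2) * u x) = 0"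
  shows "(p - 1) * m * (LINT x|lebesgue_on \<Omega>. \<bar>u x\<bar> powr p) \<le> (LINT x|lebesgue_on \<Omega>. norm (Du x) powr p)"
proof -
  define M where "M = (p - 1) * m"
  have M: "0 < M" using p m by (simp add: M_def)
  have \<Omega>b [measurable]: "\<Omega> \<in> sets borel" using \<Omega> by auto
  have um: "u \<in> borel_measurable (lebesgue_on \<Omega>)" "integrable (lebesgue_on \<Omega>) (\<lambda>x. norm (u x) powr p)"
    and Dm: "Du \<in> borel_measurable (lebesgue_on \<Omega>)" "integrable (lebesgue_on \<Omega>) (\<lambda>x. norm (Du x) powr p)"
    and wg: "has_weak_gradient u Du \<Omega>" using W by (auto simp: in_W1p_def in_Lp_def)
  obtain v where v [measurable]: "v \<in> borel_measurable borel" and v0: "\<And>x. x \<notin> \<Omega> \<Longrightarrow> v x = 0" and uv: "AE x in lebesgue_on \<Omega>. u x = v x"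
    using borel_representative[OF \<Omega>b um(1)] by blast
  obtain D where D [measurable]: "D \<in> borel_measurable borel" and D0: "\<And>x. x \<notin> \<Omega> \<Longrightarrow> D x = 0" and DuD: "AE x in lebesgue_on \<Omega>. Du x = D x"
    using borel_representative[OF \<Omega>b Dm(1)] by blast
  have whole: "(LINT x:\<Omega>|lborel. f x) = (LINT x|lborel. f x)" "set_integrable lborel \<Omega> f \<longleftrightarrow> integrable lborel f"
    if "\<And>x. x \<notin> \<Omega> \<Longrightarrow> f x = 0" for f :: "'a \<Rightarrow> real"
  proof -
    have "(\<lambda>x. indicat_real \<Omega> x *\<^sub>R f x) = f" using that by (auto simp: fun_eq_iff indicator_def)
    then show "(LINT x:\<Omega>|lborel. f x) = (LINT x|lborel. f x)" "set_integrable lborel \<Omega> f \<longleftrightarrow> integrable lborel f"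
      by (simp_all add: set_lebesgue_integral_def set_integrable_def)
  qed
  have lint: "(LINT x|lebesgue_on \<Omega>. f x) = (LINT x|lborel. h x)"
    if "AE x in lebesgue_on \<Omega>. f x = h x" "h \<in> borel_measurable borel" "f \<in> borel_measurable (lebesgue_on \<Omega>)" "\<And>x. x \<notin> \<Omega> \<Longrightarrow> h x = 0" for f h :: "'a \<Rightarrow> real"
  proof -
    have hm: "h \<in> borel_measurable (lebesgue_on \<Omega>)"
      using that(2) by (intro measurable_restrict_space1 measurable_completion) simp
    have "(LINT x|lebesgue_on \<Omega>. f x) = (LINT x|lebesgue_on \<Omega>. h x)"
      by (rule integral_cong_AE[OF that(3) hm that(1)])
    then show ?thesis using lebesgue_on_integral_borel(2)[OF \<Omega>b that(2)] whole(1)[OF that(4)] by simp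
  qed
  have integ: "integrable lborel h"
    if "AE x in lebesgue_on \<Omega>. f x = h x" "h \<in> borel_measurable borel" "integrable (lebesgue_on \<Omega>) f" "\<And>x. x \<notin> \<Omega> \<Longrightarrow> h x = 0" for f h :: "'a \<Rightarrow> real"
  proof -
    have hm: "h \<in> borel_measurable (lebesgue_on \<Omega>)"
      using that(2) by (intro measurable_restrict_space1 measurable_completion) simp
    have "integrable (lebesgue_on \<Omega>) h"
      using that(3) by (rule integrable_cong_AE_imp[OF _ hm]) (use that(1) in \<open>auto elim: eventually_mono\<close>)
    then show ?thesis using lebesgue_on_integral_borel(1)[OF \<Omega>b that(2)] whole(2)[OF that(4)] by simp
  qed
  have vp: "integrable lborel (\<lambda>x. \<bar>v x\<bar> powr p)"
    by (rule integ[OF _ _ um(2)]) (use uv v0 p in \<open>auto elim!: eventually_mono\<close>)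
  have Dp: "integrable lborel (\<lambda>x. norm (D x) powr p)"
    by (rule integ[OF _ _ Dm(2)]) (use DuD D0 p in \<open>auto elim!: eventually_mono\<close>)
  have i\<Omega>: "integrable lborel (indicat_real \<Omega>)"
    using bounded_emeasure_lborel_finite[OF \<Omega>(2)] by (simp add: integrable_indicator_iff)
  have le1: "t powr q \<le> 1 + t powr p" if "0 \<le> t" "0 \<le> q" "q \<le> p" for t q :: real
  proof (cases "t \<le> 1")
    case True
    then have "t powr q \<le> 1" using that by (simp add: powr_le1)
    then show ?thesis by (simp add: add_increasing2)
  next
    case False
    then have "t powr q \<le> t powr p" using that by (intro powr_mono) auto
    then show ?thesis by simp
  qed
  have vi: "integrable lborel v"
  proof (rule Bochner_Integration.integrable_bound)
    show "integrable lborel (\<lambda>x. indicat_real \<Omega> x + \<bar>v x\<bar> powr p)" using i\<Omega> vp by auto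
    show "AE x in lborel. norm (v x) \<le> norm (indicat_real \<Omega> x + \<bar>v x\<bar> powr p)"
    proof (rule AE_I2)
      fix x :: 'a
      show "norm (v x) \<le> norm (indicat_real \<Omega> x + \<bar>v x\<bar> powr p)"
        using le1[of "\<bar>v x\<bar>" 1] p v0[of x] by (cases "x \<in> \<Omega>") auto
    qed
  qed simp
  have Di: "integrable lborel D"
  proof (rule Bochner_Integration.integrable_bound)
    show "integrable lborel (\<lambda>x. indicat_real \<Omega> x + norm (D x) powr p)" using i\<Omega> Dp by auto
    show "AE x in lborel. norm (D x) \<le> norm (indicat_real \<Omega> x + norm (D x) powr p)"
    proof (rule AE_I2)
      fix x :: 'a
      show "norm (D x) \<le> norm (indicat_real \<Omega> x + norm (D x) powr p)"
        using le1[of "norm (D x)" 1] p D0[of x] by (cases "x \<in> \<Omega>") auto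
    qed
  qed simp
  have weak: "(LINT y|lborel. v y * frechet_derivative \<phi> (at y) b) = - (LINT y|lborel. (D y \<bullet> b) * \<phi> y)"
    if \<phi>: "\<phi> \<in> test_functions \<Omega>" and b: "b \<in> Basis" for \<phi> b
  proof -
    note T = test_function_facts[OF \<phi>]
    have [measurable]: "(\<lambda>x. frechet_derivative \<phi> (at x) b) \<in> borel_measurable borel" "\<phi> \<in> borel_measurable borel"
      using T(2) T(3)[OF b] by (auto intro: borel_measurable_continuous_onI)
    have [measurable]: "(\<lambda>x. frechet_derivative \<phi> (at x) b) \<in> borel_measurable (lebesgue_on \<Omega>)" "\<phi> \<in> borel_measurable (lebesgue_on \<Omega>)"
      by (intro measurable_restrict_space1 measurable_completion; simp)+
    have "(LINT x|lebesgue_on \<Omega>. u x * frechet_derivative \<phi> (at x) b) = (LINT y|lborel. v y * frechet_derivative \<phi> (at y) b)"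
      by (rule lint) (use uv um(1) v0 in \<open>auto elim!: eventually_mono\<close>)
    moreover have "(LINT x|lebesgue_on \<Omega>. (Du x \<bullet> b) * \<phi> x) = (LINT y|lborel. (D y \<bullet> b) * \<phi> y)"
      by (rule lint) (use DuD Dm(1) D0 in \<open>auto elim!: eventually_mono\<close>)
    ultimately show ?thesis using wg \<phi> b by (simp add: has_weak_gradient_def)
  qed
  obtain c where c: "(\<integral>\<^sup>+x. ennreal (\<bar>v x - c\<bar> powr p) * indicator \<Omega> x \<partial>lborel) \<le> ennreal ((LINT y|lborel. norm (D y) powr p) / M)"
    using sobolev_poincare_convex[OF p m Zm dL L \<Omega> d vi Di Dp weak] unfolding M_def by blast
  define h where "h x = \<bar>v x\<bar> powr (p - 2) * v x" for x
  have hm [measurable]: "h \<in> borel_measurable borel" unfolding h_def by measurable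
  have abs: "\<bar>h x\<bar> = \<bar>v x\<bar> powr (p - 1)" for x
    using powr_add[of "\<bar>v x\<bar>" "p - 2" 1] by (cases "v x = 0") (auto simp: h_def abs_mult)
  have hi: "integrable lborel h"
  proof (rule Bochner_Integration.integrable_bound)
    show "integrable lborel (\<lambda>x. indicat_real \<Omega> x + \<bar>v x\<bar> powr p)" using i\<Omega> vp by auto
    show "AE x in lborel. norm (h x) \<le> norm (indicat_real \<Omega> x + \<bar>v x\<bar> powr p)"
    proof (rule AE_I2)
      fix x :: 'a
      show "norm (h x) \<le> norm (indicat_real \<Omega> x + \<bar>v x\<bar> powr p)"
        using le1[of "\<bar>v x\<bar>" "p - 1"] p v0[of x] abs[of x] by (cases "x \<in> \<Omega>") auto
    qed
  qed simp
  have h0: "(LINT x|lborel. h x) = 0"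
  proof -
    have "(LINT x|lebesgue_on \<Omega>. \<bar>u x\<bar> powr (p - 2) * u x) = (LINT x|lborel. h x)"
      by (rule lint) (use uv um(1) v0 in \<open>auto elim!: eventually_mono simp: h_def\<close>)
    then show ?thesis using mean by simp
  qed
  have finc: "integrable lborel (\<lambda>x. indicat_real \<Omega> x * \<bar>v x - c\<bar> powr p)"
  proof (rule integrableI_bounded)
    have "(\<integral>\<^sup>+x. ennreal (norm (indicat_real \<Omega> x * \<bar>v x - c\<bar> powr p)) \<partial>lborel) = (\<integral>\<^sup>+x. ennreal (\<bar>v x - c\<bar> powr p) * indicator \<Omega> x \<partial>lborel)"
      by (intro nn_integral_cong) (auto simp: indicator_def)
    also have "\<dots> < \<infinity>" using c by (rule le_less_trans) simp
    finally show "(\<integral>\<^sup>+x. ennreal (norm (indicat_real \<Omega> x * \<bar>v x - c\<bar> powr p)) \<partial>lborel) < \<infinity>" .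
  qed measurable
  have "(LINT x|lborel. \<bar>v x\<bar> powr p) = (LINT x|lborel. \<bar>v x\<bar> powr p - p * c * h x)"
    using vp hi h0 by simp
  also have "\<dots> \<le> (LINT x|lborel. indicat_real \<Omega> x * \<bar>v x - c\<bar> powr p)"
  proof (rule integral_mono[OF _ finc])
    show "integrable lborel (\<lambda>x. \<bar>v x\<bar> powr p - p * c * h x)" using vp hi by auto
    show "\<bar>v x\<bar> powr p - p * c * h x \<le> indicat_real \<Omega> x * \<bar>v x - c\<bar> powr p" for x
      using abs_powr_tangent[OF p, of "v x" c] v0[of x] p by (cases "x \<in> \<Omega>") (auto simp: h_def)
  qed
  also have "\<dots> \<le> (LINT y|lborel. norm (D y) powr p) / M"
  proof -
    have "ennreal (LINT x|lborel. indicat_real \<Omega> x * \<bar>v x - c\<bar> powr p) = (\<integral>\<^sup>+x. ennreal (indicat_real \<Omega> x * \<bar>v x - c\<bar> powr p) \<partial>lborel)"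
      using finc by (intro nn_integral_eq_integral[symmetric]) auto
    also have "\<dots> = (\<integral>\<^sup>+x. ennreal (\<bar>v x - c\<bar> powr p) * indicator \<Omega> x \<partial>lborel)"
      by (intro nn_integral_cong) (auto simp: indicator_def)
    finally have "ennreal (LINT x|lborel. indicat_real \<Omega> x * \<bar>v x - c\<bar> powr p) \<le> ennreal ((LINT y|lborel. norm (D y) powr p) / M)"
      using c by simp
    then show ?thesis using M by (subst (asm) ennreal_le_iff) auto
  qed
  finally have "M * (LINT x|lborel. \<bar>v x\<bar> powr p) \<le> (LINT y|lborel. norm (D y) powr p)"
    using M by (simp add: pos_le_divide_eq mult.commute)
  moreover have "(LINT x|lebesgue_on \<Omega>. \<bar>u x\<bar> powr p) = (LINT x|lborel. \<bar>v x\<bar> powr p)"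
    by (rule lint) (use uv um(1) v0 p in \<open>auto elim!: eventually_mono\<close>)
  moreover have "(LINT x|lebesgue_on \<Omega>. norm (Du x) powr p) = (LINT x|lborel. norm (D x) powr p)"
    by (rule lint) (use DuD Dm(1) D0 p in \<open>auto elim!: eventually_mono\<close>)
  ultimately show ?thesis by (simp add: M_def)
qed

text \<open>Difference quotients have integral zero by translation invariance, and they converge dominatedly.\<close>

lemma integral_directional_derivative_0:
  fixes F :: "'a::euclidean_space \<Rightarrow> real"
  assumes F: "\<And>x. (F has_derivative F' x) (at x)" and cont: "continuous_on UNIV (\<lambda>x. F' x b)"
    and supp: "\<And>x. R \<le> norm x \<Longrightarrow> F x = 0"
  shows "(LINT x|lborel. F' x b) = 0"
proof -
  have contF: "continuous_on UNIV F"
    by (intro continuous_at_imp_continuous_on ballI has_derivative_continuous[OF F])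
  then have [measurable]: "F \<in> borel_measurable borel" by (rule borel_measurable_continuous_onI)
  have [measurable]: "(\<lambda>x. F' x b) \<in> borel_measurable borel" using cont by (rule borel_measurable_continuous_onI)
  define Q where "Q = \<bar>R\<bar> + norm b"
  have "compact ((\<lambda>x. F' x b) ` cball 0 (Q + norm b))"
    by (rule compact_continuous_image) (auto intro: continuous_on_subset[OF cont])
  then have "bounded ((\<lambda>x. F' x b) ` cball 0 (Q + norm b))" by (rule compact_imp_bounded)
  then obtain C where C: "\<forall>y\<in>(\<lambda>x. F' x b) ` cball 0 (Q + norm b). norm y \<le> C" unfolding bounded_iff by blast
  have iF: "integrable lborel F"
  proof -
    have "integrable lborel (\<lambda>x. indicator (cball 0 \<bar>R\<bar>) x *\<^sub>R F x)"
      by (rule borel_integrable_compact) (auto intro: continuous_on_subset[OF contF])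
    moreover have "(\<lambda>x. indicator (cball 0 \<bar>R\<bar>) x *\<^sub>R F x) = F" using supp by (auto simp: fun_eq_iff indicator_def)
    ultimately show ?thesis by simp
  qed
  define t where "t n = inverse (real (Suc n))" for n
  have t: "0 < t n" "t n \<le> 1" for n by (auto simp: t_def inverse_le_1_iff)
  have t0: "t \<longlonglongrightarrow> 0" unfolding t_def by (rule LIMSEQ_inverse_real_of_nat)
  define q where "q n x = (F (x + t n *\<^sub>R b) - F x) / t n" for n x
  have line: "((\<lambda>s. F (x + s *\<^sub>R b)) has_real_derivative F' (x + s *\<^sub>R b) b) (at s)" for x s
  proof -
    have "((\<lambda>s. x + s *\<^sub>R b) has_derivative (\<lambda>h. h *\<^sub>R b)) (at s)" by (auto intro!: derivative_eq_intros)
    from has_derivative_compose[OF this F]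
    have "((\<lambda>s. F (x + s *\<^sub>R b)) has_derivative (\<lambda>h. F' (x + s *\<^sub>R b) (h *\<^sub>R b))) (at s)" .
    moreover have "F' y (h *\<^sub>R b) = F' y b * h" for h y
      using linear_simps(5)[OF has_derivative_bounded_linear[OF F[of y]], of h b] by (simp add: mult.commute)
    ultimately show ?thesis by (simp add: has_field_derivative_def)
  qed
  have "(\<lambda>n. LINT x|lborel. q n x) \<longlonglongrightarrow> (LINT x|lborel. F' x b)"
  proof (rule integral_dominated_convergence[where w = "\<lambda>x::'a. \<bar>C\<bar> * indicator (cball 0 Q) x"])
    show "integrable lborel (\<lambda>x::'a. \<bar>C\<bar> * indicat_real (cball 0 Q) x)"
      using bounded_emeasure_lborel_finite[OF bounded_cball[of "0::'a" Q]] by (intro integrable_mult_right) (simp add: integrable_indicator_iff)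
    show "AE x in lborel. (\<lambda>n. q n x) \<longlonglongrightarrow> F' x b"
    proof (rule AE_I2)
      fix x :: 'a
      have "((\<lambda>s. (F (x + s *\<^sub>R b) - F x) / s) \<longlongrightarrow> F' x b) (at 0)"
        using line[of x 0] by (simp add: DERIV_def)
      moreover have "filterlim t (at 0) sequentially"
        using t0 t(1) by (auto simp: filterlim_at less_imp_neq[symmetric])
      ultimately show "(\<lambda>n. q n x) \<longlonglongrightarrow> F' x b" unfolding q_def by (rule filterlim_compose)
    qed
    show "AE x in lborel. norm (q n x) \<le> \<bar>C\<bar> * indicat_real (cball 0 Q) x" for n
    proof (rule AE_I2)
      fix x :: 'a
      have tb: "norm (s *\<^sub>R b) \<le> norm b" if "0 \<le> s" "s \<le> 1" for s using that mult_left_le_one_le[of "norm b" s] by simp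
      show "norm (q n x) \<le> \<bar>C\<bar> * indicat_real (cball 0 Q) x"
      proof (cases "norm x \<le> Q")
        case True
        obtain s where s: "0 < s" "s < t n" "F (x + t n *\<^sub>R b) - F (x + 0 *\<^sub>R b) = (t n - 0) * F' (x + s *\<^sub>R b) b"
          using MVT2[OF t(1)[of n], of "\<lambda>s. F (x + s *\<^sub>R b)" "\<lambda>s. F' (x + s *\<^sub>R b) b"] line by blast
        have "norm (x + s *\<^sub>R b) \<le> Q + norm b"
          using norm_triangle_ineq[of x "s *\<^sub>R b"] tb[of s] s t(2)[of n] True by linarith
        then have "\<bar>F' (x + s *\<^sub>R b) b\<bar> \<le> C" using C by simp
        then show ?thesis using s t(1)[of n] True by (simp add: q_def)
      next
        case False
        have "norm x \<le> norm (x + t n *\<^sub>R b) + norm (t n *\<^sub>R b)" using norm_triangle_ineq4[of "x + t n *\<^sub>R b" "t n *\<^sub>R b"] by simp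
        then have "R \<le> norm (x + t n *\<^sub>R b)" "R \<le> norm x"
          using False tb[of "t n"] t[of n] norm_ge_zero[of b] unfolding Q_def by linarith+
        then show ?thesis using supp False by (simp add: q_def)
      qed
    qed
  qed (auto simp: q_def)
  moreover have "(LINT x|lborel. q n x) = 0" for n
  proof -
    have i2: "integrable lborel (\<lambda>x. F (x + t n *\<^sub>R b))" "(LINT x|lborel. F (x + t n *\<^sub>R b)) = (LINT x|lborel. F x)"
      using integral_translate(1,2)[of F "- (t n *\<^sub>R b)"] iF by simp_all
    then show ?thesis using iF by (simp add: q_def)
  qed
  ultimately show ?thesis by (simp add: LIMSEQ_const_iff)
qed

lemma in_Lp_continuous:
  fixes f :: "'a::euclidean_space \<Rightarrow> 'b::euclidean_space"
  assumes p: "1 < p" and \<Omega>: "open \<Omega>" "bounded \<Omega>" and f: "continuous_on UNIV f"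
  shows "in_Lp p \<Omega> f"
proof -
  have \<Omega>b: "\<Omega> \<in> sets borel" using \<Omega> by auto
  have fm: "f \<in> borel_measurable borel" using f by (rule borel_measurable_continuous_onI)
  have c: "continuous_on UNIV (\<lambda>x. norm (f x) powr p)"
    using p by (intro continuous_on_powr' continuous_intros f) auto
  have "integrable (lebesgue_on \<Omega>) (\<lambda>x. norm (f x) powr p)"
    using lebesgue_on_integral_borel(1)[OF \<Omega>b borel_measurable_continuous_onI[OF c]]
      set_integrable_continuous_bounded[OF c \<Omega>(2) \<Omega>b] by simp
  moreover have "f \<in> borel_measurable (lebesgue_on \<Omega>)"
    using fm by (intro measurable_restrict_space1 measurable_completion) simp
  ultimately show ?thesis by (simp add: in_Lp_def)
qed

text \<open>The weak gradient is found by integrating the derivative of \<open>(x \<bullet> a - c) \<phi>\<close>.\<close>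

lemma affine_in_W1p:
  fixes \<Omega> :: "'a::euclidean_space set"
  assumes p: "1 < p" and \<Omega>: "open \<Omega>" "bounded \<Omega>"
  shows "in_W1p p \<Omega> (\<lambda>x. x \<bullet> a - c) (\<lambda>x. a)"
proof -
  have \<Omega>b: "\<Omega> \<in> sets borel" using \<Omega> by auto
  have cu: "continuous_on UNIV (\<lambda>x. x \<bullet> a - c)" by (intro continuous_intros)
  have "has_weak_gradient (\<lambda>x. x \<bullet> a - c) (\<lambda>x. a) \<Omega>"
    unfolding has_weak_gradient_def
  proof (intro ballI)
    fix \<phi> and b :: 'a assume \<phi>: "\<phi> \<in> test_functions \<Omega>" and b: "b \<in> Basis"
    note T = test_function_facts[OF \<phi>]
    obtain R where R: "\<And>x. R \<le> norm x \<Longrightarrow> \<phi> x = 0" using T(6) by blast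
    define F1 F2 where "F1 x = (x \<bullet> a - c) * frechet_derivative \<phi> (at x) b" and "F2 x = (a \<bullet> b) * \<phi> x" for x
    have c12: "continuous_on UNIV F1" "continuous_on UNIV F2"
      unfolding F1_def F2_def by (intro continuous_intros T(3)[OF b] T(2))+
    have m12: "F1 \<in> borel_measurable borel" "F2 \<in> borel_measurable borel"
      using c12 by (auto intro: borel_measurable_continuous_onI)
    have z: "F1 x = 0" "F2 x = 0" if "x \<notin> \<Omega>" for x using T(4,5)[OF that] by (auto simp: F1_def F2_def)
    have ind: "(\<lambda>x. indicat_real \<Omega> x *\<^sub>R F1 x) = F1" "(\<lambda>x. indicat_real \<Omega> x *\<^sub>R F2 x) = F2"
      using z by (auto simp: fun_eq_iff indicator_def)
    have i12: "integrable lborel F1" "integrable lborel F2"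
      using set_integrable_continuous_bounded[OF c12(1) \<Omega>(2) \<Omega>b] set_integrable_continuous_bounded[OF c12(2) \<Omega>(2) \<Omega>b]
      by (simp_all add: set_integrable_def ind[unfolded real_scaleR_def])
    have d: "((\<lambda>x. (x \<bullet> a - c) * \<phi> x) has_derivative (\<lambda>v. (x \<bullet> a - c) * frechet_derivative \<phi> (at x) v + (v \<bullet> a) * \<phi> x)) (at x)" for x
    proof -
      have "((\<lambda>x. x \<bullet> a - c) has_derivative (\<lambda>v. v \<bullet> a)) (at x)" by (auto intro!: derivative_eq_intros)
      from has_derivative_mult[OF this T(1)] show ?thesis .
    qed
    have "(LINT x|lborel. (x \<bullet> a - c) * frechet_derivative \<phi> (at x) b + (b \<bullet> a) * \<phi> x) = 0"
      by (rule integral_directional_derivative_0[OF d, where R = R]) (auto intro!: continuous_intros T(3)[OF b] T(2) simp: R)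
    then have "(LINT x|lborel. F1 x + F2 x) = 0" by (simp add: F1_def F2_def inner_commute)
    then have "(LINT x|lborel. F1 x) = - (LINT x|lborel. F2 x)" using i12 by simp
    moreover have "(LINT x|lebesgue_on \<Omega>. F1 x) = (LINT x|lborel. F1 x)" "(LINT x|lebesgue_on \<Omega>. F2 x) = (LINT x|lborel. F2 x)"
      using lebesgue_on_integral_borel(2)[OF \<Omega>b m12(1)] lebesgue_on_integral_borel(2)[OF \<Omega>b m12(2)]
      by (simp_all only: set_lebesgue_integral_def ind)
    ultimately have "(LINT x|lebesgue_on \<Omega>. F1 x) = - (LINT x|lebesgue_on \<Omega>. F2 x)" by simp
    then show "(LINT x|lebesgue_on \<Omega>. (x \<bullet> a - c) * frechet_derivative \<phi> (at x) b) = - (LINT x|lebesgue_on \<Omega>. (a \<bullet> b) * \<phi> x)"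
      unfolding F1_def F2_def .
  qed
  then show ?thesis using in_Lp_continuous[OF p \<Omega> cu] in_Lp_continuous[OF p \<Omega> continuous_on_const[of UNIV a]] by (simp add: in_W1p_def)
qed

text \<open>The infimum of the empty set of reals carries no information, so the eigenvalue bound needs one
  admissible function: a linear function minus its \<open>p\<close>-mean.\<close>

lemma neumann_admissible_exists:
  fixes \<Omega> :: "'a::euclidean_space set"
  assumes p: "1 < p" and \<Omega>: "open \<Omega>" "bounded \<Omega>" "\<Omega> \<noteq> {}"
  shows "\<exists>u Du. in_W1p p \<Omega> u Du \<and> \<not> (AE x in lebesgue_on \<Omega>. u x = 0) \<and>
        (LINT x|lebesgue_on \<Omega>. \<bar>u x\<bar> powr (p - 2) * u x) = 0"
proof -
  obtain a :: 'a where a: "a \<in> Basis" using nonempty_Basis by blast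
  have a0: "a \<noteq> 0" using a by auto
  have \<Omega>b: "\<Omega> \<in> sets borel" using \<Omega> by auto
  have s: "\<Omega> \<inter> space lebesgue \<in> sets lebesgue" using \<Omega>b by auto
  have ca: "continuous_on UNIV (\<lambda>x. x \<bullet> a)" by (intro continuous_intros)
  obtain c where c: "(LINT x:\<Omega>|lborel. \<bar>x \<bullet> a - c\<bar> powr (p - 2) * (x \<bullet> a - c)) = 0"
    using exists_p_mean[OF p ca \<Omega>(1,2)] by blast
  have "continuous_on UNIV (\<lambda>x. \<bar>x \<bullet> a - c\<bar> powr (p - 2) * (x \<bullet> a - c))"
    by (intro continuous_signed_powr p continuous_intros)
  then have "(LINT x|lebesgue_on \<Omega>. \<bar>x \<bullet> a - c\<bar> powr (p - 2) * (x \<bullet> a - c)) = 0"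
    using lebesgue_on_integral_borel(2)[OF \<Omega>b borel_measurable_continuous_onI] c by metis
  moreover have "\<not> (AE x in lebesgue_on \<Omega>. x \<bullet> a - c = 0)"
  proof
    assume "AE x in lebesgue_on \<Omega>. x \<bullet> a - c = 0"
    then have "AE x in lebesgue. x \<in> \<Omega> \<longrightarrow> x \<bullet> a - c = 0" using s by (simp add: AE_restrict_space_iff)
    moreover have "AE x in lebesgue. x \<bullet> a \<noteq> c" by (rule AE_completion[OF AE_lborel_hyperplane[OF a0]])
    ultimately have "AE x in lebesgue. x \<notin> \<Omega>" by eventually_elim auto
    then have "\<Omega> \<in> null_sets lebesgue" using \<Omega>b by (subst AE_iff_null_sets) auto
    then show False using open_not_negligible[OF \<Omega>(1,3)] by (simp add: negligible_iff_null_sets)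
  qed
  ultimately show ?thesis using affine_in_W1p[OF p \<Omega>(1,2), of a c] by blast
qed

text \<open>With \<open>m = (\<pi>\<^sub>p / d')\<^sup>p / (p - 1)\<close> the blow-up time of \<open>z' = 1 + m z\<^sup>p\<close> is exactly \<open>d'/2\<close>, and any \<open>L\<close> strictly
  between the diameter and \<open>d'\<close> can be used.\<close>

lemma neumann_quotient_ge:
  fixes \<Omega> :: "'a::euclidean_space set" and u :: "'a \<Rightarrow> real" and Du :: "'a \<Rightarrow> 'a"
  assumes p: "1 < p" and \<Omega>: "open \<Omega>" "bounded \<Omega>" "convex \<Omega>" "\<Omega> \<noteq> {}"
    and W: "in_W1p p \<Omega> u Du" and mean: "(LINT x|lebesgue_on \<Omega>. \<bar>u x\<bar> powr (p - 2) * u x) = 0"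
    and d': "diameter \<Omega> < d'"
  shows "(pi_p p / d') powr p * (LINT x|lebesgue_on \<Omega>. \<bar>u x\<bar> powr p) \<le> (LINT x|lebesgue_on \<Omega>. norm (Du x) powr p)"
proof -
  define m where "m = (pi_p p / d') powr p / (p - 1)"
  have d0: "0 < d'" using d' diameter_ge_0[OF \<Omega>(2)] by linarith
  have pp: "0 < pi_p p" by (rule pi_p_pos[OF p])
  have m: "0 < m" using p pp d0 by (simp add: m_def)
  have "m powr (- 1 / p) = (p - 1) powr (1 / p) * (d' / pi_p p)"
  proof -
    have "m powr (- 1 / p) = ((pi_p p / d') powr p) powr (- 1 / p) / (p - 1) powr (- 1 / p)"
      unfolding m_def by (rule powr_divide)
    also have "((pi_p p / d') powr p) powr (- 1 / p) = d' / pi_p p"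
      using p pp d0 by (simp add: powr_powr powr_minus)
    also have "(p - 1) powr (- 1 / p) = 1 / (p - 1) powr (1 / p)" by (simp add: powr_minus_divide)
    finally show ?thesis by simp
  qed
  then have "2 * m powr (- 1 / p) * (pi / (p * sin (pi / p))) = (2 * pi * ((p - 1) powr (1 / p) / (p * sin (pi / p)))) * (d' / pi_p p)"
    by (simp only: mult_ac times_divide_eq_left times_divide_eq_right divide_divide_eq_left)
  also have "\<dots> = d'" unfolding pi_p_eq[OF p, symmetric] using pp by simp
  finally have eq: "2 * m powr (- 1 / p) * (pi / (p * sin (pi / p))) = d'" .
  define L where "L = (diameter \<Omega> + d') / 2"
  have L: "diameter \<Omega> < L" "L < d'" using d' by (auto simp: L_def)
  obtain Zm where Zm: "0 < Zm" "L / 2 \<le> integral {0..Zm} (\<lambda>z. 1 / (1 + m * z powr p))"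
    using integral_inverse_one_plus_powr[OF p m, of L] L(2) eq by auto
  have "(p - 1) * m * (LINT x|lebesgue_on \<Omega>. \<bar>u x\<bar> powr p) \<le> (LINT x|lebesgue_on \<Omega>. norm (Du x) powr p)"
    by (rule W1p_poincare[OF p m Zm(1) L(1) Zm(2) \<Omega> _ W mean]) (rule diameter_bounded_bound[OF \<Omega>(2)])
  then show ?thesis using p by (simp add: m_def)
qed

theorem theorem1p1:
  fixes \<Omega> :: "'a::euclidean_space set" and p d :: real
  assumes "\<Omega> \<noteq> {}" and "open \<Omega>" and "bounded \<Omega>" and "convex \<Omega>"
    and "diameter \<Omega> = d" and "2 \<le> p"
  shows "neumann_eigenvalue p \<Omega> \<ge> (pi_p p / d) powr p
    \<and> pi_p p = 2 * pi * ((p - 1) powr (1 / p) / (p * sin (pi / p)))"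
proof
  have p: "1 < p" using assms by simp
  show "pi_p p = 2 * pi * ((p - 1) powr (1 / p) / (p * sin (pi / p)))" by (rule pi_p_eq[OF p])
  let ?S = "{(LINT x|lebesgue_on \<Omega>. norm (Du x) powr p) / (LINT x|lebesgue_on \<Omega>. \<bar>u x\<bar> powr p) | u Du.
        in_W1p p \<Omega> u Du \<and> \<not> (AE x in lebesgue_on \<Omega>. u x = 0) \<and>
        (LINT x|lebesgue_on \<Omega>. \<bar>u x\<bar> powr (p - 2) * u x) = 0}"
  show "neumann_eigenvalue p \<Omega> \<ge> (pi_p p / d) powr p"
    unfolding neumann_eigenvalue_def
  proof (rule cInf_greatest)
    show "?S \<noteq> {}" using neumann_admissible_exists[OF p assms(2,3,1)] by blast
    fix Q assume "Q \<in> ?S"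
    then obtain u Du where W: "in_W1p p \<Omega> u Du" and nz: "\<not> (AE x in lebesgue_on \<Omega>. u x = 0)"
      and mean: "(LINT x|lebesgue_on \<Omega>. \<bar>u x\<bar> powr (p - 2) * u x) = 0"
      and Q: "Q = (LINT x|lebesgue_on \<Omega>. norm (Du x) powr p) / (LINT x|lebesgue_on \<Omega>. \<bar>u x\<bar> powr p)" by blast
    define U where "U = (LINT x|lebesgue_on \<Omega>. \<bar>u x\<bar> powr p)"
    have iu: "integrable (lebesgue_on \<Omega>) (\<lambda>x. \<bar>u x\<bar> powr p)" using W by (simp add: in_W1p_def in_Lp_def)
    have "U \<noteq> 0"
    proof
      assume "U = 0"
      then have "AE x in lebesgue_on \<Omega>. \<bar>u x\<bar> powr p = 0"
        using integral_nonneg_eq_0_iff_AE[OF iu] by (simp add: U_def)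
      with nz show False by simp
    qed
    moreover have "0 \<le> U" unfolding U_def by simp
    ultimately have U: "0 < U" by simp
    have ge: "(pi_p p / d') powr p \<le> Q" if "d < d'" for d'
    proof -
      have "(pi_p p / d') powr p * U \<le> (LINT x|lebesgue_on \<Omega>. norm (Du x) powr p)"
        unfolding U_def by (rule neumann_quotient_ge[OF p assms(2-4,1) W mean]) (use that assms(5) in simp)
      then show ?thesis using U by (simp add: Q U_def[symmetric] pos_le_divide_eq)
    qed
    show "(pi_p p / d) powr p \<le> Q"
    proof (cases "d = 0")
      \<comment> \<open>Division by zero makes the left-hand side \<open>0\<close>.\<close>
      case True
      then show ?thesis using U by (simp add: Q U_def[symmetric])
    next
      case False
      then have d: "0 < d" using diameter_ge_0[OF assms(3)] assms(5) by simp
      have "((\<lambda>d'. (pi_p p / d') powr p) \<longlongrightarrow> (pi_p p / d) powr p) (at_right d)"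
        using d pi_p_pos[OF p] by (intro tendsto_intros) auto
      then show ?thesis
        by (rule tendsto_upperbound) (auto simp: eventually_at_right_less intro!: eventually_mono[OF eventually_at_right_less] ge)
    qed
  qed
qed

end
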